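(* Let $\mathscr{A}=(\{\mathcal{A}_{s,t}\}_{0<s<t},\{\Delta_{r,s,t}\}_{0<r<s<t})$ be a unital $C^*$-subproduct system and $\mathscr{A}^\sharp=(\{\mathcal{A}^\sharp_{s,t}\}_{0<s<t},\{\Delta^\sharp_{r,s,t}\}_{0<r<s<t})$ be its inductive dilation. Let $\{p_{s,t}\}_{0<s<t}$ be a unit of $\mathscr{A}$, and $\{p^\sharp_{s,t}\}_{0<s<t}$ be the unit dilation of $\{p_{s,t}\}_{0<s<t}$. For any real numbers $0<u\le s<t\le v$, consider the $*$-monomorphism $\Delta^\sharp_{(s,t),(u,v)}:\mathcal{A}^\sharp_{s,t}\to\mathcal{A}^\sharp_{u,v}$ acting, for $x\in\mathcal{A}^\sharp_{s,t}$, as $$\Delta^\sharp_{(s,t),(u,v)}(x)=\begin{cases}x,&u=s<t=v\\(\Delta^\sharp_{s,t,v})^{-1}(x\otimes p^\sharp_{t,v}),&u=s<t<v\\(\Delta^\sharp_{u,s,t})^{-1}(p^\sharp_{u,s}\otimes x),&u<s<t=v\\(\Delta^\sharp_{u,s,v})^{-1}\big(\mathrm{id}_{\mathcal{A}^\sharp_{u,s}}\otimes\Delta^\sharp_{s,t,v}\big)^{-1}\big(p^\sharp_{u,s}\otimes x\otimes p^\sharp_{t,v}\big),&u<s<t<v.\end{cases}$$ Then the system $\{(\mathcal{A}^\sharp_{s,t},\Delta^\sharp_{(s,t),(u,v)})\,|\,(s,t)\in I_{(0,\infty)}\}$ is an inductive system of $C^*$-algebras over the partially ordered set $(I_{(0,\infty)},\subseteq)$,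 where $I_{(0,\infty)}$ is the set of all open intervals $(s,t)$, $0<s<t$, ordered by inclusion.
   Context: All tensor products of $C^*$-algebras are injective (minimal) tensor products; $\mathrm{id}$ denotes identity maps; a $*$-monomorphism is an injective $*$-homomorphism. A $C^*$-subproduct system is a pair $\mathscr{A}=(\{\mathcal{A}_{s,t}\}_{0<s<t},\{\Delta_{r,s,t}\}_{0<r<s<t})$ of $C^*$-algebras $\mathcal{A}_{s,t}$ and $*$-monomorphisms $\Delta_{r,s,t}:\mathcal{A}_{r,t}\to\mathcal{A}_{r,s}\otimes\mathcal{A}_{s,t}$ such that $(\mathrm{id}_{\mathcal{A}_{r,s}}\otimes\Delta_{s,t,u})\Delta_{r,s,u}=(\Delta_{r,s,t}\otimes\mathrm{id}_{\mathcal{A}_{t,u}})\Delta_{r,t,u}$ for all $0<r<s<t<u$; it is a $C^*$-product system if all $\Delta_{r,s,t}$ are $*$-isomorphisms. A unit of $\mathscr{A}$ is a family of non-zero projections $p_{s,t}\in\mathcal{A}_{s,t}$, $0<s<t$, with $\Delta_{r,s,t}(p_{r,t})=p_{r,s}\otimes p_{s,t}$ for all $0<r<s<t$; $\mathscr{A}$ is unital if it admits a unit. For $0<s<t$, $\mathcal{P}_{s,t}$ is the set, ordered by inclusion, of finite partitions $I=\{s=\iota_0<\iota_1<\dots<\iota_m<\iota_{m+1}=t\}$ of $[s,t]$ ($m\ge 0$). Put $\mathcal{A}_I=\mathcal{A}_{\iota_0,\iota_1}\otimes\cdots\otimes\mathcal{A}_{\iota_m,\iota_{m+1}}$. Define $\Delta_{\{s,t\},I}:\mathcal{A}_{s,t}\to\mathcal{A}_I$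 as the identity if $m=0$, as $\Delta_{\iota_0,\iota_1,\iota_2}$ if $m=1$, and as $(\Delta_{\{\iota_0,\iota_m\},I\setminus\{\iota_{m+1}\}}\otimes\mathrm{id}_{\mathcal{A}_{\iota_m,\iota_{m+1}}})\Delta_{\iota_0,\iota_m,\iota_{m+1}}$ if $m\ge2$. For $I\subseteq J$ in $\mathcal{P}_{s,t}$, with $I_i=J\cap[\iota_i,\iota_{i+1}]$, put $\Delta_{I,J}=\Delta_{\{\iota_0,\iota_1\},I_0}\otimes\cdots\otimes\Delta_{\{\iota_m,\iota_{m+1}\},I_m}:\mathcal{A}_I\to\mathcal{A}_J=\mathcal{A}_{I_0}\otimes\cdots\otimes\mathcal{A}_{I_m}$. Inductive dilation: $\mathcal{A}^\sharp_{s,t}$ is the $C^*$-inductive limit of the inductive system $\{(\mathcal{A}_I,\Delta_{I,J})\,|\,I\subseteq J\in\mathcal{P}_{s,t}\}$, with connecting $*$-monomorphisms $\Delta^\sharp_I:\mathcal{A}_I\to\mathcal{A}^\sharp_{s,t}$; write $\Delta^\sharp_{s,t}=\Delta^\sharp_{\{s,t\}}$. For $0<r<s<t$, $\Delta^\sharp_{r,s,t}:\mathcal{A}^\sharp_{r,t}\to\mathcal{A}^\sharp_{r,s}\otimes\mathcal{A}^\sharp_{s,t}$ is the unique $*$-isomorphism with $\Delta^\sharp_{r,s,t}\Delta^\sharp_{I\cup J}=\Delta^\sharp_I\otimes\Delta^\sharp_J$ for all $I\in\mathcal{P}_{r,s}$, $J\in\mathcal{P}_{s,t}$. The pair $\mathscr{A}^\sharp$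 is a $C^*$-product system. The unit dilation of $\{p_{s,t}\}$ is the unit $p^\sharp_{s,t}=\Delta^\sharp_{s,t}(p_{s,t})$ of $\mathscr{A}^\sharp$. *)

theory Defs
  imports "HOL-Analysis.Analysis"
begin

section \<open>C*-algebras on carrier sets\<close>

text \<open>
  Families of C*-algebras indexed by real numbers cannot be families of types, so a
  C*-algebra is a record of operations on a carrier inside a type \<open>'u\<close>. All C*-algebras
  occurring in one statement have their elements in the same type \<open>'u\<close>; as \<open>'u\<close> is
  arbitrary and any family of sets embeds into a common one, this only fixes a universe.
  The operations matter only on the carrier. No algebra is assumed to have an identity.
\<close>

record 'u cstar =
  carr :: "'u set"
  czero :: 'u
  cadd :: "'u \<Rightarrow> 'u \<Rightarrow> 'u"
  cscale :: "complex \<Rightarrow> 'u \<Rightarrow> 'u"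
  cmul :: "'u \<Rightarrow> 'u \<Rightarrow> 'u"
  cadj :: "'u \<Rightarrow> 'u"
  cnrm :: "'u \<Rightarrow> real"

definition cdist :: "'u cstar \<Rightarrow> 'u \<Rightarrow> 'u \<Rightarrow> real" where
  "cdist A x y = cnrm A (cadd A x (cscale A (-1) y))"

definition csum :: "'u cstar \<Rightarrow> 'u list \<Rightarrow> 'u" where
  "csum A xs = foldr (cadd A) xs (czero A)"

locale cstar_algebra =
  fixes A :: "'u cstar"
  assumes zero_closed: "czero A \<in> carr A"
    and add_closed: "\<lbrakk>x \<in> carr A; y \<in> carr A\<rbrakk> \<Longrightarrow> cadd A x y \<in> carr A"
    and scale_closed: "x \<in> carr A \<Longrightarrow> cscale A c x \<in> carr A"
    and mul_closed: "\<lbrakk>x \<in> carr A; y \<in> carr A\<rbrakk> \<Longrightarrow> cmul A x y \<in> carr A"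
    and adj_closed: "x \<in> carr A \<Longrightarrow> cadj A x \<in> carr A"
    and add_assoc: "\<lbrakk>x \<in> carr A; y \<in> carr A; z \<in> carr A\<rbrakk> \<Longrightarrow>
      cadd A (cadd A x y) z = cadd A x (cadd A y z)"
    and add_commute: "\<lbrakk>x \<in> carr A; y \<in> carr A\<rbrakk> \<Longrightarrow> cadd A x y = cadd A y x"
    and add_zero: "x \<in> carr A \<Longrightarrow> cadd A (czero A) x = x"
    and add_minus: "x \<in> carr A \<Longrightarrow> cadd A x (cscale A (-1) x) = czero A"
    and scale_add: "\<lbrakk>x \<in> carr A; y \<in> carr A\<rbrakk> \<Longrightarrow>
      cscale A c (cadd A x y) = cadd A (cscale A c x) (cscale A c y)"
    and add_scale: "x \<in> carr A \<Longrightarrow> cscale A (c + d) x = cadd A (cscale A c x) (cscale A d x)"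
    and scale_scale: "x \<in> carr A \<Longrightarrow> cscale A c (cscale A d x) = cscale A (c * d) x"
    and scale_one: "x \<in> carr A \<Longrightarrow> cscale A 1 x = x"
    and mul_assoc: "\<lbrakk>x \<in> carr A; y \<in> carr A; z \<in> carr A\<rbrakk> \<Longrightarrow>
      cmul A (cmul A x y) z = cmul A x (cmul A y z)"
    and mul_add: "\<lbrakk>x \<in> carr A; y \<in> carr A; z \<in> carr A\<rbrakk> \<Longrightarrow>
      cmul A x (cadd A y z) = cadd A (cmul A x y) (cmul A x z)"
    and add_mul: "\<lbrakk>x \<in> carr A; y \<in> carr A; z \<in> carr A\<rbrakk> \<Longrightarrow>
      cmul A (cadd A x y) z = cadd A (cmul A x z) (cmul A y z)"
    and scale_mul: "\<lbrakk>x \<in> carr A; y \<in> carr A\<rbrakk> \<Longrightarrow>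
      cmul A (cscale A c x) y = cscale A c (cmul A x y)"
    and mul_scale: "\<lbrakk>x \<in> carr A; y \<in> carr A\<rbrakk> \<Longrightarrow>
      cmul A x (cscale A c y) = cscale A c (cmul A x y)"
    and adj_adj: "x \<in> carr A \<Longrightarrow> cadj A (cadj A x) = x"
    and adj_add: "\<lbrakk>x \<in> carr A; y \<in> carr A\<rbrakk> \<Longrightarrow>
      cadj A (cadd A x y) = cadd A (cadj A x) (cadj A y)"
    and adj_scale: "x \<in> carr A \<Longrightarrow> cadj A (cscale A c x) = cscale A (cnj c) (cadj A x)"
    and adj_mul: "\<lbrakk>x \<in> carr A; y \<in> carr A\<rbrakk> \<Longrightarrow>
      cadj A (cmul A x y) = cmul A (cadj A y) (cadj A x)"
    and norm_nonneg: "x \<in> carr A \<Longrightarrow> 0 \<le> cnrm A x"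
    and norm_eq_zero: "x \<in> carr A \<Longrightarrow> cnrm A x = 0 \<longleftrightarrow> x = czero A"
    and norm_triangle: "\<lbrakk>x \<in> carr A; y \<in> carr A\<rbrakk> \<Longrightarrow>
      cnrm A (cadd A x y) \<le> cnrm A x + cnrm A y"
    and norm_scale: "x \<in> carr A \<Longrightarrow> cnrm A (cscale A c x) = cmod c * cnrm A x"
    and norm_mul: "\<lbrakk>x \<in> carr A; y \<in> carr A\<rbrakk> \<Longrightarrow> cnrm A (cmul A x y) \<le> cnrm A x * cnrm A y"
    and cstar_identity: "x \<in> carr A \<Longrightarrow> cnrm A (cmul A (cadj A x) x) = (cnrm A x)\<^sup>2"
    and complete: "\<lbrakk>\<And>n::nat. X n \<in> carr A;
        \<And>e. e > 0 \<Longrightarrow> \<exists>N. \<forall>m\<ge>N. \<forall>n\<ge>N. cdist A (X m) (X n) < e\<rbrakk> \<Longrightarrow>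
      \<exists>x\<in>carr A. (\<lambda>n. cdist A (X n) x) \<longlonglongrightarrow> 0"

definition clinear_map :: "'u cstar \<Rightarrow> 'u cstar \<Rightarrow> ('u \<Rightarrow> 'u) \<Rightarrow> bool" where
  "clinear_map A B f \<longleftrightarrow>
     (\<forall>x\<in>carr A. f x \<in> carr B) \<and>
     (\<forall>x\<in>carr A. \<forall>y\<in>carr A. f (cadd A x y) = cadd B (f x) (f y)) \<and>
     (\<forall>c. \<forall>x\<in>carr A. f (cscale A c x) = cscale B c (f x))"

definition star_hom :: "'u cstar \<Rightarrow> 'u cstar \<Rightarrow> ('u \<Rightarrow> 'u) \<Rightarrow> bool" where
  "star_hom A B f \<longleftrightarrow>
     clinear_map A B f \<and>
     (\<forall>x\<in>carr A. \<forall>y\<in>carr A. f (cmul A x y) = cmul B (f x) (f y)) \<and>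
     (\<forall>x\<in>carr A. f (cadj A x) = cadj B (f x))"

definition star_mono :: "'u cstar \<Rightarrow> 'u cstar \<Rightarrow> ('u \<Rightarrow> 'u) \<Rightarrow> bool" where
  "star_mono A B f \<longleftrightarrow> star_hom A B f \<and> inj_on f (carr A)"

definition star_iso :: "'u cstar \<Rightarrow> 'u cstar \<Rightarrow> ('u \<Rightarrow> 'u) \<Rightarrow> bool" where
  "star_iso A B f \<longleftrightarrow> star_hom A B f \<and> bij_betw f (carr A) (carr B)"

section \<open>Representations on Hilbert spaces\<close>

text \<open>
  Every Hilbert space is isometric to some \<open>\<ell>\<^sup>2('h)\<close>. For a C*-algebra with carrier inside
  \<open>'u\<close>, the cyclic representations live on spaces of dimension at most the cardinality of
  \<open>'u\<close>, so representations on \<open>\<ell>\<^sup>2('u)\<close> suffice to compute every spatial norm below.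
\<close>

definition ell2 :: "('h \<Rightarrow> complex) set" where
  "ell2 = {\<xi>. (\<lambda>z. (cmod (\<xi> z))\<^sup>2) summable_on UNIV}"

definition ell2_norm :: "('h \<Rightarrow> complex) \<Rightarrow> real" where
  "ell2_norm \<xi> = sqrt (\<Sum>\<^sub>\<infinity>z. (cmod (\<xi> z))\<^sup>2)"

definition ell2_inner :: "('h \<Rightarrow> complex) \<Rightarrow> ('h \<Rightarrow> complex) \<Rightarrow> complex" where
  "ell2_inner \<xi> \<eta> = (\<Sum>\<^sub>\<infinity>z. cnj (\<xi> z) * \<eta> z)"

definition bounded_operator :: "(('h \<Rightarrow> complex) \<Rightarrow> ('h \<Rightarrow> complex)) \<Rightarrow> bool" where
  "bounded_operator T \<longleftrightarrow>
     (\<forall>\<xi>\<in>ell2. T \<xi> \<in> ell2) \<and>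
     (\<forall>\<xi>\<in>ell2. \<forall>\<eta>\<in>ell2. T (\<lambda>z. \<xi> z + \<eta> z) = (\<lambda>z. T \<xi> z + T \<eta> z)) \<and>
     (\<forall>c. \<forall>\<xi>\<in>ell2. T (\<lambda>z. c * \<xi> z) = (\<lambda>z. c * T \<xi> z)) \<and>
     (\<exists>K. \<forall>\<xi>\<in>ell2. ell2_norm (T \<xi>) \<le> K * ell2_norm \<xi>)"

definition representation :: "'u cstar \<Rightarrow> ('u \<Rightarrow> ('h \<Rightarrow> complex) \<Rightarrow> ('h \<Rightarrow> complex)) \<Rightarrow> bool" where
  "representation A \<pi> \<longleftrightarrow>
     (\<forall>a\<in>carr A. bounded_operator (\<pi> a)) \<and>
     (\<forall>a\<in>carr A. \<forall>b\<in>carr A. \<forall>\<xi>\<in>ell2. \<pi> (cadd A a b) \<xi> = (\<lambda>z. \<pi> a \<xi> z + \<pi> b \<xi> z)) \<and>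
     (\<forall>c. \<forall>a\<in>carr A. \<forall>\<xi>\<in>ell2. \<pi> (cscale A c a) \<xi> = (\<lambda>z. c * \<pi> a \<xi> z)) \<and>
     (\<forall>a\<in>carr A. \<forall>b\<in>carr A. \<forall>\<xi>\<in>ell2. \<pi> (cmul A a b) \<xi> = \<pi> a (\<pi> b \<xi>)) \<and>
     (\<forall>a\<in>carr A. \<forall>\<xi>\<in>ell2. \<forall>\<eta>\<in>ell2.
        ell2_inner (\<pi> (cadj A a) \<xi>) \<eta> = ell2_inner \<xi> (\<pi> a \<eta>))"

section \<open>Minimal tensor products\<close>

text \<open>
  An element of the algebraic tensor product \<open>A\<^sub>1 \<odot> \<dots> \<odot> A\<^sub>n\<close> (\<open>n \<ge> 1\<close>) is given by a finite
  list of elementary tensors, standing for their sum; scalars are absorbed in a factor.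
\<close>

definition elementary :: "'u cstar list \<Rightarrow> 'u list set" where
  "elementary As = {as. list_all2 (\<lambda>a A. a \<in> carr A) as As}"

text \<open>
  The vector \<open>\<xi>\<^sub>1 \<otimes> \<dots> \<otimes> \<xi>\<^sub>n\<close> of the Hilbert space tensor product \<open>\<ell>\<^sup>2('h) \<otimes> \<dots> \<otimes> \<ell>\<^sup>2('h)\<close>, which
  is \<open>\<ell>\<^sup>2\<close> of the lists of length \<open>n\<close> (other lists get the value 0).
\<close>

definition tensor_vector :: "('h \<Rightarrow> complex) list \<Rightarrow> 'h list \<Rightarrow> complex" where
  "tensor_vector \<xi>s zs =
     (if length zs = length \<xi>s then (\<Prod>i<length \<xi>s. (\<xi>s ! i) (zs ! i)) else 0)"

definition vector_lists :: "nat \<Rightarrow> ('h \<Rightarrow> complex) list list set" where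
  "vector_lists n = {V. \<forall>\<xi>s\<in>set V. length \<xi>s = n \<and> set \<xi>s \<subseteq> ell2}"

text \<open>
  The operator norm of \<open>(\<pi>\<^sub>1 \<otimes> \<dots> \<otimes> \<pi>\<^sub>n)(x)\<close>, for \<open>x\<close> the sum of the elementary tensors in \<open>X\<close>.
  The supremum runs over the unit ball of the dense subspace of finite sums of vectors
  \<open>\<xi>\<^sub>1 \<otimes> \<dots> \<otimes> \<xi>\<^sub>n\<close>.
\<close>

definition spatial_norm ::
  "('u \<Rightarrow> ('h \<Rightarrow> complex) \<Rightarrow> ('h \<Rightarrow> complex)) list \<Rightarrow> 'u list list \<Rightarrow> real" where
  "spatial_norm \<pi>s X =
     Sup {ell2_norm (\<lambda>zs. \<Sum>as\<leftarrow>X. \<Sum>\<xi>s\<leftarrow>V.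
            tensor_vector (map (\<lambda>(\<pi>, a, \<xi>). \<pi> a \<xi>) (zip \<pi>s (zip as \<xi>s))) zs) | V.
          V \<in> vector_lists (length \<pi>s) \<and>
          ell2_norm (\<lambda>zs. \<Sum>\<xi>s\<leftarrow>V. tensor_vector \<xi>s zs) \<le> 1}"

definition min_norm :: "'u cstar list \<Rightarrow> 'u list list \<Rightarrow> real" where
  "min_norm As X = Sup {spatial_norm \<pi>s X | \<pi>s ::
     ('u \<Rightarrow> ('u \<Rightarrow> complex) \<Rightarrow> ('u \<Rightarrow> complex)) list. list_all2 representation As \<pi>s}"

text \<open>
  \<open>T\<close> is the completion of \<open>A\<^sub>1 \<odot> \<dots> \<odot> A\<^sub>n\<close> in the minimal norm, with \<open>a\<^sub>1 \<otimes> \<dots> \<otimes> a\<^sub>n\<close> being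
  \<open>\<tau> [a\<^sub>1, \<dots>, a\<^sub>n]\<close>.
\<close>

definition is_min_tensor :: "'u cstar list \<Rightarrow> 'u cstar \<Rightarrow> ('u list \<Rightarrow> 'u) \<Rightarrow> bool" where
  "is_min_tensor As T \<tau> \<longleftrightarrow>
     cstar_algebra T \<and>
     (\<forall>as\<in>elementary As. \<tau> as \<in> carr T) \<and>
     (\<forall>as\<in>elementary As. \<forall>i<length As. clinear_map (As ! i) T (\<lambda>x. \<tau> (as[i := x]))) \<and>
     (\<forall>as\<in>elementary As. \<forall>bs\<in>elementary As.
        \<tau> (map (\<lambda>(A, a, b). cmul A a b) (zip As (zip as bs))) = cmul T (\<tau> as) (\<tau> bs)) \<and>
     (\<forall>as\<in>elementary As. \<tau> (map (\<lambda>(A, a). cadj A a) (zip As as)) = cadj T (\<tau> as)) \<and>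
     (\<forall>X. set X \<subseteq> elementary As \<longrightarrow> cnrm T (csum T (map \<tau> X)) = min_norm As X) \<and>
     (\<forall>x\<in>carr T. \<forall>e>0. \<exists>X. set X \<subseteq> elementary As \<and> cdist T (csum T (map \<tau> X)) x < e)"

text \<open>
  A choice \<open>M\<close> of minimal tensor products, where \<open>tprod M [A\<^sub>1, \<dots>, A\<^sub>n]\<close> is
  \<open>A\<^sub>1 \<otimes> \<dots> \<otimes> A\<^sub>n\<close>. Multiple tensor products are formed in one step, so that the usual
  identifications \<open>(A \<otimes> B) \<otimes> C = A \<otimes> B \<otimes> C = A \<otimes> (B \<otimes> C)\<close> need no associators. The
  product of a single factor \<open>A\<close> is \<open>A\<close> itself. Such a choice exists whenever the
  cardinality of \<open>'u\<close> is not increased by forming sequences.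
\<close>

record 'u tensor_choice =
  tprod :: "'u cstar list \<Rightarrow> 'u cstar"
  telem :: "'u cstar list \<Rightarrow> 'u list \<Rightarrow> 'u"

definition min_tensor_products :: "'u tensor_choice \<Rightarrow> bool" where
  "min_tensor_products M \<longleftrightarrow>
     (\<forall>As. As \<noteq> [] \<longrightarrow> (\<forall>A\<in>set As. cstar_algebra A) \<longrightarrow>
        is_min_tensor As (tprod M As) (telem M As)) \<and>
     (\<forall>A. cstar_algebra A \<longrightarrow> tprod M [A] = A \<and> (\<forall>a\<in>carr A. telem M [A] [a] = a))"

text \<open>
  \<open>tjoin2 M As Bs x y\<close> is \<open>x \<otimes> y\<close>, for \<open>x \<in> A\<^sub>1 \<otimes> \<dots> \<otimes> A\<^sub>m\<close> and \<open>y \<in> B\<^sub>1 \<otimes> \<dots> \<otimes> B\<^sub>n\<close>, as an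
  element of \<open>A\<^sub>1 \<otimes> \<dots> \<otimes> A\<^sub>m \<otimes> B\<^sub>1 \<otimes> \<dots> \<otimes> B\<^sub>n\<close>: the bounded bilinear extension of
  the concatenation of elementary tensors (unique on the carriers, by density).
\<close>

definition is_tjoin2 ::
  "'u tensor_choice \<Rightarrow> 'u cstar list \<Rightarrow> 'u cstar list \<Rightarrow> ('u \<Rightarrow> 'u \<Rightarrow> 'u) \<Rightarrow> bool" where
  "is_tjoin2 M As Bs m \<longleftrightarrow>
     (\<forall>x\<in>carr (tprod M As). clinear_map (tprod M Bs) (tprod M (As @ Bs)) (\<lambda>y. m x y)) \<and>
     (\<forall>y\<in>carr (tprod M Bs). clinear_map (tprod M As) (tprod M (As @ Bs)) (\<lambda>x. m x y)) \<and>
     (\<exists>K. \<forall>x\<in>carr (tprod M As). \<forall>y\<in>carr (tprod M Bs).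
        cnrm (tprod M (As @ Bs)) (m x y) \<le> K * cnrm (tprod M As) x * cnrm (tprod M Bs) y) \<and>
     (\<forall>as\<in>elementary As. \<forall>bs\<in>elementary Bs.
        m (telem M As as) (telem M Bs bs) = telem M (As @ Bs) (as @ bs))"

definition tjoin2 :: "'u tensor_choice \<Rightarrow> 'u cstar list \<Rightarrow> 'u cstar list \<Rightarrow> 'u \<Rightarrow> 'u \<Rightarrow> 'u" where
  "tjoin2 M As Bs = (SOME m. is_tjoin2 M As Bs m)"

text \<open>
  \<open>tjoin M [As\<^sub>1, \<dots>, As\<^sub>n] [x\<^sub>1, \<dots>, x\<^sub>n]\<close> is \<open>x\<^sub>1 \<otimes> \<dots> \<otimes> x\<^sub>n\<close> in the tensor product of the
  concatenated list, where \<open>x\<^sub>i\<close> lies in the tensor product of the list \<open>As\<^sub>i\<close>.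
\<close>

fun tjoin :: "'u tensor_choice \<Rightarrow> 'u cstar list list \<Rightarrow> 'u list \<Rightarrow> 'u" where
  "tjoin M [As] [x] = x"
| "tjoin M (As # Bs # Css) (x # xs) =
     tjoin2 M As (concat (Bs # Css)) x (tjoin M (Bs # Css) xs)"
| "tjoin M _ _ = undefined"

text \<open>
  \<open>h\<close> is \<open>f\<^sub>1 \<otimes> \<dots> \<otimes> f\<^sub>n\<close>, where \<open>f\<^sub>i\<close> maps the tensor product of the list \<open>Ass ! i\<close> to that of
  the list \<open>Bss ! i\<close>.
\<close>

definition is_tensor_map :: "'u tensor_choice \<Rightarrow> 'u cstar list list \<Rightarrow> 'u cstar list list \<Rightarrow>
    ('u \<Rightarrow> 'u) list \<Rightarrow> ('u \<Rightarrow> 'u) \<Rightarrow> bool" where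
  "is_tensor_map M Ass Bss fs h \<longleftrightarrow>
     star_hom (tprod M (concat Ass)) (tprod M (concat Bss)) h \<and>
     (\<forall>xs\<in>elementary (map (tprod M) Ass).
        h (tjoin M Ass xs) = tjoin M Bss (map (\<lambda>(f, x). f x) (zip fs xs)))"

definition tensor_map :: "'u tensor_choice \<Rightarrow> 'u cstar list list \<Rightarrow> 'u cstar list list \<Rightarrow>
    ('u \<Rightarrow> 'u) list \<Rightarrow> 'u \<Rightarrow> 'u" where
  "tensor_map M Ass Bss fs = (SOME h. is_tensor_map M Ass Bss fs h)"

section \<open>Inductive systems and inductive limits\<close>

definition inductive_system ::
  "'i set \<Rightarrow> 'i rel \<Rightarrow> ('i \<Rightarrow> 'u cstar) \<Rightarrow> ('i \<Rightarrow> 'i \<Rightarrow> 'u \<Rightarrow> 'u) \<Rightarrow> bool" where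
  "inductive_system Idx r A \<phi> \<longleftrightarrow>
     Idx \<noteq> {} \<and> partial_order_on Idx r \<and>
     (\<forall>i\<in>Idx. \<forall>j\<in>Idx. \<exists>k\<in>Idx. (i, k) \<in> r \<and> (j, k) \<in> r) \<and>
     (\<forall>i\<in>Idx. cstar_algebra (A i)) \<and>
     (\<forall>i j. (i, j) \<in> r \<longrightarrow> star_hom (A i) (A j) (\<phi> i j)) \<and>
     (\<forall>i\<in>Idx. \<forall>x\<in>carr (A i). \<phi> i i x = x) \<and>
     (\<forall>i j k. (i, j) \<in> r \<longrightarrow> (j, k) \<in> r \<longrightarrow> (\<forall>x\<in>carr (A i). \<phi> j k (\<phi> i j x) = \<phi> i k x))"

text \<open>
  \<open>B\<close> is the completion of the algebraic inductive limit in the seminorm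
  \<open>\<parallel>\<psi>\<^sub>i(x)\<parallel> = lim\<^sub>j \<parallel>\<phi>\<^sub>i\<^sub>j(x)\<parallel>\<close>; the net is decreasing, so its limit is the infimum.
\<close>

definition inductive_limit ::
  "'i set \<Rightarrow> 'i rel \<Rightarrow> ('i \<Rightarrow> 'u cstar) \<Rightarrow> ('i \<Rightarrow> 'i \<Rightarrow> 'u \<Rightarrow> 'u) \<Rightarrow>
    'u cstar \<Rightarrow> ('i \<Rightarrow> 'u \<Rightarrow> 'u) \<Rightarrow> bool" where
  "inductive_limit Idx r A \<phi> B \<psi> \<longleftrightarrow>
     inductive_system Idx r A \<phi> \<and> cstar_algebra B \<and>
     (\<forall>i\<in>Idx. star_hom (A i) B (\<psi> i)) \<and>
     (\<forall>i j. (i, j) \<in> r \<longrightarrow> (\<forall>x\<in>carr (A i). \<psi> j (\<phi> i j x) = \<psi> i x)) \<and>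
     (\<forall>i\<in>Idx. \<forall>x\<in>carr (A i). cnrm B (\<psi> i x) = (INF j\<in>{j. (i, j) \<in> r}. cnrm (A j) (\<phi> i j x))) \<and>
     (\<forall>b\<in>carr B. \<forall>e>0. \<exists>i\<in>Idx. \<exists>x\<in>carr (A i). cdist B (\<psi> i x) b < e)"

section \<open>C*-subproduct systems\<close>

definition subproduct_system ::
  "'u tensor_choice \<Rightarrow> (real \<Rightarrow> real \<Rightarrow> 'u cstar) \<Rightarrow> (real \<Rightarrow> real \<Rightarrow> real \<Rightarrow> 'u \<Rightarrow> 'u) \<Rightarrow> bool" where
  "subproduct_system M A \<Delta> \<longleftrightarrow>
     (\<forall>s t. 0 < s \<and> s < t \<longrightarrow> cstar_algebra (A s t)) \<and>
     (\<forall>r s t. 0 < r \<and> r < s \<and> s < t \<longrightarrow>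
        star_mono (A r t) (tprod M [A r s, A s t]) (\<Delta> r s t)) \<and>
     (\<forall>r s t u. 0 < r \<and> r < s \<and> s < t \<and> t < u \<longrightarrow> (\<forall>x\<in>carr (A r u).
        tensor_map M [[A r s], [A s u]] [[A r s], [A s t, A t u]] [id, \<Delta> s t u] (\<Delta> r s u x) =
        tensor_map M [[A r t], [A t u]] [[A r s, A s t], [A t u]] [\<Delta> r s t, id] (\<Delta> r t u x)))"

definition system_unit ::
  "'u tensor_choice \<Rightarrow> (real \<Rightarrow> real \<Rightarrow> 'u cstar) \<Rightarrow> (real \<Rightarrow> real \<Rightarrow> real \<Rightarrow> 'u \<Rightarrow> 'u) \<Rightarrow>
    (real \<Rightarrow> real \<Rightarrow> 'u) \<Rightarrow> bool" where
  "system_unit M A \<Delta> p \<longleftrightarrow>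
     (\<forall>s t. 0 < s \<and> s < t \<longrightarrow>
        p s t \<in> carr (A s t) \<and> p s t \<noteq> czero (A s t) \<and>
        cmul (A s t) (p s t) (p s t) = p s t \<and> cadj (A s t) (p s t) = p s t) \<and>
     (\<forall>r s t. 0 < r \<and> r < s \<and> s < t \<longrightarrow>
        \<Delta> r s t (p r t) = telem M [A r s, A s t] [p r s, p s t])"

definition unital_system ::
  "'u tensor_choice \<Rightarrow> (real \<Rightarrow> real \<Rightarrow> 'u cstar) \<Rightarrow> (real \<Rightarrow> real \<Rightarrow> real \<Rightarrow> 'u \<Rightarrow> 'u) \<Rightarrow> bool" where
  "unital_system M A \<Delta> \<longleftrightarrow> (\<exists>p. system_unit M A \<Delta> p)"

section \<open>The inductive dilation\<close>

definition partitions :: "real \<Rightarrow> real \<Rightarrow> real set set" where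
  "partitions s t = {I. finite I \<and> {s, t} \<subseteq> I \<and> I \<subseteq> {s..t}}"

definition partition_order :: "real \<Rightarrow> real \<Rightarrow> real set rel" where
  "partition_order s t = {(I, J). I \<in> partitions s t \<and> J \<in> partitions s t \<and> I \<subseteq> J}"

text \<open>The pairs \<open>(\<iota>\<^sub>i, \<iota>\<^sub>i\<^sub>+\<^sub>1)\<close> of neighbouring points of a partition, in increasing order.\<close>

definition steps :: "real set \<Rightarrow> (real \<times> real) list" where
  "steps I = (let l = sorted_list_of_set I in zip l (tl l))"

definition factors :: "(real \<Rightarrow> real \<Rightarrow> 'u cstar) \<Rightarrow> real set \<Rightarrow> 'u cstar list" where
  "factors A I = map (\<lambda>(a, b). A a b) (steps I)"

definition part_alg ::
  "'u tensor_choice \<Rightarrow> (real \<Rightarrow> real \<Rightarrow> 'u cstar) \<Rightarrow> real set \<Rightarrow> 'u cstar" where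
  "part_alg M A I = tprod M (factors A I)"

text \<open>
  The map \<open>\<Delta>\<^bsub>{s,t},I\<^esub>\<close>, by recursion on the points of \<open>I\<close> listed in decreasing order
  \<open>t = \<iota>\<^bsub>m+1\<^esub> > \<iota>\<^sub>m > \<dots> > \<iota>\<^sub>0 = s\<close>.
\<close>

fun split_list :: "'u tensor_choice \<Rightarrow> (real \<Rightarrow> real \<Rightarrow> 'u cstar) \<Rightarrow>
    (real \<Rightarrow> real \<Rightarrow> real \<Rightarrow> 'u \<Rightarrow> 'u) \<Rightarrow> real list \<Rightarrow> 'u \<Rightarrow> 'u" where
  "split_list M A \<Delta> (t # i # j # k # l) =
     (let s = last (k # l) in
        tensor_map M [[A s i], [A i t]] [factors A (set (i # j # k # l)), [A i t]]
          [split_list M A \<Delta> (i # j # k # l), id] \<circ> \<Delta> s i t)"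
| "split_list M A \<Delta> [t, i, s] = \<Delta> s i t"
| "split_list M A \<Delta> _ = id"

definition split_map :: "'u tensor_choice \<Rightarrow> (real \<Rightarrow> real \<Rightarrow> 'u cstar) \<Rightarrow>
    (real \<Rightarrow> real \<Rightarrow> real \<Rightarrow> 'u \<Rightarrow> 'u) \<Rightarrow> real set \<Rightarrow> 'u \<Rightarrow> 'u" where
  "split_map M A \<Delta> I = split_list M A \<Delta> (rev (sorted_list_of_set I))"

definition refine_map :: "'u tensor_choice \<Rightarrow> (real \<Rightarrow> real \<Rightarrow> 'u cstar) \<Rightarrow>
    (real \<Rightarrow> real \<Rightarrow> real \<Rightarrow> 'u \<Rightarrow> 'u) \<Rightarrow> real set \<Rightarrow> real set \<Rightarrow> 'u \<Rightarrow> 'u" where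
  "refine_map M A \<Delta> I J =
     tensor_map M (map (\<lambda>(a, b). [A a b]) (steps I))
       (map (\<lambda>(a, b). factors A (J \<inter> {a..b})) (steps I))
       (map (\<lambda>(a, b). split_map M A \<Delta> (J \<inter> {a..b})) (steps I))"

text \<open>
  \<open>(A\<^sup>\<sharp>, \<Delta>\<^sup>\<sharp>)\<close> is an inductive dilation of \<open>(A, \<Delta>)\<close> with connecting maps
  \<open>\<Delta>\<^sup>\<sharp>\<^sub>I = \<iota> I\<close>. Inductive limits are determined up to isomorphism only, hence a predicate.
  The last clause says \<open>\<Delta>\<^sup>\<sharp>\<^bsub>r,s,t\<^esub> \<circ> \<Delta>\<^sup>\<sharp>\<^bsub>I \<union> J\<^esub> = \<Delta>\<^sup>\<sharp>\<^sub>I \<otimes> \<Delta>\<^sup>\<sharp>\<^sub>J\<close>, and determines \<open>\<Delta>\<^sup>\<sharp>\<^bsub>r,s,t\<^esub>\<close>.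
\<close>

definition inductive_dilation :: "'u tensor_choice \<Rightarrow>
    (real \<Rightarrow> real \<Rightarrow> 'u cstar) \<Rightarrow> (real \<Rightarrow> real \<Rightarrow> real \<Rightarrow> 'u \<Rightarrow> 'u) \<Rightarrow>
    (real \<Rightarrow> real \<Rightarrow> 'u cstar) \<Rightarrow> (real \<Rightarrow> real \<Rightarrow> real \<Rightarrow> 'u \<Rightarrow> 'u) \<Rightarrow> (real set \<Rightarrow> 'u \<Rightarrow> 'u) \<Rightarrow> bool" where
  "inductive_dilation M A \<Delta> A\<^sub>d \<Delta>\<^sub>d \<iota> \<longleftrightarrow>
     (\<forall>s t. 0 < s \<and> s < t \<longrightarrow>
        inductive_limit (partitions s t) (partition_order s t) (part_alg M A) (refine_map M A \<Delta>)
          (A\<^sub>d s t) \<iota> \<and>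
        (\<forall>I\<in>partitions s t. star_mono (part_alg M A I) (A\<^sub>d s t) (\<iota> I))) \<and>
     (\<forall>r s t. 0 < r \<and> r < s \<and> s < t \<longrightarrow>
        star_iso (A\<^sub>d r t) (tprod M [A\<^sub>d r s, A\<^sub>d s t]) (\<Delta>\<^sub>d r s t) \<and>
        (\<forall>I\<in>partitions r s. \<forall>J\<in>partitions s t.
           is_tensor_map M [factors A I, factors A J] [[A\<^sub>d r s], [A\<^sub>d s t]] [\<iota> I, \<iota> J]
             (\<Delta>\<^sub>d r s t \<circ> \<iota> (I \<union> J))))"

definition unit_dilation :: "(real set \<Rightarrow> 'u \<Rightarrow> 'u) \<Rightarrow> (real \<Rightarrow> real \<Rightarrow> 'u) \<Rightarrow> real \<Rightarrow> real \<Rightarrow> 'u" where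
  "unit_dilation \<iota> p s t = \<iota> {s, t} (p s t)"

section \<open>Embeddings along a unit\<close>

definition intervals :: "(real \<times> real) set" where
  "intervals = {(s, t). 0 < s \<and> s < t}"

definition interval_order :: "(real \<times> real) rel" where
  "interval_order = {((s, t), (u, v)). (s, t) \<in> intervals \<and> (u, v) \<in> intervals \<and>
     {s<..<t} \<subseteq> {u<..<v}}"

text \<open>
  The four cases for \<open>u \<le> s < t \<le> v\<close>, applied below to \<open>A\<^sup>\<sharp>\<close>, \<open>\<Delta>\<^sup>\<sharp>\<close> and \<open>p\<^sup>\<sharp>\<close>.
\<close>

definition unit_embedding :: "'u tensor_choice \<Rightarrow>
    (real \<Rightarrow> real \<Rightarrow> 'u cstar) \<Rightarrow> (real \<Rightarrow> real \<Rightarrow> real \<Rightarrow> 'u \<Rightarrow> 'u) \<Rightarrow> (real \<Rightarrow> real \<Rightarrow> 'u) \<Rightarrow>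
    real \<times> real \<Rightarrow> real \<times> real \<Rightarrow> 'u \<Rightarrow> 'u" where
  "unit_embedding M A \<Delta> p = (\<lambda>(s, t) (u, v) x.
     if u = s \<and> t = v then x
     else if u = s then
       inv_into (carr (A s v)) (\<Delta> s t v) (telem M [A s t, A t v] [x, p t v])
     else if t = v then
       inv_into (carr (A u t)) (\<Delta> u s t) (telem M [A u s, A s t] [p u s, x])
     else
       inv_into (carr (A u v)) (\<Delta> u s v)
         (inv_into (carr (tprod M [A u s, A s v]))
           (tensor_map M [[A u s], [A s v]] [[A u s], [A s t, A t v]] [id, \<Delta> s t v])
           (telem M [A u s, A s t, A t v] [p u s, x, p t v])))"

end

theory Submission
  imports Defs
begin

text \<open>
  Write \<open>L\<close> and \<open>R\<close> for the one-sided embeddings \<open>x \<mapsto> (\<Delta>\<^sup>\<sharp>)\<^sup>-\<^sup>1(p\<^sup>\<sharp> \<otimes> x)\<close> and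
  \<open>x \<mapsto> (\<Delta>\<^sup>\<sharp>)\<^sup>-\<^sup>1(x \<otimes> p\<^sup>\<sharp>)\<close>. On the dense set of elements \<open>\<Delta>\<^sup>\<sharp>\<^sub>J(y)\<close> they only insert unit
  projections of the original system at one end of the partition \<open>J\<close>, so \<open>L L = L\<close>, \<open>R R = R\<close> and
  \<open>L R = R L\<close> follow from associativity of \<open>\<otimes>\<close> and \<open>\<Delta>(p) = p \<otimes> p\<close>. The general embedding is
  \<open>L R\<close>; for the two-sided formula this needs that \<open>id \<otimes> \<Delta>\<^sup>\<sharp>\<close> exists and is injective.

  Existence of tensor products of maps rests on the fact that the product representations of a
  minimal tensor product are jointly isometric: a map into it is determined by, and can be
  prescribed through, its composites with them. Injectivity of \<open>id \<otimes> f\<close> follows by slice maps.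
\<close>

section \<open>The Hilbert space of square-summable families\<close>

text \<open>A completed minimal tensor product is known only through its norm, so the values of a
  map into it are found as limits, and identities between them are tested in representations. The
  representations that enter the norm act on square-summable families over \<open>'u\<close>, and
  their direct sum would leave this universe; hence a whole family of product representations stands
  in wherever one faithful representation would usually do. A product representation acts on
  families over lists. To reuse it as a representation of a single factor, lists are coded
  injectively by elements of \<open>'u\<close>. This is possible because the unit is nonzero: its
  complex multiples make \<open>'u\<close> infinite.

  Apart from one-factor products, the only tensor product of maps to be constructed is
  \<open>id \<otimes> \<Delta>\<^sub>d\<close>, in the two-sided case. Injectivity of such a map is
  usually proved by extending representations from a subalgebra; slices by matrix coefficients avoid
  any extension. Algebras may lack an identity, so even the contractivity of representations is
  obtained by an iteration inside the algebra.\<close>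

lemma ell2_add:
  assumes "\<xi> \<in> ell2" "\<eta> \<in> ell2"
  shows "(\<lambda>z. \<xi> z + \<eta> z) \<in> ell2"
proof -
  have "(\<lambda>z. 2 * (cmod (\<xi> z))\<^sup>2 + 2 * (cmod (\<eta> z))\<^sup>2) summable_on UNIV"
    using assms by (intro summable_on_add summable_on_cmult_right) (auto simp: ell2_def)
  moreover have "(cmod (a + b))\<^sup>2 \<le> 2 * (cmod a)\<^sup>2 + 2 * (cmod b)\<^sup>2" for a b
  proof -
    have "(cmod (a + b))\<^sup>2 \<le> (cmod a + cmod b)\<^sup>2"
      by (intro power_mono norm_triangle_ineq) auto
    also have "\<dots> \<le> 2 * (cmod a)\<^sup>2 + 2 * (cmod b)\<^sup>2"
      using sum_squares_bound[of "cmod a" "cmod b"] by (simp add: power2_sum)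
    finally show ?thesis .
  qed
  ultimately show ?thesis
    unfolding ell2_def by (auto intro: summable_on_comparison_test)
qed

lemma ell2_scale: "\<xi> \<in> ell2 \<Longrightarrow> (\<lambda>z. c * \<xi> z) \<in> ell2"
  unfolding ell2_def by (auto simp: norm_mult power_mult_distrib intro: summable_on_cmult_right)

lemma ell2_zero: "(\<lambda>z. 0) \<in> ell2"
  by (simp add: ell2_def)

lemma ell2_product_summable:
  assumes "\<xi> \<in> ell2" "\<eta> \<in> ell2"
  shows "(\<lambda>z. cnj (\<xi> z) * \<eta> z) summable_on UNIV"
proof -
  have "(\<lambda>z. (cmod (\<xi> z))\<^sup>2 + (cmod (\<eta> z))\<^sup>2) summable_on UNIV"
    using assms by (intro summable_on_add) (auto simp: ell2_def)
  moreover have "norm (cnj a * b) \<le> (cmod a)\<^sup>2 + (cmod b)\<^sup>2" for a b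
  proof -
    have "0 \<le> cmod a * cmod b"
      by simp
    then have "cmod a * cmod b \<le> (cmod a)\<^sup>2 + (cmod b)\<^sup>2"
      using sum_squares_bound[of "cmod a" "cmod b"] by linarith
    then show ?thesis
      by (simp add: norm_mult)
  qed
  ultimately have "(\<lambda>z. norm (cnj (\<xi> z) * \<eta> z)) summable_on UNIV"
    by (rule summable_on_comparison_test) auto
  then show ?thesis
    by (rule abs_summable_summable)
qed

text \<open>Finite partial sums control both membership and norm, so the operators and limits below
  are constructed from estimates on finite sums.\<close>

lemma ell2_boundI:
  assumes "\<And>F. finite F \<Longrightarrow> (\<Sum>z\<in>F. (cmod (\<xi> z))\<^sup>2) \<le> K\<^sup>2" and "0 \<le> K"
  shows "\<xi> \<in> ell2" and "ell2_norm \<xi> \<le> K"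
proof -
  show *: "\<xi> \<in> ell2"
    unfolding ell2_def using assms
    by (auto intro!: nonneg_bdd_above_summable_on bdd_aboveI2[where M = "K\<^sup>2"])
  then have "(\<Sum>\<^sub>\<infinity>z. (cmod (\<xi> z))\<^sup>2) \<le> K\<^sup>2"
    using assms by (intro infsum_le_finite_sums) (auto simp: ell2_def)
  then show "ell2_norm \<xi> \<le> K"
    unfolding ell2_norm_def using assms by (simp add: real_le_lsqrt)
qed

lemma ell2_sum_le:
  assumes "\<xi> \<in> ell2" "finite F"
  shows "(\<Sum>z\<in>F. (cmod (\<xi> z))\<^sup>2) \<le> (ell2_norm \<xi>)\<^sup>2"
  using assms finite_sum_le_infsum[of "\<lambda>z. (cmod (\<xi> z))\<^sup>2" UNIV F]
  by (simp add: ell2_norm_def ell2_def infsum_nonneg)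

text \<open>As a complete normed type, the square-summable families carry the type
  \<open>blinfun\<close> of bounded operators, which is complete in turn; product representations
  will be found as limits there.\<close>

typedef 'a l2 = "ell2 :: ('a \<Rightarrow> complex) set"
  morphisms coord Abs_l2
  using ell2_zero by blast

lemma coord_ell2 [simp]: "coord x \<in> ell2"
  by (rule coord)

lemma l2_eqI: "(\<And>z. coord x z = coord y z) \<Longrightarrow> x = y"
  by (metis coord_inject ext)

instantiation l2 :: (type) real_inner
begin

definition "0 = Abs_l2 (\<lambda>z. 0)"
definition "x + y = Abs_l2 (\<lambda>z. coord x z + coord y z)"
definition "- x = Abs_l2 (\<lambda>z. - coord x z)"
definition "x - y = Abs_l2 (\<lambda>z. coord x z - coord y z)" for x y :: "'a l2"
definition "r *\<^sub>R x = Abs_l2 (\<lambda>z. of_real r * coord x z)"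
definition "norm x = ell2_norm (coord x)"
definition "inner x y = Re (ell2_inner (coord x) (coord y))"
definition "dist x y = norm (x - y)" for x y :: "'a l2"
definition "sgn x = inverse (norm x) *\<^sub>R x" for x :: "'a l2"
definition "uniformity = (INF e\<in>{0<..}. principal {(x, y::'a l2). dist x y < e})"
definition "open U = (\<forall>x\<in>U. \<forall>\<^sub>F (x', y) in uniformity. x' = x \<longrightarrow> y \<in> U)" for U :: "'a l2 set"

lemma coord_zero: "coord 0 = (\<lambda>z. 0)"
  by (simp add: zero_l2_def Abs_l2_inverse ell2_zero)

lemma coord_add: "coord (x + y) = (\<lambda>z. coord x z + coord y z)"
  by (simp add: plus_l2_def Abs_l2_inverse ell2_add)

lemma coord_uminus: "coord (- x) = (\<lambda>z. - coord x z)"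
  using ell2_scale[of "coord x" "-1"] by (simp add: uminus_l2_def Abs_l2_inverse)

lemma coord_diff: "coord (x - y) = (\<lambda>z. coord x z - coord y z)"
  using ell2_add[OF coord_ell2[of x] coord_ell2[of "- y"]]
  by (simp add: minus_l2_def Abs_l2_inverse coord_uminus)

lemma coord_scaleR: "coord (r *\<^sub>R x) = (\<lambda>z. of_real r * coord x z)"
  by (simp add: scaleR_l2_def Abs_l2_inverse ell2_scale)

lemma l2_inner_self: "inner x x = (\<Sum>\<^sub>\<infinity>z. (cmod (coord x z))\<^sup>2)" for x :: "'a l2"
proof -
  have "Re (\<Sum>\<^sub>\<infinity>z. cnj (coord x z) * coord x z) = (\<Sum>\<^sub>\<infinity>z. Re (cnj (coord x z) * coord x z))"
    by (rule infsum_Re[symmetric]) (intro ell2_product_summable coord)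
  then show ?thesis
    by (simp add: inner_l2_def ell2_inner_def cmod_power2 flip: power2_eq_square)
qed

instance
proof
  fix x y z :: "'a l2" and r s :: real
  show "dist x y = norm (x - y)" by (rule dist_l2_def)
  show "sgn x = scaleR (inverse (norm x)) x" by (rule sgn_l2_def)
  show "uniformity = (INF e\<in>{0<..}. principal {(x, y::'a l2). dist x y < e})"
    by (rule uniformity_l2_def)
  show "open U = (\<forall>x\<in>U. \<forall>\<^sub>F (x', y) in uniformity. x' = x \<longrightarrow> y \<in> U)" for U :: "'a l2 set"
    by (rule open_l2_def)
  have summ: "(\<lambda>z. cnj (coord x z) * coord y z) summable_on UNIV" for x y :: "'a l2"
    by (intro ell2_product_summable coord)
  show "inner x y = inner y x"
  proof -
    have "inner y x = Re (cnj (\<Sum>\<^sub>\<infinity>z. cnj (coord x z) * coord y z))"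
      unfolding inner_l2_def ell2_inner_def infsum_cnj[symmetric] by (simp add: mult.commute)
    then show ?thesis
      by (simp add: inner_l2_def ell2_inner_def)
  qed
  show "inner (x + y) z = inner x z + inner y z"
    by (simp add: inner_l2_def ell2_inner_def coord_add distrib_right infsum_add summ)
  show "inner (r *\<^sub>R x) y = r * inner x y"
  proof -
    have "ell2_inner (coord (r *\<^sub>R x)) (coord y) = of_real r * ell2_inner (coord x) (coord y)"
      by (simp add: ell2_inner_def coord_scaleR mult.assoc infsum_cmult_right')
    then show ?thesis
      by (simp add: inner_l2_def)
  qed
  show "0 \<le> inner x x"
    by (simp add: l2_inner_self infsum_nonneg)
  show "inner x x = 0 \<longleftrightarrow> x = 0"
  proof
    assume "inner x x = 0"
    then have "(cmod (coord x z))\<^sup>2 = 0" for z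
      using coord[of x] by (intro nonneg_infsum_le_0D[of _ UNIV]) (auto simp: l2_inner_self ell2_def)
    then show "x = 0"
      by (intro l2_eqI) (simp add: coord_zero)
  qed (simp add: l2_inner_self coord_zero)
  show "norm x = sqrt (inner x x)"
    by (simp add: norm_l2_def ell2_norm_def l2_inner_self)
qed (intro l2_eqI; simp add: coord_add coord_uminus coord_diff coord_scaleR coord_zero algebra_simps)+

end

lemmas coord_simps [simp] = coord_zero coord_add coord_uminus coord_diff coord_scaleR

lemma coord_sum [simp]: "coord (\<Sum>i\<in>S. f i) z = (\<Sum>i\<in>S. coord (f i) z)"
  by (induction S rule: infinite_finite_induct) auto

lemma coord_sum_list [simp]: "coord (\<Sum>i\<leftarrow>S. f i) z = (\<Sum>i\<leftarrow>S. coord (f i) z)"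
  by (induction S) auto

lemma l2_boundI:
  assumes "\<And>F. finite F \<Longrightarrow> (\<Sum>z\<in>F. (cmod (\<xi> z))\<^sup>2) \<le> K\<^sup>2" and "0 \<le> K"
  obtains x where "coord x = \<xi>" "norm x \<le> K"
  using ell2_boundI[OF assms] by (metis coord_cases norm_l2_def)

lemma l2_sum_le: "finite F \<Longrightarrow> (\<Sum>z\<in>F. (cmod (coord x z))\<^sup>2) \<le> (norm x)\<^sup>2"
  by (simp add: ell2_sum_le norm_l2_def)

lemma norm_coord_le: "cmod (coord x z) \<le> norm x"
  using l2_sum_le[of "{z}" x] by (simp add: power2_le_iff_abs_le)

lemma norm_l2_square: "(norm x)\<^sup>2 = (\<Sum>\<^sub>\<infinity>z. (cmod (coord x z))\<^sup>2)"
  by (rule trans[OF power2_norm_eq_inner l2_inner_self])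

lemma l2_summable: "(\<lambda>z. (cmod (coord x z))\<^sup>2) summable_on A"
  using coord[of x] summable_on_subset_banach[of _ UNIV A] by (auto simp: ell2_def)

lemma bounded_linear_coord: "bounded_linear (\<lambda>x. coord x z)"
  by (rule bounded_linear_intro[where K = 1]) (auto simp: scaleR_conv_of_real norm_coord_le)

instance l2 :: (type) banach
proof
  fix X :: "nat \<Rightarrow> 'a l2"
  assume C: "Cauchy X"
  have "Cauchy (\<lambda>n. coord (X n) z)" for z
    by (rule bounded_linear.Cauchy[OF bounded_linear_coord C])
  then have "\<forall>z. \<exists>l. (\<lambda>n. coord (X n) z) \<longlonglongrightarrow> l"
    by (simp add: Cauchy_convergent_iff convergent_def)
  then obtain g where g: "\<And>z. (\<lambda>n. coord (X n) z) \<longlonglongrightarrow> g z"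
    by metis
  \<comment> \<open>As in Fatou's lemma: the estimate for \<open>X n - X m\<close> holds on each
    finite set of coordinates and survives the coordinatewise limit in \<open>m\<close>. In
    particular the difference from \<open>g\<close> is square-summable, although \<open>g\<close> is
    not yet known to be.\<close>
  have key: "\<exists>y. coord y = (\<lambda>z. coord (X n) z - g z) \<and> norm y \<le> e"
    if N: "\<forall>m\<ge>N. \<forall>n\<ge>N. dist (X m) (X n) < e" and n: "n \<ge> N" for e N n
  proof -
    have "0 \<le> e"
      using N by (meson dist_not_less_zero less_le_trans linear not_le order_refl)
    have "(\<Sum>z\<in>F. (cmod (coord (X n) z - g z))\<^sup>2) \<le> e\<^sup>2" if F: "finite F" for F
    proof (rule LIMSEQ_le_const2)
      show "(\<lambda>m. \<Sum>z\<in>F. (cmod (coord (X n) z - coord (X m) z))\<^sup>2)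
          \<longlonglongrightarrow> (\<Sum>z\<in>F. (cmod (coord (X n) z - g z))\<^sup>2)"
        by (intro tendsto_intros g)
      have "(\<Sum>z\<in>F. (cmod (coord (X n) z - coord (X m) z))\<^sup>2) \<le> e\<^sup>2" if "m \<ge> N" for m
      proof -
        have "(\<Sum>z\<in>F. (cmod (coord (X n) z - coord (X m) z))\<^sup>2) \<le> (norm (X n - X m))\<^sup>2"
          using l2_sum_le[OF F, of "X n - X m"] by simp
        also have "\<dots> \<le> e\<^sup>2"
          using N n that by (intro power_mono) (auto simp: dist_norm less_imp_le)
        finally show ?thesis .
      qed
      then show "\<exists>N. \<forall>m\<ge>N. (\<Sum>z\<in>F. (cmod (coord (X n) z - coord (X m) z))\<^sup>2) \<le> e\<^sup>2"
        by blast
    qed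
    then show ?thesis
      using \<open>0 \<le> e\<close> by (metis l2_boundI)
  qed
  obtain N1 where "\<forall>m\<ge>N1. \<forall>n\<ge>N1. dist (X m) (X n) < 1"
    using C by (metis Cauchy_def zero_less_one)
  then obtain y where y: "coord y = (\<lambda>z. coord (X N1) z - g z)"
    using key by blast
  \<comment> \<open>Hence \<open>g\<close> is the difference of two elements of the space, and so is
    itself one.\<close>
  have lim: "coord (X N1 - y) = g"
    by (simp add: y)
  have "X \<longlonglongrightarrow> X N1 - y"
  proof (rule LIMSEQ_I)
    fix e :: real assume "e > 0"
    then obtain N where N: "\<forall>m\<ge>N. \<forall>n\<ge>N. dist (X m) (X n) < e / 2"
      using C by (metis Cauchy_def half_gt_zero)
    have "norm (X n - (X N1 - y)) < e" if n: "n \<ge> N" for n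
    proof -
      obtain w where w: "coord w = (\<lambda>z. coord (X n) z - g z)" "norm w \<le> e / 2"
        using key[OF N n] by blast
      have "w = X n - (X N1 - y)"
        by (rule l2_eqI) (use w lim in \<open>simp add: fun_eq_iff\<close>)
      then show ?thesis
        using w \<open>e > 0\<close> by auto
    qed
    then show "\<exists>N. \<forall>n\<ge>N. norm (X n - (X N1 - y)) < e"
      by blast
  qed
  then show "convergent X"
    by (auto simp: convergent_def)
qed

section \<open>Basis vectors, truncations and complex scalars\<close>

definition basis_vec :: "'a \<Rightarrow> 'a l2" where
  "basis_vec w = Abs_l2 (\<lambda>z. if z = w then 1 else 0)"

definition restrict_l2 :: "'a set \<Rightarrow> 'a l2 \<Rightarrow> 'a l2" where
  "restrict_l2 S x = Abs_l2 (\<lambda>z. if z \<in> S then coord x z else 0)"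

definition scaleC :: "complex \<Rightarrow> 'a l2 \<Rightarrow> 'a l2" where
  "scaleC c x = Abs_l2 (\<lambda>z. c * coord x z)"

lemma coord_scaleC [simp]: "coord (scaleC c x) = (\<lambda>z. c * coord x z)"
  by (simp add: scaleC_def Abs_l2_inverse ell2_scale)

lemma coord_restrict_l2 [simp]: "coord (restrict_l2 S x) = (\<lambda>z. if z \<in> S then coord x z else 0)"
  and norm_restrict_l2_le: "norm (restrict_l2 S x) \<le> norm x"
proof -
  let ?f = "\<lambda>z. if z \<in> S then coord x z else 0"
  have *: "(\<Sum>z\<in>F. (cmod (?f z))\<^sup>2) \<le> (norm x)\<^sup>2" if "finite F" for F
    by (rule order_trans[OF sum_mono l2_sum_le[OF that]]) auto
  obtain y where y: "coord y = ?f" "norm y \<le> norm x"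
    by (rule l2_boundI[OF *]) auto
  then have "restrict_l2 S x = y"
    unfolding restrict_l2_def using coord_inverse[of y] by simp
  then show "coord (restrict_l2 S x) = ?f" "norm (restrict_l2 S x) \<le> norm x"
    using y by auto
qed

lemma coord_basis_vec [simp]: "coord (basis_vec w) = (\<lambda>z. if z = w then 1 else 0)"
proof -
  have "(cmod (if z = w then 1 else 0))\<^sup>2 = (if z = w then 1 else 0)" for z
    by simp
  then have "(\<lambda>z. if z = w then 1 else 0) \<in> ell2"
    by (intro ell2_boundI(1)[where K = 1]) (simp_all add: sum.delta)
  then show ?thesis
    by (simp add: basis_vec_def Abs_l2_inverse)
qed

lemma norm_scaleC: "norm (scaleC c x) = cmod c * norm x"
proof -
  have "(norm (scaleC c x))\<^sup>2 = (cmod c * norm x)\<^sup>2"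
    by (simp add: norm_l2_square power_mult_distrib norm_mult infsum_cmult_right')
  then show ?thesis
    by (simp add: power2_eq_iff_nonneg)
qed

lemma scaleC_of_real: "scaleC (of_real r) x = r *\<^sub>R x"
  by (rule l2_eqI) simp

lemma scaleC_scaleC [simp]: "scaleC c (scaleC d x) = scaleC (c * d) x"
  by (rule l2_eqI) simp

lemma scaleC_one [simp]: "scaleC 1 x = x"
  by (rule l2_eqI) simp

lemma scaleC_add: "scaleC c (x + y) = scaleC c x + scaleC c y"
  by (rule l2_eqI) (simp add: distrib_left)

lemma restrict_l2_finite:
  assumes "finite S"
  shows "restrict_l2 S x = (\<Sum>z\<in>S. scaleC (coord x z) (basis_vec z))"
  by (rule l2_eqI) (use assms in \<open>simp add: if_distrib sum.delta' cong: if_cong\<close>)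

text \<open>The squared norm of the tail is the difference between the full sum of squares and a
  finite partial sum.\<close>

lemma restrict_l2_approx:
  assumes "0 < e"
  obtains S where "finite S" "norm (x - restrict_l2 S x) < e"
proof -
  have "((\<lambda>z. (cmod (coord x z))\<^sup>2) has_sum (norm x)\<^sup>2) UNIV"
    unfolding norm_l2_square by (rule has_sum_infsum) (rule l2_summable)
  then have "((\<lambda>S. \<Sum>z\<in>S. (cmod (coord x z))\<^sup>2) \<longlongrightarrow> (norm x)\<^sup>2) (finite_subsets_at_top UNIV)"
    by (simp add: has_sum_def)
  then have "\<forall>\<^sub>F S in finite_subsets_at_top UNIV. dist (\<Sum>z\<in>S. (cmod (coord x z))\<^sup>2) ((norm x)\<^sup>2) < e\<^sup>2"
    by (rule tendstoD) (use assms in simp)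
  then obtain S where S: "finite S" "dist (\<Sum>z\<in>S. (cmod (coord x z))\<^sup>2) ((norm x)\<^sup>2) < e\<^sup>2"
    by (auto simp: eventually_finite_subsets_at_top)
  have "(norm x)\<^sup>2 = (\<Sum>\<^sub>\<infinity>z\<in>S. (cmod (coord x z))\<^sup>2) + (\<Sum>\<^sub>\<infinity>z\<in>-S. (cmod (coord x z))\<^sup>2)"
    unfolding norm_l2_square by (subst infsum_Un_disjoint[symmetric]) (auto intro: l2_summable)
  also have "(\<Sum>\<^sub>\<infinity>z\<in>-S. (cmod (coord x z))\<^sup>2) = (norm (x - restrict_l2 S x))\<^sup>2"
    unfolding norm_l2_square by (rule infsum_cong_neutral) auto
  finally have "(norm (x - restrict_l2 S x))\<^sup>2 < e\<^sup>2"
    using S by (simp add: dist_real_def)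
  then have "norm (x - restrict_l2 S x) < e"
    using assms by (simp add: power2_less_imp_less)
  with S that show ?thesis
    by blast
qed

section \<open>Operators and their matrix entries\<close>

text \<open>
  The library type of bounded linear maps is real linear; complex linearity is the predicate \<open>clin\<close>.
\<close>

type_synonym 'a op = "'a l2 \<Rightarrow>\<^sub>L 'a l2"

definition clin :: "('a l2 \<Rightarrow>\<^sub>L 'b l2) \<Rightarrow> bool" where
  "clin T \<longleftrightarrow> (\<forall>c x. T (scaleC c x) = scaleC c (T x))"

definition entry :: "('a l2 \<Rightarrow>\<^sub>L 'b l2) \<Rightarrow> 'b \<Rightarrow> 'a \<Rightarrow> complex" where
  "entry T z w = coord (T (basis_vec w)) z"

lemma clinD: "clin T \<Longrightarrow> T (scaleC c x) = scaleC c (T x)"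
  by (simp add: clin_def)

lemma clin_compose: "clin T \<Longrightarrow> clin S \<Longrightarrow> clin (T o\<^sub>L S)"
  by (simp add: clin_def)

lemma clin_add: "clin T \<Longrightarrow> clin S \<Longrightarrow> clin (T + S)"
  by (simp add: clin_def blinfun.add_left scaleC_add)

lemma clin_zero: "clin 0"
  unfolding clin_def by (auto intro!: l2_eqI)

text \<open>\<open>f\<close> and \<open>g\<close> are only real linear, so they have to agree on all
  complex multiples of basis vectors; finite sums of these are dense.\<close>

lemma bounded_linear_eq_on_l2:
  assumes f: "bounded_linear f" and g: "bounded_linear g"
    and eq: "\<And>c z. f (scaleC c (basis_vec z)) = g (scaleC c (basis_vec z))"
  shows "f x = g x"
proof -
  define h where "h = (\<lambda>x. f x - g x)"
  have h: "bounded_linear h"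
    unfolding h_def by (rule bounded_linear_sub[OF f g])
  interpret h: bounded_linear h by (rule h)
  have "norm (h x) \<le> e" if "e > 0" for e
  proof -
    obtain K where K: "K > 0" "\<And>x. norm (h x) \<le> norm x * K"
      using h.pos_bounded by blast
    have "0 < e / K"
      using that K by simp
    then obtain S where S: "finite S" "norm (x - restrict_l2 S x) < e / K"
      by (rule restrict_l2_approx)
    have "h (restrict_l2 S x) = 0"
      using S by (simp add: restrict_l2_finite h.sum) (simp add: h_def eq)
    then have "norm (h x) = norm (h (x - restrict_l2 S x))"
      by (simp add: h.diff)
    also have "\<dots> \<le> norm (x - restrict_l2 S x) * K"
      by (rule K)
    also have "\<dots> \<le> e"
      using S K by (simp add: field_simps)
    finally show ?thesis .
  qed
  then have "norm (h x) \<le> 0"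
    by (rule field_le_epsilon[of _ 0, simplified])
  then show ?thesis
    by (simp add: h_def)
qed

text \<open>Identities between complex linear operators reduce to their matrices. For tensor
  products the entries are products of numbers, which turns bilinearity, commutation and
  associativity into computations with complex numbers.\<close>

lemma op_eqI:
  assumes "clin T" "clin S" "\<And>z w. entry T z w = entry S z w"
  shows "T = S"
proof (rule blinfun_eqI)
  fix x
  have *: "T (basis_vec z) = S (basis_vec z)" for z
    by (rule l2_eqI) (use assms in \<open>simp add: entry_def\<close>)
  show "T x = S x"
    by (rule bounded_linear_eq_on_l2[OF blinfun.bounded_linear_right blinfun.bounded_linear_right])
      (use assms in \<open>simp add: clinD *\<close>)
qed

lemma entry_zero [simp]: "entry 0 z w = 0"
  by (simp add: entry_def)

lemma entry_add: "entry (T + S) z w = entry T z w + entry S z w"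
  by (simp add: entry_def blinfun.add_left)

lemma norm_basis_vec: "norm (basis_vec w) = 1"
proof -
  have "(norm (basis_vec w))\<^sup>2 = (\<Sum>\<^sub>\<infinity>z\<in>{w}. 1)"
    unfolding norm_l2_square by (rule infsum_cong_neutral) auto
  then show ?thesis
    by (simp add: power2_eq_1_iff) (smt (verit) norm_ge_zero)
qed

lemma norm_entry_le: "cmod (entry T z w) \<le> norm T"
  unfolding entry_def
  using norm_coord_le[of "T (basis_vec w)" z] norm_blinfun[of T "basis_vec w"]
  by (simp add: norm_basis_vec)

lemma bounded_linear_scaleC: "bounded_linear (scaleC c)"
  by (rule bounded_linear_intro[where K = "cmod c"])
    (auto simp: scaleC_add norm_scaleC scaleC_of_real[symmetric] mult_ac)

lemma clin_limit:
  assumes "X \<longlonglongrightarrow> T" "\<And>n. clin (X n)"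
  shows "clin T"
  unfolding clin_def
proof (intro allI)
  fix c x
  have "(\<lambda>n. X n (scaleC c x)) \<longlonglongrightarrow> T (scaleC c x)"
    by (intro bounded_linear.tendsto[OF blinfun.bounded_linear_left] assms)
  moreover have "(\<lambda>n. scaleC c (X n x)) \<longlonglongrightarrow> scaleC c (T x)"
    by (intro bounded_linear.tendsto[OF bounded_linear_scaleC]
      bounded_linear.tendsto[OF blinfun.bounded_linear_left] assms)
  ultimately show "T (scaleC c x) = scaleC c (T x)"
    using assms LIMSEQ_unique by (simp add: clin_def)
qed

text \<open>The relation of being adjoint, as conjugate transposition of matrices. In this form it
  passes through \<open>transport\<close> and \<open>op_tensor\<close> entry by entry, without any
  infinite sum.\<close>

definition adjoint_entries :: "('a l2 \<Rightarrow>\<^sub>L 'b l2) \<Rightarrow> ('b l2 \<Rightarrow>\<^sub>L 'a l2) \<Rightarrow> bool" where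
  "adjoint_entries T T' \<longleftrightarrow> (\<forall>z w. entry T' w z = cnj (entry T z w))"

lemma ell2_inner_basis_vec: "ell2_inner (coord (scaleC c (basis_vec z))) (coord y) = cnj c * coord y z"
proof -
  have "ell2_inner (coord (scaleC c (basis_vec z))) (coord y) = (\<Sum>\<^sub>\<infinity>w\<in>{z}. cnj c * coord y w)"
    unfolding ell2_inner_def by (rule infsum_cong_neutral) auto
  then show ?thesis
    by simp
qed

lemma inner_basis_vec: "inner (scaleC c (basis_vec z)) y = Re (cnj c * coord y z)"
  using ell2_inner_basis_vec[of c z y] by (simp only: inner_l2_def)

lemma ell2_inner_commute: "ell2_inner \<xi> \<eta> = cnj (ell2_inner \<eta> \<xi>)"
  unfolding ell2_inner_def infsum_cnj[symmetric] by (simp add: mult.commute)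

text \<open>The imaginary part of an inner product is the real part of the one with
  \<open>\<i>\<close> times its first argument, so equality of real inner products suffices for maps
  that commute with \<open>\<i>\<close>.\<close>

lemma ell2_inner_eqI:
  assumes "\<And>x y. inner (f x) (g y) = inner (h x) (k y)"
    and f: "f (scaleC \<i> x) = scaleC \<i> (f x)" and h: "h (scaleC \<i> x) = scaleC \<i> (h x)"
  shows "ell2_inner (coord (f x)) (coord (g y)) = ell2_inner (coord (h x)) (coord (k y))"
proof (rule complex_eqI)
  have Im: "Im (ell2_inner (coord u) (coord v)) = inner (scaleC \<i> u) v" for u :: "'x l2" and v
  proof -
    have "ell2_inner (coord (scaleC \<i> u)) (coord v) = - \<i> * ell2_inner (coord u) (coord v)"
      by (simp add: ell2_inner_def mult.assoc infsum_cmult_right' infsum_uminus)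
    then show ?thesis
      by (simp add: inner_l2_def)
  qed
  show "Im (ell2_inner (coord (f x)) (coord (g y))) = Im (ell2_inner (coord (h x)) (coord (k y)))"
    unfolding Im using assms(1)[of "scaleC \<i> x" y] by (simp add: f h)
qed (use assms(1) in \<open>simp add: inner_l2_def\<close>)

text \<open>From entries to vectors: density is applied in one argument after the other to the real
  inner product, and \<open>ell2_inner_eqI\<close> restores the imaginary part. Conversely, entries
  are inner products with basis vectors.\<close>

lemma adjoint_entries_iff:
  assumes "clin T" "clin T'"
  shows "adjoint_entries T T' \<longleftrightarrow>
    (\<forall>x y. ell2_inner (coord (T' x)) (coord y) = ell2_inner (coord x) (coord (T y)))"
proof
  assume adj: "adjoint_entries T T'"
  have "inner (T' (scaleC c (basis_vec z))) (scaleC d (basis_vec w))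
      = inner (scaleC c (basis_vec z)) (T (scaleC d (basis_vec w)))" for c d z w
  proof -
    have "inner (T' (scaleC c (basis_vec z))) (scaleC d (basis_vec w)) = Re (cnj d * (c * entry T' w z))"
      using inner_basis_vec[of d w "T' (scaleC c (basis_vec z))"] assms
      by (simp add: inner_commute clinD entry_def)
    also have "\<dots> = Re (cnj c * (d * entry T z w))"
      using adj by (simp add: adjoint_entries_def) (simp add: algebra_simps)
    also have "\<dots> = inner (scaleC c (basis_vec z)) (T (scaleC d (basis_vec w)))"
      using inner_basis_vec[of c z "T (scaleC d (basis_vec w))"] assms by (simp add: clinD entry_def)
    finally show ?thesis .
  qed
  then have "inner (T' x) (scaleC d (basis_vec w)) = inner x (T (scaleC d (basis_vec w)))" for x d w
    by (rule bounded_linear_eq_on_l2[rotated 2]) (auto intro: blinfun.bounded_linear_right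
        bounded_linear_inner_left_comp bounded_linear_inner_right_comp bounded_linear_inner_right bounded_linear_ident)
  then have "inner (T' x) y = inner x (T y)" for x y
    by (rule bounded_linear_eq_on_l2[rotated 2]) (auto intro: blinfun.bounded_linear_right
        bounded_linear_inner_left_comp bounded_linear_inner_right_comp bounded_linear_inner_right bounded_linear_ident)
  then show "\<forall>x y. ell2_inner (coord (T' x)) (coord y) = ell2_inner (coord x) (coord (T y))"
    using assms by (intro allI ell2_inner_eqI[of "\<lambda>x. T' x" "\<lambda>y. y" "\<lambda>x. x"]) (auto simp: clinD)
next
  assume *: "\<forall>x y. ell2_inner (coord (T' x)) (coord y) = ell2_inner (coord x) (coord (T y))"
  have "entry T' w z = cnj (entry T z w)" for z w
  proof -
    have "cnj (entry T' w z) = entry T z w"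
      using *[rule_format, of "basis_vec z" "basis_vec w"]
        ell2_inner_basis_vec[of 1 z "T (basis_vec w)"] ell2_inner_basis_vec[of 1 w "T' (basis_vec z)"]
        ell2_inner_commute[of "coord (T' (basis_vec z))" "coord (basis_vec w)"]
      by (simp add: entry_def)
    then show ?thesis
      by (metis complex_cnj_cnj)
  qed
  then show "adjoint_entries T T'"
    by (simp add: adjoint_entries_def)
qed

definition op_of :: "('a l2 \<Rightarrow> 'b \<Rightarrow> complex) \<Rightarrow> 'a l2 \<Rightarrow>\<^sub>L 'b l2" where
  "op_of \<Phi> = Blinfun (\<lambda>x. Abs_l2 (\<Phi> x))"

text \<open>One bound on finite sums gives everything at once: square-summable values, boundedness
  and the norm estimate. The operators \<open>cmult\<close>, \<open>down\<close>, \<open>up\<close>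
  and \<open>amplify\<close> are obtained in this way.\<close>

lemma op_of:
  assumes add: "\<And>x y z. \<Phi> (x + y) z = \<Phi> x z + \<Phi> y z"
    and scale: "\<And>c x z. \<Phi> (scaleC c x) z = c * \<Phi> x z"
    and bound: "\<And>x F. finite F \<Longrightarrow> (\<Sum>z\<in>F. (cmod (\<Phi> x z))\<^sup>2) \<le> (K * norm x)\<^sup>2" and K: "0 \<le> K"
  shows coord_op_of: "coord (op_of \<Phi> x) = \<Phi> x"
    and clin_op_of: "clin (op_of \<Phi>)" and norm_op_of: "norm (op_of \<Phi>) \<le> K"
proof -
  have *: "coord (Abs_l2 (\<Phi> x)) = \<Phi> x \<and> norm (Abs_l2 (\<Phi> x)) \<le> K * norm x" for x
  proof -
    obtain y where "coord y = \<Phi> x" "norm y \<le> K * norm x"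
      by (rule l2_boundI[of "\<Phi> x" "K * norm x"]) (use bound K in auto)
    then show ?thesis
      by (metis coord_inverse)
  qed
  have "bounded_linear (\<lambda>x. Abs_l2 (\<Phi> x))"
  proof (rule bounded_linear_intro)
    show "Abs_l2 (\<Phi> (x + y)) = Abs_l2 (\<Phi> x) + Abs_l2 (\<Phi> y)" for x y
      by (rule l2_eqI) (simp add: * add)
    show "Abs_l2 (\<Phi> (r *\<^sub>R x)) = r *\<^sub>R Abs_l2 (\<Phi> x)" for r x
      by (rule l2_eqI) (simp add: * scale scaleC_of_real[symmetric] del: coord_scaleR)
    show "norm (Abs_l2 (\<Phi> x)) \<le> norm x * K" for x
      using * by (simp add: mult.commute)
  qed
  then have app: "op_of \<Phi> x = Abs_l2 (\<Phi> x)" for x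
    by (simp add: op_of_def bounded_linear_Blinfun_apply)
  show "coord (op_of \<Phi> x) = \<Phi> x"
    by (simp add: app *)
  show "clin (op_of \<Phi>)"
    unfolding clin_def app by (auto intro!: l2_eqI simp: * scale)
  show "norm (op_of \<Phi>) \<le> K"
    by (rule norm_blinfun_bound) (use K * in \<open>auto simp: app\<close>)
qed

text \<open>The scalars of the normed space of operators are real; composition with this operator
  expresses complex multiples.\<close>

definition cmult :: "complex \<Rightarrow> 'a op" where
  "cmult c = op_of (\<lambda>x z. c * coord x z)"

lemma cmult:
  fixes x :: "'a l2"
  shows cmult_apply [simp]: "cmult c x = scaleC c x"
    and clin_cmult: "clin (cmult c :: 'a op)"
    and norm_cmult_le: "norm (cmult c :: 'a op) \<le> cmod c"
proof -
  have *: "(\<Sum>z\<in>F. (cmod (c * coord x z))\<^sup>2) \<le> (cmod c * norm x)\<^sup>2" if "finite F" for F and x :: "'a l2"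
    using l2_sum_le[OF that, of "scaleC c x"] by (simp add: norm_scaleC)
  show "cmult c x = scaleC c x"
    unfolding cmult_def by (rule l2_eqI) (subst coord_op_of[OF _ _ *]; simp add: algebra_simps)
  show "clin (cmult c :: 'a op)"
    unfolding cmult_def by (rule clin_op_of[OF _ _ *]; simp add: algebra_simps)
  show "norm (cmult c :: 'a op) \<le> cmod c"
    unfolding cmult_def by (rule norm_op_of[OF _ _ *]; simp add: algebra_simps)
qed

lemma entry_cmult_compose: "entry (cmult c o\<^sub>L T) z w = c * entry T z w"
  by (simp add: entry_def)

subsection \<open>Transport along injections\<close>

text \<open>\<open>up e Z\<close> is the partial isometry taking the basis vector at
  \<open>a \<in> Z\<close> to the one at \<open>e a\<close>, and \<open>down e Z\<close> is its
  adjoint. The set \<open>Z\<close> is there for maps that are injective only on a part, such as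
  concatenation of lists.\<close>

definition down :: "('a \<Rightarrow> 'b) \<Rightarrow> 'a set \<Rightarrow> 'b l2 \<Rightarrow>\<^sub>L 'a l2" where
  "down e Z = op_of (\<lambda>x a. if a \<in> Z then coord x (e a) else 0)"

definition up :: "('a \<Rightarrow> 'b) \<Rightarrow> 'a set \<Rightarrow> 'a l2 \<Rightarrow>\<^sub>L 'b l2" where
  "up e Z = op_of (\<lambda>x b. if b \<in> e ` Z then coord x (inv_into Z e b) else 0)"

lemma down:
  assumes "inj_on e Z"
  shows coord_down: "coord (down e Z x) = (\<lambda>a. if a \<in> Z then coord x (e a) else 0)"
    and clin_down: "clin (down e Z)" and norm_down_le: "norm (down e Z) \<le> 1"
proof -
  have *: "(\<Sum>a\<in>F. (cmod (if a \<in> Z then coord x (e a) else 0))\<^sup>2) \<le> (1 * norm x)\<^sup>2"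
    if "finite F" for F x
  proof -
    have "(\<Sum>a\<in>F. (cmod (if a \<in> Z then coord x (e a) else 0))\<^sup>2) = (\<Sum>a\<in>F \<inter> Z. (cmod (coord x (e a)))\<^sup>2)"
      using that by (intro sum.mono_neutral_cong_right) auto
    also have "\<dots> = (\<Sum>b\<in>e ` (F \<inter> Z). (cmod (coord x b))\<^sup>2)"
      using assms by (subst sum.reindex) (auto intro: inj_on_subset)
    also have "\<dots> \<le> (1 * norm x)\<^sup>2"
      unfolding mult_1 by (rule l2_sum_le) (use that in simp)
    finally show ?thesis .
  qed
  show "coord (down e Z x) = (\<lambda>a. if a \<in> Z then coord x (e a) else 0)"
    unfolding down_def by (rule coord_op_of[OF _ _ *]; simp add: algebra_simps)
  show "clin (down e Z)"
    unfolding down_def by (rule clin_op_of[OF _ _ *]; simp add: algebra_simps)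
  show "norm (down e Z) \<le> 1"
    unfolding down_def by (rule norm_op_of[OF _ _ *]; simp add: algebra_simps)
qed

lemma up:
  assumes "inj_on e Z"
  shows coord_up: "coord (up e Z x) = (\<lambda>b. if b \<in> e ` Z then coord x (inv_into Z e b) else 0)"
    and clin_up: "clin (up e Z)" and norm_up_le: "norm (up e Z) \<le> 1"
proof -
  have *: "(\<Sum>b\<in>F. (cmod (if b \<in> e ` Z then coord x (inv_into Z e b) else 0))\<^sup>2) \<le> (1 * norm x)\<^sup>2"
    if "finite F" for F x
  proof -
    have "(\<Sum>b\<in>F. (cmod (if b \<in> e ` Z then coord x (inv_into Z e b) else 0))\<^sup>2)
        = (\<Sum>b\<in>F \<inter> e ` Z. (cmod (coord x (inv_into Z e b)))\<^sup>2)"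
      using that by (intro sum.mono_neutral_cong_right) auto
    also have "\<dots> = (\<Sum>a\<in>inv_into Z e ` (F \<inter> e ` Z). (cmod (coord x a))\<^sup>2)"
      by (subst sum.reindex) (auto intro: inj_on_subset[OF inj_on_inv_into[OF order_refl]])
    also have "\<dots> \<le> (1 * norm x)\<^sup>2"
      unfolding mult_1 by (rule l2_sum_le) (use that in simp)
    finally show ?thesis .
  qed
  show "coord (up e Z x) = (\<lambda>b. if b \<in> e ` Z then coord x (inv_into Z e b) else 0)"
    unfolding up_def by (rule coord_op_of[OF _ _ *]; simp add: algebra_simps)
  show "clin (up e Z)"
    unfolding up_def by (rule clin_op_of[OF _ _ *]; simp add: algebra_simps)
  show "norm (up e Z) \<le> 1"
    unfolding up_def by (rule norm_op_of[OF _ _ *]; simp add: algebra_simps)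
qed

lemma up_basis_vec: "inj_on e Z \<Longrightarrow> a \<in> Z \<Longrightarrow> up e Z (basis_vec a) = basis_vec (e a)"
  by (rule l2_eqI) (auto simp: coord_up inv_into_f_f)

lemma down_basis_vec: "inj_on e Z \<Longrightarrow> a \<in> Z \<Longrightarrow> down e Z (basis_vec (e a)) = basis_vec a"
  by (rule l2_eqI) (auto simp: coord_down inj_on_def)

lemma down_basis_vec_other: "inj_on e Z \<Longrightarrow> b \<notin> e ` Z \<Longrightarrow> down e Z (basis_vec b) = 0"
  by (rule l2_eqI) (auto simp: coord_down)

lemma down_up: "inj e \<Longrightarrow> down e UNIV (up e UNIV x) = x"
  by (rule l2_eqI) (simp add: coord_down coord_up)

text \<open>Conjugation with this partial isometry: the matrix of \<open>T\<close> over
  \<open>Z\<close>, copied along \<open>e\<close> and padded with zeros. For \<open>Z = UNIV\<close>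
  it is isometric and multiplicative.\<close>

definition transport :: "('a \<Rightarrow> 'b) \<Rightarrow> 'a set \<Rightarrow> 'a op \<Rightarrow> 'b op" where
  "transport e Z T = up e Z o\<^sub>L T o\<^sub>L down e Z"

lemma clin_transport: "inj_on e Z \<Longrightarrow> clin T \<Longrightarrow> clin (transport e Z T)"
  by (simp add: transport_def clin_compose clin_up clin_down)

lemma norm_contract_compose:
  assumes "norm U \<le> 1" "norm V \<le> 1"
  shows "norm (U o\<^sub>L T o\<^sub>L V) \<le> norm T"
proof -
  have "norm (U o\<^sub>L T o\<^sub>L V) \<le> norm U * norm T * norm V"
    by (meson norm_blinfun_compose mult_right_mono norm_ge_zero order_trans)
  also have "\<dots> \<le> 1 * norm T * 1"
    using assms by (intro mult_mono) auto
  finally show ?thesis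
    by simp
qed

lemma norm_transport_le: "inj_on e Z \<Longrightarrow> norm (transport e Z T) \<le> norm T"
  unfolding transport_def by (intro norm_contract_compose norm_up_le norm_down_le)

lemma transport_add: "transport e Z (T + S) = transport e Z T + transport e Z S"
  by (rule blinfun_eqI) (simp add: transport_def blinfun.add_left blinfun.add_right)

lemma transport_diff: "transport e Z (T - S) = transport e Z T - transport e Z S"
  by (rule blinfun_eqI) (simp add: transport_def blinfun.diff_left blinfun.diff_right)

lemma transport_cmult: "inj_on e Z \<Longrightarrow> transport e Z (cmult c o\<^sub>L T) = cmult c o\<^sub>L transport e Z T"
  by (rule blinfun_eqI) (simp add: transport_def clinD clin_up)

lemma entry_transport:
  assumes "inj_on e Z" "a \<in> Z" "b \<in> Z"
  shows "entry (transport e Z T) (e a) (e b) = entry T a b"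
  using assms by (simp add: entry_def transport_def down_basis_vec coord_up inv_into_f_f)

lemma entry_transport_other:
  assumes "inj_on e Z" "a \<notin> e ` Z \<or> b \<notin> e ` Z"
  shows "entry (transport e Z T) a b = 0"
  using assms by (auto simp: entry_def transport_def down_basis_vec_other coord_up blinfun.zero_right)

lemma transport_compose:
  "inj e \<Longrightarrow> transport e UNIV (T o\<^sub>L S) = transport e UNIV T o\<^sub>L transport e UNIV S"
  by (rule blinfun_eqI) (simp add: transport_def down_up)

text \<open>\<open>T\<close> is recovered from the transported operator by the reverse conjugation,
  which is a contraction as well.\<close>

lemma norm_transport:
  assumes "inj e"
  shows "norm (transport e UNIV T) = norm T"
proof (rule antisym)
  have "T = down e UNIV o\<^sub>L transport e UNIV T o\<^sub>L up e UNIV"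
    by (rule blinfun_eqI) (simp add: transport_def down_up assms)
  then show "norm T \<le> norm (transport e UNIV T)"
    using norm_contract_compose[OF norm_down_le[OF assms] norm_up_le[OF assms]] by metis
qed (rule norm_transport_le[OF assms])

lemma adjoint_entries_transport:
  assumes "inj_on e Z" "adjoint_entries T T'"
  shows "adjoint_entries (transport e Z T) (transport e Z T')"
  unfolding adjoint_entries_def
proof (intro allI)
  fix z w
  show "entry (transport e Z T') w z = cnj (entry (transport e Z T) z w)"
  proof (cases "z \<in> e ` Z \<and> w \<in> e ` Z")
    case True
    then show ?thesis
      using assms by (auto simp: entry_transport adjoint_entries_def)
  next
    case False
    then show ?thesis
      using assms by (auto simp: entry_transport_other)
  qed
qed

subsection \<open>Tensor products of operators\<close>

text \<open>The operator \<open>1 \<otimes> S\<close>: it applies \<open>S\<close> to each slice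
  with fixed first coordinate.\<close>

definition amplify :: "'b op \<Rightarrow> ('a \<times> 'b) op" where
  "amplify S = op_of (\<lambda>x (a, b). coord (S (down (Pair a) UNIV x)) b)"

definition swap_op :: "('a \<times> 'b) l2 \<Rightarrow>\<^sub>L ('b \<times> 'a) l2" where
  "swap_op = down prod.swap UNIV"

text \<open>The factorisation \<open>T \<otimes> S = (T \<otimes> 1)(1 \<otimes> S)\<close>, where
  conjugation with the swap moves the amplified operator to the first coordinate.\<close>

definition op_tensor :: "'a op \<Rightarrow> 'b op \<Rightarrow> ('a \<times> 'b) op" where
  "op_tensor T S = (swap_op o\<^sub>L amplify T o\<^sub>L swap_op) o\<^sub>L amplify S"

lemma inj_Pair: "inj (Pair a)"
  by (simp add: inj_def)

text \<open>The slices split the index set into rows. This is what bounds the norm of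
  \<open>1 \<otimes> S\<close> by that of \<open>S\<close>.\<close>

lemma slices_norm_le:
  assumes "finite A"
  shows "(\<Sum>a\<in>A. (norm (down (Pair a) UNIV x))\<^sup>2) \<le> (norm x)\<^sup>2"
proof -
  have "(\<Sum>a\<in>A. (norm (down (Pair a) UNIV x))\<^sup>2) = (\<Sum>a\<in>A. \<Sum>\<^sub>\<infinity>b. (cmod (coord x (a, b)))\<^sup>2)"
    by (simp add: norm_l2_square coord_down inj_Pair)
  also have "\<dots> = (\<Sum>\<^sub>\<infinity>a\<in>A. \<Sum>\<^sub>\<infinity>b. (cmod (coord x (a, b)))\<^sup>2)"
    using assms by simp
  also have "\<dots> = (\<Sum>\<^sub>\<infinity>p\<in>A \<times> UNIV. (cmod (coord x p))\<^sup>2)"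
    by (rule infsum_Sigma_banach) (rule l2_summable)
  also have "\<dots> \<le> (norm x)\<^sup>2"
    unfolding norm_l2_square by (rule infsum_mono_neutral) (auto intro: l2_summable)
  finally show ?thesis .
qed

lemma amplify:
  fixes x :: "('a \<times> 'b) l2"
  assumes "clin S"
  shows coord_amplify: "coord (amplify S x) = (\<lambda>(a, b). coord (S (down (Pair a) UNIV x)) b)"
    and clin_amplify: "clin (amplify S :: ('a \<times> 'b) op)"
    and norm_amplify_le: "norm (amplify S :: ('a \<times> 'b) op) \<le> norm S"
proof -
  let ?\<Phi> = "\<lambda>(x :: ('a \<times> 'b) l2) (a, b). coord (S (down (Pair a) UNIV x)) b"
  have *: "(\<Sum>p\<in>F. (cmod (?\<Phi> x p))\<^sup>2) \<le> (norm S * norm x)\<^sup>2" if "finite F" for F and x :: "('a \<times> 'b) l2"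
  proof -
    have "(\<Sum>p\<in>F. (cmod (?\<Phi> x p))\<^sup>2) \<le> (\<Sum>p\<in>fst ` F \<times> snd ` F. (cmod (?\<Phi> x p))\<^sup>2)"
      using that by (intro sum_mono2) (auto simp: subset_fst_snd)
    also have "\<dots> = (\<Sum>a\<in>fst ` F. \<Sum>b\<in>snd ` F. (cmod (coord (S (down (Pair a) UNIV x)) b))\<^sup>2)"
      by (simp add: sum.cartesian_product case_prod_beta)
    also have "\<dots> \<le> (\<Sum>a\<in>fst ` F. (norm (S (down (Pair a) UNIV x)))\<^sup>2)"
      using that by (intro sum_mono l2_sum_le) auto
    also have "\<dots> \<le> (\<Sum>a\<in>fst ` F. (norm S)\<^sup>2 * (norm (down (Pair a) UNIV x))\<^sup>2)"
      by (intro sum_mono) (metis norm_blinfun norm_ge_zero power_mono power_mult_distrib)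
    also have "\<dots> \<le> (norm S)\<^sup>2 * (norm x)\<^sup>2"
      using that by (simp add: sum_distrib_left[symmetric] mult_left_mono slices_norm_le)
    finally show ?thesis
      by (simp add: power_mult_distrib)
  qed
  have add: "?\<Phi> (x + y) p = ?\<Phi> x p + ?\<Phi> y p" for x y p
    by (cases p) (simp add: blinfun.add_right)
  have scale: "?\<Phi> (scaleC c x) p = c * ?\<Phi> x p" for c x p
    by (cases p) (simp add: clinD clin_down inj_Pair assms)
  show "coord (amplify S x) = ?\<Phi> x"
    unfolding amplify_def by (rule coord_op_of[where \<Phi> = ?\<Phi>, OF add scale *]) auto
  show "clin (amplify S :: ('a \<times> 'b) op)"
    unfolding amplify_def by (rule clin_op_of[where \<Phi> = ?\<Phi>, OF add scale *]) auto
  show "norm (amplify S :: ('a \<times> 'b) op) \<le> norm S"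
    unfolding amplify_def by (rule norm_op_of[where \<Phi> = ?\<Phi>, OF add scale *]) auto
qed

lemma coord_swap_op [simp]: "coord (swap_op x) = (\<lambda>(b, a). coord x (a, b))"
  by (auto simp: swap_op_def coord_down inj_on_def fun_eq_iff)

lemma clin_swap_op: "clin swap_op" and norm_swap_op_le: "norm swap_op \<le> 1"
  by (auto simp: swap_op_def clin_down norm_down_le inj_on_def)

lemma swap_op_swap_op [simp]: "swap_op (swap_op x) = x"
  by (rule l2_eqI) auto

lemma down_Pair_amplify: "clin S \<Longrightarrow> down (Pair a) UNIV (amplify S x) = S (down (Pair a) UNIV x)"
  by (rule l2_eqI) (simp add: coord_down inj_Pair coord_amplify)

lemma amplify_compose:
  "clin T \<Longrightarrow> clin S \<Longrightarrow> amplify (T o\<^sub>L S) = amplify T o\<^sub>L amplify S"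
  by (rule blinfun_eqI, rule l2_eqI) (simp add: coord_amplify clin_compose down_Pair_amplify)

lemma clin_op_tensor: "clin T \<Longrightarrow> clin S \<Longrightarrow> clin (op_tensor T S)"
  by (simp add: op_tensor_def clin_compose clin_amplify clin_swap_op)

lemma norm_op_tensor_le:
  assumes "clin T" "clin S"
  shows "norm (op_tensor T S) \<le> norm T * norm S"
proof -
  have "norm (swap_op o\<^sub>L amplify T o\<^sub>L swap_op :: ('a \<times> 'b) op) \<le> norm T"
    using norm_contract_compose[OF norm_swap_op_le norm_swap_op_le] norm_amplify_le[OF assms(1)]
    by (rule order_trans)
  then show ?thesis
    unfolding op_tensor_def using norm_amplify_le[OF assms(2)]
    by (rule order_trans[OF norm_blinfun_compose mult_mono]) auto
qed

text \<open>The second product takes the factors \<open>1 \<otimes> S\<close> and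
  \<open>T \<otimes> 1\<close> in the opposite order. That both have the same matrix is the
  commutation behind \<open>op_tensor_compose\<close>.\<close>

lemma entry_op_tensor_aux:
  assumes "clin T" "clin S"
  shows "entry (op_tensor T S) (a, b) (c, d) = entry T a c * entry S b d"
    and "entry (amplify S o\<^sub>L (swap_op o\<^sub>L amplify T o\<^sub>L swap_op)) (a, b) (c, d) = entry T a c * entry S b d"
proof -
  have 1: "down (Pair x) UNIV (basis_vec (y, z)) = (if x = y then basis_vec z else 0)"
    for x y :: 'x and z :: 'y
    by (rule l2_eqI) (auto simp: coord_down inj_Pair)
  have 2: "swap_op (basis_vec (y, z)) = basis_vec (z, y)" for y :: 'x and z :: 'y
    by (rule l2_eqI) (auto split: if_splits)
  have 3: "amplify V (basis_vec (y, z)) = up (Pair y) UNIV (V (basis_vec z))"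
    if "clin V" for V :: "'y op" and y :: 'x and z
    by (rule l2_eqI) (auto simp: coord_amplify that 1 coord_up inj_Pair blinfun.zero_right
        inv_into_f_f[OF inj_Pair] split: prod.splits)
  have 4: "down (Pair x) UNIV (swap_op (up (Pair y) UNIV v)) = scaleC (coord v x) (basis_vec y)"
    for x :: 'x and y :: 'y and v
    by (rule l2_eqI) (auto simp: coord_down coord_up inj_Pair inv_into_f_f[OF inj_Pair])
  show "entry (op_tensor T S) (a, b) (c, d) = entry T a c * entry S b d"
    by (simp add: entry_def op_tensor_def 3 4 coord_amplify assms clinD)
  show "entry (amplify S o\<^sub>L (swap_op o\<^sub>L amplify T o\<^sub>L swap_op)) (a, b) (c, d) = entry T a c * entry S b d"
    by (simp add: entry_def 2 3 4 coord_amplify assms clinD)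
qed

lemma entry_op_tensor:
  "clin T \<Longrightarrow> clin S \<Longrightarrow> entry (op_tensor T S) (a, b) (c, d) = entry T a c * entry S b d"
  by (rule entry_op_tensor_aux)

lemma op_tensor_compose:
  assumes "clin T" "clin S" "clin T'" "clin S'"
  shows "op_tensor (T o\<^sub>L T') (S o\<^sub>L S') = op_tensor T S o\<^sub>L op_tensor T' S'"
proof -
  have comm: "op_tensor T' S = amplify S o\<^sub>L (swap_op o\<^sub>L amplify T' o\<^sub>L swap_op)"
    using assms by (intro op_eqI)
      (auto simp: clin_op_tensor clin_compose clin_amplify clin_swap_op entry_op_tensor_aux)
  show ?thesis
  proof (rule blinfun_eqI)
    fix x
    have "op_tensor (T o\<^sub>L T') (S o\<^sub>L S') x
        = (swap_op o\<^sub>L amplify T o\<^sub>L swap_op) (op_tensor T' S (amplify S' x))"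
      using assms by (simp add: op_tensor_def amplify_compose)
    then show "op_tensor (T o\<^sub>L T') (S o\<^sub>L S') x = (op_tensor T S o\<^sub>L op_tensor T' S') x"
      unfolding comm by (simp add: op_tensor_def)
  qed
qed

lemma adjoint_entries_op_tensor:
  assumes "clin T" "clin S" "clin T'" "clin S'" "adjoint_entries T T'" "adjoint_entries S S'"
  shows "adjoint_entries (op_tensor T S) (op_tensor T' S')"
  using assms by (auto simp: adjoint_entries_def entry_op_tensor)

definition vec_tensor :: "'a l2 \<Rightarrow> 'b l2 \<Rightarrow> ('a \<times> 'b) l2" where
  "vec_tensor x y = Abs_l2 (\<lambda>(a, b). coord x a * coord y b)"

lemma coord_vec_tensor [simp]: "coord (vec_tensor x y) = (\<lambda>(a, b). coord x a * coord y b)"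
proof -
  let ?\<xi> = "\<lambda>(a, b). coord x a * coord y b"
  have "(\<Sum>p\<in>F. (cmod (?\<xi> p))\<^sup>2) \<le> (norm x * norm y)\<^sup>2" if "finite F" for F
  proof -
    have "(\<Sum>p\<in>F. (cmod (?\<xi> p))\<^sup>2) \<le> (\<Sum>p\<in>fst ` F \<times> snd ` F. (cmod (?\<xi> p))\<^sup>2)"
      using that by (intro sum_mono2) (auto simp: subset_fst_snd)
    also have "\<dots> = (\<Sum>a\<in>fst ` F. (cmod (coord x a))\<^sup>2) * (\<Sum>b\<in>snd ` F. (cmod (coord y b))\<^sup>2)"
      by (simp add: sum_product sum.cartesian_product case_prod_beta norm_mult power_mult_distrib)
    also have "\<dots> \<le> (norm x)\<^sup>2 * (norm y)\<^sup>2"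
      using that by (intro mult_mono l2_sum_le) (auto intro: sum_nonneg)
    finally show ?thesis
      by (simp add: power_mult_distrib)
  qed
  then have "?\<xi> \<in> ell2"
    by (rule ell2_boundI(1)) auto
  then show ?thesis
    by (simp add: vec_tensor_def Abs_l2_inverse)
qed

lemma op_tensor_vec_tensor:
  assumes "clin T" "clin S"
  shows "op_tensor T S (vec_tensor x y) = vec_tensor (T x) (S y)"
proof -
  have 1: "amplify S (vec_tensor x y) = vec_tensor x (S y)" if "clin S"
    for S :: "'y op" and x :: "'x l2" and y
  proof -
    have "down (Pair a) UNIV (vec_tensor x y) = scaleC (coord x a) y" for a
      by (rule l2_eqI) (simp add: coord_down inj_Pair)
    then show ?thesis
      by (intro l2_eqI) (auto simp: coord_amplify that clinD)
  qed
  have 2: "swap_op (vec_tensor x y) = vec_tensor y x" for x :: "'x l2" and y :: "'y l2"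
    by (rule l2_eqI) auto
  show ?thesis
    by (simp add: op_tensor_def 1 2 assms)
qed

subsection \<open>Operators on lists of indices\<close>

abbreviation cons_pair :: "'a \<times> 'a list \<Rightarrow> 'a list" where
  "cons_pair \<equiv> \<lambda>(z, zs). z # zs"

abbreviation append_pair :: "'a list \<times> 'a list \<Rightarrow> 'a list" where
  "append_pair \<equiv> \<lambda>(zs, ws). zs @ ws"

text \<open>The operators act on lists of all lengths and vanish outside lists of length
  \<open>length Ts\<close>; thus products with different numbers of factors share one type. The
  empty product is the projection onto the basis vector of the empty list.\<close>

fun tensor_ops :: "'a op list \<Rightarrow> 'a list op" where
  "tensor_ops [] = transport (\<lambda>_ :: unit. []) UNIV id_blinfun"
| "tensor_ops (T # Ts) = transport cons_pair UNIV (op_tensor T (tensor_ops Ts))"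

text \<open>The tensor product in which lists are cut after \<open>n\<close> places: concatenation
  is injective only when the length of the first part is prescribed.\<close>

definition append_op :: "nat \<Rightarrow> 'a list op \<Rightarrow> 'a list op \<Rightarrow>
    'a list op" where
  "append_op n T S = transport append_pair {(zs, ws). length zs = n} (op_tensor T S)"

lemma inj_unit_nil: "inj (\<lambda>_ :: unit. [])"
  by (simp add: inj_def)

lemma inj_cons_pair: "inj cons_pair"
  by (auto simp: inj_def)

lemma inj_append_pair: "inj_on append_pair {(zs, ws). length zs = n}"
  by (auto simp: inj_on_def)

lemma clin_id: "clin id_blinfun"
  by (simp add: clin_def)

lemma clin_tensor_ops: "\<forall>T\<in>set Ts. clin T \<Longrightarrow> clin (tensor_ops Ts)"
  by (induction Ts) (auto intro!: clin_transport clin_op_tensor inj_unit_nil inj_cons_pair clin_id)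

lemma entry_tensor_ops_Nil: "entry (tensor_ops []) zs ws = (if zs = [] \<and> ws = [] then 1 else 0)"
  using entry_transport[OF inj_unit_nil, of "()" "()" "id_blinfun"]
    entry_transport_other[OF inj_unit_nil, of zs ws "id_blinfun"]
  by (auto simp: entry_def)

lemma entry_tensor_ops_Cons:
  "\<forall>T\<in>set (T # Ts). clin T \<Longrightarrow>
    entry (tensor_ops (T # Ts)) (z # zs) (w # ws) = entry T z w * entry (tensor_ops Ts) zs ws"
  using entry_transport[OF inj_cons_pair, of "(z, zs)" "(w, ws)" "op_tensor T (tensor_ops Ts)"]
  by (simp add: entry_op_tensor clin_tensor_ops)

lemma entry_tensor_ops_Cons_Nil:
  "entry (tensor_ops (T # Ts)) [] ws = 0" "entry (tensor_ops (T # Ts)) zs [] = 0"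
  by (auto intro!: entry_transport_other inj_cons_pair)

lemma entry_tensor_ops_length:
  assumes "\<forall>T\<in>set Ts. clin T" "length zs \<noteq> length Ts \<or> length ws \<noteq> length Ts"
  shows "entry (tensor_ops Ts) zs ws = 0"
  using assms
proof (induction Ts arbitrary: zs ws)
  case Nil
  then show ?case
    by (auto simp: entry_tensor_ops_Nil simp del: tensor_ops.simps)
next
  case (Cons T Ts)
  show ?case
  proof (cases "zs = [] \<or> ws = []")
    case True
    then show ?thesis
      using entry_tensor_ops_Cons_Nil by auto
  next
    case False
    then obtain z zs' w ws' where "zs = z # zs'" "ws = w # ws'"
      by (meson neq_Nil_conv)
    then show ?thesis
      using Cons by (auto simp: entry_tensor_ops_Cons simp del: tensor_ops.simps)
  qed
qed

lemma entry_tensor_ops_append: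
  assumes "\<forall>T\<in>set (Ts @ Ss). clin T" "length zs = length Ts" "length ws = length Ts"
  shows "entry (tensor_ops (Ts @ Ss)) (zs @ zs') (ws @ ws')
    = entry (tensor_ops Ts) zs ws * entry (tensor_ops Ss) zs' ws'"
  using assms
proof (induction Ts arbitrary: zs ws)
  case Nil
  then show ?case
    by (simp add: entry_tensor_ops_Nil del: tensor_ops.simps)
next
  case (Cons T Ts)
  then obtain z zs1 w ws1 where "zs = z # zs1" "ws = w # ws1"
    by (metis length_Suc_conv)
  then show ?case
    using Cons by (simp add: entry_tensor_ops_Cons ball_Un del: tensor_ops.simps)
qed

lemma entry_append_op:
  assumes "clin T" "clin S" "length zs = n" "length ws = n"
  shows "entry (append_op n T S) (zs @ zs') (ws @ ws') = entry T zs ws * entry S zs' ws'"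
  using assms entry_transport[OF inj_append_pair, of "(zs, zs')" n "(ws, ws')" "op_tensor T S"]
  by (simp add: append_op_def entry_op_tensor)

lemma entry_append_op_short:
  assumes "length zs < n \<or> length ws < n"
  shows "entry (append_op n T S) zs ws = 0"
  using assms unfolding append_op_def by (intro entry_transport_other inj_append_pair) auto

lemma clin_append_op: "clin T \<Longrightarrow> clin S \<Longrightarrow> clin (append_op n T S)"
  unfolding append_op_def by (intro clin_transport inj_append_pair clin_op_tensor)

lemma norm_append_op_le: "clin T \<Longrightarrow> clin S \<Longrightarrow> norm (append_op n T S) \<le> norm T * norm S"
  unfolding append_op_def
  by (rule order_trans[OF norm_transport_le[OF inj_append_pair] norm_op_tensor_le])

lemma op_tensor_add_left:
  "clin T \<Longrightarrow> clin T' \<Longrightarrow> clin S \<Longrightarrow> op_tensor (T + T') S = op_tensor T S + op_tensor T' S"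
  by (rule op_eqI) (auto simp: clin_op_tensor clin_add entry_op_tensor entry_add algebra_simps)

lemma op_tensor_add_right:
  "clin T \<Longrightarrow> clin S \<Longrightarrow> clin S' \<Longrightarrow> op_tensor T (S + S') = op_tensor T S + op_tensor T S'"
  by (rule op_eqI) (auto simp: clin_op_tensor clin_add entry_op_tensor entry_add algebra_simps)

lemma append_op_add_left:
  "clin T \<Longrightarrow> clin T' \<Longrightarrow> clin S \<Longrightarrow> append_op n (T + T') S = append_op n T S + append_op n T' S"
  by (simp add: append_op_def op_tensor_add_left transport_add)

lemma append_op_add_right:
  "clin T \<Longrightarrow> clin S \<Longrightarrow> clin S' \<Longrightarrow> append_op n T (S + S') = append_op n T S + append_op n T S'"
  by (simp add: append_op_def op_tensor_add_right transport_add)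

lemma op_tensor_cmult:
  assumes "clin T" "clin S"
  shows "op_tensor (cmult c o\<^sub>L T) S = cmult c o\<^sub>L op_tensor T S"
    and "op_tensor T (cmult c o\<^sub>L S) = cmult c o\<^sub>L op_tensor T S"
  using assms
  by (auto intro!: op_eqI simp: clin_op_tensor clin_compose clin_cmult entry_op_tensor entry_cmult_compose)

lemma append_op_cmult:
  assumes "clin T" "clin S"
  shows "append_op n (cmult c o\<^sub>L T) S = cmult c o\<^sub>L append_op n T S"
    and "append_op n T (cmult c o\<^sub>L S) = cmult c o\<^sub>L append_op n T S"
  using assms by (simp_all add: append_op_def op_tensor_cmult transport_cmult inj_append_pair)

text \<open>Both matrices vanish at lists too short for the cut, and otherwise factor at the
  cut.\<close>

lemma tensor_ops_append:
  assumes "\<forall>T\<in>set (Ts @ Ss). clin T"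
  shows "tensor_ops (Ts @ Ss) = append_op (length Ts) (tensor_ops Ts) (tensor_ops Ss)"
proof (rule op_eqI)
  let ?n = "length Ts"
  have clin: "clin (tensor_ops Ts)" "clin (tensor_ops Ss)"
    using assms by (auto intro: clin_tensor_ops)
  show "clin (tensor_ops (Ts @ Ss))" "clin (append_op ?n (tensor_ops Ts) (tensor_ops Ss))"
    using assms clin by (auto intro: clin_tensor_ops clin_append_op)
  fix zs ws
  show "entry (tensor_ops (Ts @ Ss)) zs ws = entry (append_op ?n (tensor_ops Ts) (tensor_ops Ss)) zs ws"
  proof (cases "length zs < ?n \<or> length ws < ?n")
    case True
    then show ?thesis
      using assms by (simp add: entry_append_op_short) (auto intro!: entry_tensor_ops_length)
  next
    case False
    then have "length (take ?n zs) = ?n" "length (take ?n ws) = ?n"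
      by auto
    then show ?thesis
      using entry_tensor_ops_append[OF assms, of "take ?n zs" "take ?n ws" "drop ?n zs" "drop ?n ws"]
        entry_append_op[OF clin, of "take ?n zs" ?n "take ?n ws" "drop ?n zs" "drop ?n ws"]
      by simp
  qed
qed

lemma tensor_ops_compose:
  assumes "list_all2 (\<lambda>T S. clin T \<and> clin S) Ts Ss"
  shows "tensor_ops (map2 (o\<^sub>L) Ts Ss) = tensor_ops Ts o\<^sub>L tensor_ops Ss"
  using assms
proof (induction rule: list_all2_induct)
  case Nil
  have "id_blinfun o\<^sub>L id_blinfun = (id_blinfun :: unit l2 \<Rightarrow>\<^sub>L unit l2)"
    by (rule blinfun_eqI) simp
  then show ?case
    using transport_compose[OF inj_unit_nil, of id_blinfun id_blinfun] by simp
next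
  case (Cons T Ts S Ss)
  then have "\<forall>T\<in>set Ts. clin T" "\<forall>S\<in>set Ss. clin S"
    by (auto simp: list_all2_iff set_zip in_set_conv_nth)+
  then show ?case
    using Cons by (simp add: op_tensor_compose transport_compose inj_cons_pair clin_tensor_ops)
qed

lemma adjoint_entries_tensor_ops:
  assumes "list_all2 (\<lambda>T S. clin T \<and> clin S \<and> adjoint_entries T S) Ts Ss"
  shows "adjoint_entries (tensor_ops Ts) (tensor_ops Ss)"
  using assms
proof (induction rule: list_all2_induct)
  case Nil
  show ?case
    by (simp add: adjoint_entries_def entry_tensor_ops_Nil del: tensor_ops.simps)
next
  case (Cons T Ts S Ss)
  then have "\<forall>T\<in>set Ts. clin T" "\<forall>S\<in>set Ss. clin S"
    by (auto simp: list_all2_iff set_zip in_set_conv_nth)+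
  then show ?case
    using Cons
    by (auto intro!: adjoint_entries_transport adjoint_entries_op_tensor inj_cons_pair clin_tensor_ops)
qed

lemma norm_tensor_ops_le:
  "\<forall>T\<in>set Ts. clin T \<Longrightarrow> norm (tensor_ops Ts) \<le> (\<Prod>T\<leftarrow>Ts. norm T)"
proof (induction Ts)
  case Nil
  have "norm (id_blinfun :: unit l2 \<Rightarrow>\<^sub>L unit l2) \<le> 1"
    by (rule norm_blinfun_bound) auto
  then show ?case
    using order_trans[OF norm_transport_le[OF inj_unit_nil]] by simp
next
  case (Cons T Ts)
  have "norm (tensor_ops (T # Ts)) \<le> norm T * norm (tensor_ops Ts)"
    using Cons by (auto intro!: order_trans[OF norm_transport_le norm_op_tensor_le] inj_cons_pair clin_tensor_ops)
  also have "\<dots> \<le> norm T * (\<Prod>T\<leftarrow>Ts. norm T)"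
    using Cons by (intro mult_left_mono) auto
  finally show ?case
    by simp
qed

section \<open>Elementary tensors of vectors\<close>

fun tensor_vec :: "'a l2 list \<Rightarrow> 'a list l2" where
  "tensor_vec [] = basis_vec []"
| "tensor_vec (x # xs) = up cons_pair UNIV (vec_tensor x (tensor_vec xs))"

lemma coord_tensor_vec: "coord (tensor_vec xs) = tensor_vector (map coord xs)"
proof (induction xs)
  case Nil
  show ?case
    by (auto simp: tensor_vector_def fun_eq_iff)
next
  case (Cons x xs)
  have inv: "inv cons_pair (z # zs) = (z, zs)" for z and zs :: "'a list"
    using inv_f_f[OF inj_cons_pair, of "(z, zs)"] by simp
  show ?case
  proof
    fix zs
    show "coord (tensor_vec (x # xs)) zs = tensor_vector (map coord (x # xs)) zs"
      by (cases zs) (auto simp: coord_up inj_cons_pair inv tensor_vector_def Cons.IH image_iff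
          prod.lessThan_Suc_shift simp del: prod.lessThan_Suc)
  qed
qed

lemma tensor_ops_tensor_vec:
  assumes "list_all2 (\<lambda>T x. clin T) Ts xs"
  shows "tensor_ops Ts (tensor_vec xs) = tensor_vec (map2 blinfun_apply Ts xs)"
  using assms
proof (induction rule: list_all2_induct)
  case Nil
  then show ?case
    by (simp add: transport_def down_basis_vec[OF inj_unit_nil, of "()"] up_basis_vec[OF inj_unit_nil])
next
  case (Cons T Ts x xs)
  then have "\<forall>T\<in>set Ts. clin T"
    by (metis (no_types, lifting) in_set_conv_nth list_all2_conv_all_nth)
  then show ?case
    using Cons by (simp add: transport_def down_up inj_cons_pair op_tensor_vec_tensor clin_tensor_ops)
qed

section \<open>C*-algebras and their representations\<close>

context cstar_algebra
begin

lemmas closed [simp, intro] = zero_closed add_closed scale_closed mul_closed adj_closed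

lemma add_left_commute:
  "x \<in> carr A \<Longrightarrow> y \<in> carr A \<Longrightarrow> z \<in> carr A \<Longrightarrow> cadd A x (cadd A y z) = cadd A y (cadd A x z)"
  by (metis add_assoc add_commute)

lemmas add_simps = add_assoc add_commute add_left_commute

lemma add_zero_right [simp]: "x \<in> carr A \<Longrightarrow> cadd A x (czero A) = x"
  using add_zero add_commute by simp

lemma scale_0: "x \<in> carr A \<Longrightarrow> cscale A 0 x = czero A"
  using add_scale[of x 1 "-1"] by (simp add: scale_one add_minus)

lemma scale_zero [simp]: "cscale A c (czero A) = czero A"
  using scale_scale[of "czero A" c 0] by (simp add: scale_0)

lemma norm_zero [simp]: "cnrm A (czero A) = 0"
  by (simp add: norm_eq_zero)

lemma minus_minus: "x \<in> carr A \<Longrightarrow> cscale A (- 1) (cscale A (- 1) x) = x"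
  by (simp add: scale_scale scale_one)

lemma minus_add_cancel:
  "x \<in> carr A \<Longrightarrow> y \<in> carr A \<Longrightarrow> cadd A (cscale A (- 1) x) (cadd A x y) = y"
  by (metis add_assoc add_commute add_minus add_zero scale_closed)

lemma add_eq_zero_imp_eq:
  assumes "x \<in> carr A" "y \<in> carr A" "cadd A x (cscale A (- 1) y) = czero A"
  shows "x = y"
  using assms by (metis add_commute add_zero_right minus_add_cancel minus_minus scale_closed)

lemma cdist_nonneg: "x \<in> carr A \<Longrightarrow> y \<in> carr A \<Longrightarrow> 0 \<le> cdist A x y"
  by (simp add: cdist_def norm_nonneg)

lemma cdist_self [simp]: "x \<in> carr A \<Longrightarrow> cdist A x x = 0"
  by (simp add: cdist_def add_minus)

lemma cdist_zero: "x \<in> carr A \<Longrightarrow> cdist A x (czero A) = cnrm A x"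
  by (simp add: cdist_def)

lemma cdist_commute:
  assumes "x \<in> carr A" "y \<in> carr A"
  shows "cdist A x y = cdist A y x"
proof -
  have "cscale A (- 1) (cadd A x (cscale A (- 1) y)) = cadd A y (cscale A (- 1) x)"
    using assms by (simp add: scale_add minus_minus add_commute)
  then show ?thesis
    using assms norm_scale[of "cadd A x (cscale A (- 1) y)" "- 1"] by (simp add: cdist_def)
qed

lemma cdist_triangle:
  assumes "x \<in> carr A" "y \<in> carr A" "z \<in> carr A"
  shows "cdist A x z \<le> cdist A x y + cdist A y z"
proof -
  have "cadd A (cadd A x (cscale A (- 1) y)) (cadd A y (cscale A (- 1) z)) = cadd A x (cscale A (- 1) z)"
    using assms by (simp add: add_assoc minus_add_cancel)
  then show ?thesis
    using norm_triangle[of "cadd A x (cscale A (- 1) y)" "cadd A y (cscale A (- 1) z)"] assms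
    by (simp add: cdist_def)
qed

lemma cdist_add:
  assumes "x \<in> carr A" "y \<in> carr A" "z \<in> carr A" "w \<in> carr A"
  shows "cdist A (cadd A x y) (cadd A z w) \<le> cdist A x z + cdist A y w"
proof -
  have "cadd A (cadd A x (cscale A (- 1) z)) (cadd A y (cscale A (- 1) w))
      = cadd A (cadd A x y) (cscale A (- 1) (cadd A z w))"
    using assms by (simp add: add_simps scale_add)
  then show ?thesis
    using norm_triangle[of "cadd A x (cscale A (- 1) z)" "cadd A y (cscale A (- 1) w)"] assms
    by (simp add: cdist_def)
qed

lemma cdist_scale:
  assumes "x \<in> carr A" "y \<in> carr A"
  shows "cdist A (cscale A c x) (cscale A c y) = cmod c * cdist A x y"
proof -
  have "cscale A c (cadd A x (cscale A (- 1) y)) = cadd A (cscale A c x) (cscale A (- 1) (cscale A c y))"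
    using assms by (simp add: scale_add scale_scale)
  then show ?thesis
    using assms norm_scale[of "cadd A x (cscale A (- 1) y)" c] by (simp add: cdist_def)
qed

lemma cdist_mul_left:
  assumes "x \<in> carr A" "y \<in> carr A" "z \<in> carr A"
  shows "cdist A (cmul A x y) (cmul A x z) \<le> cnrm A x * cdist A y z"
  using assms norm_mul[of x "cadd A y (cscale A (- 1) z)"] by (simp add: cdist_def mul_add mul_scale)

lemma cdist_mul_right:
  assumes "x \<in> carr A" "y \<in> carr A" "z \<in> carr A"
  shows "cdist A (cmul A y x) (cmul A z x) \<le> cdist A y z * cnrm A x"
  using assms norm_mul[of "cadd A y (cscale A (- 1) z)" x] by (simp add: cdist_def add_mul scale_mul)

lemma norm_adj_le: "x \<in> carr A \<Longrightarrow> cnrm A x \<le> cnrm A (cadj A x)"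
proof -
  assume x: "x \<in> carr A"
  have "cnrm A x * cnrm A x \<le> cnrm A (cadj A x) * cnrm A x"
    using x cstar_identity[of x] norm_mul[of "cadj A x" x] by (simp add: power2_eq_square)
  then show ?thesis
    using x norm_nonneg[of x] norm_nonneg[of "cadj A x"] by (cases "cnrm A x = 0") auto
qed

lemma cdist_adj:
  assumes "x \<in> carr A" "y \<in> carr A"
  shows "cdist A (cadj A x) (cadj A y) = cdist A x y"
proof -
  let ?d = "cadd A x (cscale A (- 1) y)"
  have "cadj A ?d = cadd A (cadj A x) (cscale A (- 1) (cadj A y))"
    using assms by (simp add: adj_add adj_scale)
  moreover have "cnrm A (cadj A ?d) = cnrm A ?d"
    using norm_adj_le[of ?d] norm_adj_le[of "cadj A ?d"] assms by (simp add: adj_adj)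
  ultimately show ?thesis
    by (simp add: cdist_def)
qed

lemma norm_le_cdist: "x \<in> carr A \<Longrightarrow> y \<in> carr A \<Longrightarrow> cnrm A x \<le> cnrm A y + cdist A x y"
  using cdist_triangle[of x y "czero A"] by (simp add: cdist_zero)

lemma cdist_le_0_imp_eq:
  assumes "x \<in> carr A" "y \<in> carr A" "cdist A x y \<le> 0"
  shows "x = y"
proof -
  have "cnrm A (cadd A x (cscale A (- 1) y)) = 0"
    using assms cdist_nonneg[of x y] by (simp add: cdist_def)
  then have "cadd A x (cscale A (- 1) y) = czero A"
    using assms by (subst (asm) norm_eq_zero) auto
  then show ?thesis
    by (rule add_eq_zero_imp_eq[OF assms(1,2)])
qed

lemma cdist_eqI:
  assumes "x \<in> carr A" "y \<in> carr A" "\<And>e. e > 0 \<Longrightarrow> cdist A x y \<le> e"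
  shows "x = y"
  using assms cdist_le_0_imp_eq field_le_epsilon[of "cdist A x y" 0] by simp

lemma csum_Nil [simp]: "csum A [] = czero A"
  and csum_Cons [simp]: "csum A (x # xs) = cadd A x (csum A xs)"
  by (simp_all add: csum_def)

lemma csum_closed [simp]: "set xs \<subseteq> carr A \<Longrightarrow> csum A xs \<in> carr A"
  by (induction xs) auto

lemma csum_append:
  "set xs \<subseteq> carr A \<Longrightarrow> set ys \<subseteq> carr A \<Longrightarrow> csum A (xs @ ys) = cadd A (csum A xs) (csum A ys)"
  by (induction xs) (auto simp: add_zero add_assoc)

lemma csum_scale: "set xs \<subseteq> carr A \<Longrightarrow> csum A (map (cscale A c) xs) = cscale A c (csum A xs)"
  by (induction xs) (auto simp: scale_add)

text \<open>
  The substitute for the continuous functional calculus: \<open>k = 1 - (1 - a\<^sup>*a)\<^sup>1\<^sup>/\<^sup>2\<close>, found as a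
  fixed point of a contraction, without adjoining an identity.
\<close>

lemma selfadjoint_fixed_point:
  assumes a: "a \<in> carr A" and small: "cnrm A a < 1"
  obtains k where "k \<in> carr A" "cadj A k = k"
    "cadd A k k = cadd A (cmul A (cadj A a) a) (cmul A k k)"
proof -
  define h where "h = cmul A (cadj A a) a"
  \<comment> \<open>A fixed point satisfies \<open>2k = h + k\<^sup>2\<close>, that is,
    \<open>(1 - k)\<^sup>2 = 1 - h\<close>.\<close>
  define F where "F = (\<lambda>k. cscale A (1 / 2) (cadd A h (cmul A k k)))"
  define K where "K = (\<lambda>n. (F ^^ n) (czero A))"
  \<comment> \<open>The smaller root of \<open>2r = \<parallel>h\<parallel> + r\<^sup>2\<close>: the
    ball of radius \<open>r\<close> is mapped into itself, and \<open>r < 1\<close> is the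
    contraction constant on it.\<close>
  define r where "r = 1 - sqrt (1 - cnrm A h)"
  have h: "h \<in> carr A" "cadj A h = h"
    using a by (simp_all add: h_def adj_mul adj_adj)
  have "cnrm A h < 1"
    unfolding h_def using a small norm_nonneg[OF a]
    by (simp add: cstar_identity power2_eq_square mult_less_cancel_right2 less_1_mult
        mult_le_one less_le_trans[OF mult_strict_mono[of _ 1 _ 1]])
  then have r: "0 \<le> r" "r < 1" and sq: "sqrt (1 - cnrm A h) * sqrt (1 - cnrm A h) = 1 - cnrm A h"
    using norm_nonneg[OF h(1)] by (auto simp: r_def)
  have r_eq: "(cnrm A h + r * r) / 2 = r"
    unfolding r_def by (simp add: left_diff_distrib right_diff_distrib sq del: real_sqrt_mult_self)
  have F: "F k \<in> carr A \<and> cnrm A (F k) \<le> r \<and> cadj A (F k) = F k"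
    if k: "k \<in> carr A" "cnrm A k \<le> r" "cadj A k = k" for k
  proof -
    have "cnrm A (cadd A h (cmul A k k)) \<le> cnrm A h + r * r"
      using k h norm_triangle[of h "cmul A k k"] norm_mul[of k k] norm_nonneg[of k]
        mult_mono[OF k(2) k(2)] r by (smt (verit) mul_closed)
    then show ?thesis
      using k h r_eq by (simp add: F_def norm_scale adj_scale adj_add adj_mul)
  qed
  have K: "K n \<in> carr A \<and> cnrm A (K n) \<le> r \<and> cadj A (K n) = K n" for n
  proof (induction n)
    case 0
    have "cadj A (czero A) = czero A"
      using adj_scale[of "czero A" 0] by (simp add: scale_0)
    then show ?case
      using r by (simp add: K_def)
  next
    case (Suc n)
    then show ?case
      using F[of "K n"] by (simp add: K_def)
  qed
  have dF: "cdist A (F k) (F l) \<le> (cnrm A k + cnrm A l) / 2 * cdist A k l"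
    if "k \<in> carr A" "l \<in> carr A" for k l
  proof -
    have "cdist A (F k) (F l) = cdist A (cadd A h (cmul A k k)) (cadd A h (cmul A l l)) / 2"
      unfolding F_def using that h by (simp add: cdist_scale)
    also have "\<dots> \<le> cdist A (cmul A k k) (cmul A l l) / 2"
      using cdist_add[of h "cmul A k k" h "cmul A l l"] that h by simp
    also have "\<dots> \<le> (cdist A (cmul A k k) (cmul A k l) + cdist A (cmul A k l) (cmul A l l)) / 2"
      using cdist_triangle[of "cmul A k k" "cmul A k l" "cmul A l l"] that by simp
    also have "\<dots> \<le> (cnrm A k * cdist A k l + cdist A k l * cnrm A l) / 2"
      using cdist_mul_left[of k k l] cdist_mul_right[of l k l] that by simp
    finally show ?thesis
      by (simp add: algebra_simps)
  qed
  \<comment> \<open>The iteration starts at zero, so the case \<open>n = 0\<close> only says that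
    all iterates stay in the unit ball.\<close>
  have dK: "cdist A (K (n + m)) (K n) \<le> r ^ n" for n m
  proof (induction n)
    case 0
    then show ?case
      using K[of m] r by (simp add: K_def cdist_zero)
  next
    case (Suc n)
    have "cdist A (K (Suc n + m)) (K (Suc n))
        \<le> (cnrm A (K (n + m)) + cnrm A (K n)) / 2 * cdist A (K (n + m)) (K n)"
      using dF[of "K (n + m)" "K n"] K by (simp add: K_def)
    also have "\<dots> \<le> r * cdist A (K (n + m)) (K n)"
      using K[of n] K[of "n + m"] cdist_nonneg by (intro mult_right_mono) auto
    also have "\<dots> \<le> r * r ^ n"
      using Suc r by (intro mult_left_mono) auto
    finally show ?case
      by simp
  qed
  have rn: "(\<lambda>n. r ^ n) \<longlonglongrightarrow> 0"
    using r by (intro LIMSEQ_power_zero) auto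
  have "\<exists>N. \<forall>m\<ge>N. \<forall>n\<ge>N. cdist A (K m) (K n) < e" if e: "e > 0" for e
  proof -
    obtain N where N: "r ^ N < e / 2"
      using real_arch_pow_inv[of "e / 2" r] e r by auto
    have "cdist A (K m) (K n) < e" if "m \<ge> N" "n \<ge> N" for m n
    proof -
      have "cdist A (K m) (K n) \<le> cdist A (K m) (K N) + cdist A (K n) (K N)"
        using cdist_triangle[of "K m" "K N" "K n"] cdist_commute[of "K n" "K N"] K by simp
      also have "\<dots> < e"
        using dK[of N "m - N"] dK[of N "n - N"] N that by simp
      finally show ?thesis .
    qed
    then show ?thesis
      by blast
  qed
  then obtain k where k: "k \<in> carr A" "(\<lambda>n. cdist A (K n) k) \<longlonglongrightarrow> 0"
    using complete[of K] K by blast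
  have "cdist A (cadj A k) k \<le> 0"
  proof (rule LIMSEQ_le_const)
    show "(\<lambda>n. cdist A (K n) k + cdist A (K n) k) \<longlonglongrightarrow> 0"
      using tendsto_add[OF k(2) k(2)] by simp
    have "cdist A (cadj A k) k \<le> cdist A (K n) k + cdist A (K n) k" for n
      using cdist_triangle[of "cadj A k" "K n" k] cdist_adj[of k "K n"] cdist_commute[of k "K n"] K[of n] k(1)
      by simp
    then show "\<exists>N. \<forall>n\<ge>N. cdist A (cadj A k) k \<le> cdist A (K n) k + cdist A (K n) k"
      by blast
  qed
  then have adj: "cadj A k = k"
    using k by (intro cdist_le_0_imp_eq) auto
  have Fk: "F k \<in> carr A"
    using k h by (simp add: F_def)
  have "cdist A (F k) k \<le> 0"
  proof (rule LIMSEQ_le_const)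
    let ?C = "(cnrm A k + r) / 2"
    show "(\<lambda>n. ?C * cdist A (K n) k + cdist A (K (Suc n)) k) \<longlonglongrightarrow> 0"
      using tendsto_add[OF tendsto_mult_right_zero[OF k(2), of ?C] LIMSEQ_Suc[OF k(2)]] by simp
    have "cdist A (F k) k \<le> ?C * cdist A (K n) k + cdist A (K (Suc n)) k" for n
    proof -
      have "cdist A (F k) k \<le> cdist A (F k) (K (Suc n)) + cdist A (K (Suc n)) k"
        using K Fk k cdist_triangle by blast
      also have "cdist A (F k) (K (Suc n)) \<le> (cnrm A k + cnrm A (K n)) / 2 * cdist A k (K n)"
        using dF[of k "K n"] k K by (simp add: K_def)
      also have "\<dots> \<le> ?C * cdist A k (K n)"
        using K[of n] k cdist_nonneg[of k "K n"] by (intro mult_right_mono) auto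
      finally show ?thesis
        using cdist_commute k K by simp
    qed
    then show "\<exists>N. \<forall>n\<ge>N. cdist A (F k) k \<le> ?C * cdist A (K n) k + cdist A (K (Suc n)) k"
      by blast
  qed
  then have "F k = k"
    using Fk k by (intro cdist_le_0_imp_eq) auto
  then have "cadd A (F k) (F k) = cadd A k k"
    by simp
  moreover have "cadd A (F k) (F k) = cadd A h (cmul A k k)"
    using add_scale[of "cadd A h (cmul A k k)" "1/2" "1/2"] k h by (simp add: F_def scale_one)
  ultimately show ?thesis
    using that k(1) adj by (simp add: h_def)
qed

end

text \<open>Representations, as defined for the minimal norm, in terms of the types \<open>l2\<close> and \<open>blinfun\<close>.\<close>

definition op_rep :: "'u cstar \<Rightarrow> ('u \<Rightarrow> 'h op) \<Rightarrow> bool" where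
  "op_rep A r \<longleftrightarrow>
     (\<forall>a\<in>carr A. clin (r a)) \<and>
     (\<forall>a\<in>carr A. \<forall>b\<in>carr A. r (cadd A a b) = r a + r b) \<and>
     (\<forall>c. \<forall>a\<in>carr A. r (cscale A c a) = cmult c o\<^sub>L r a) \<and>
     (\<forall>a\<in>carr A. \<forall>b\<in>carr A. r (cmul A a b) = r a o\<^sub>L r b) \<and>
     (\<forall>a\<in>carr A. adjoint_entries (r a) (r (cadj A a)))"

lemma op_repD:
  assumes "op_rep A r"
  shows "a \<in> carr A \<Longrightarrow> clin (r a)"
    and "a \<in> carr A \<Longrightarrow> b \<in> carr A \<Longrightarrow> r (cadd A a b) = r a + r b"
    and "a \<in> carr A \<Longrightarrow> r (cscale A c a) = cmult c o\<^sub>L r a"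
    and "a \<in> carr A \<Longrightarrow> b \<in> carr A \<Longrightarrow> r (cmul A a b) = r a o\<^sub>L r b"
    and "a \<in> carr A \<Longrightarrow> adjoint_entries (r a) (r (cadj A a))"
  using assms unfolding op_rep_def by blast+

lemma adjoint_entries_zero: "adjoint_entries 0 0"
  by (simp add: adjoint_entries_def)

lemma op_rep_zero: "op_rep A (\<lambda>a. 0)"
proof -
  have "cmult c o\<^sub>L (0 :: 'h op) = 0" for c
    by (rule blinfun_eqI) (auto intro!: l2_eqI)
  moreover have "0 o\<^sub>L (0 :: 'h op) = 0"
    by (rule blinfun_eqI) simp
  ultimately show ?thesis
    by (simp add: op_rep_def clin_zero adjoint_entries_zero)
qed

lemma op_rep_transport:
  assumes "op_rep A r" "inj e"
  shows "op_rep A (\<lambda>a. transport e UNIV (r a))"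
  using assms
  by (auto simp: op_rep_def transport_add transport_cmult transport_compose
      intro: clin_transport adjoint_entries_transport)

lemma star_homD:
  assumes "star_hom A B f"
  shows "x \<in> carr A \<Longrightarrow> f x \<in> carr B"
    and "x \<in> carr A \<Longrightarrow> y \<in> carr A \<Longrightarrow> f (cadd A x y) = cadd B (f x) (f y)"
    and "x \<in> carr A \<Longrightarrow> f (cscale A c x) = cscale B c (f x)"
    and "x \<in> carr A \<Longrightarrow> y \<in> carr A \<Longrightarrow> f (cmul A x y) = cmul B (f x) (f y)"
    and "x \<in> carr A \<Longrightarrow> f (cadj A x) = cadj B (f x)"
  using assms unfolding star_hom_def clinear_map_def by blast+

lemma op_rep_star_hom:
  assumes "op_rep B r" "star_hom A B f"
  shows "op_rep A (\<lambda>a. r (f a))"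
  using assms by (simp add: op_rep_def star_homD[OF assms(2)])

text \<open>With \<open>k\<close> from the fixed point, the adjoint of \<open>r a\<close> times
  \<open>r a\<close> equals \<open>1 - (1 - r k)\<^sup>2\<close>, so \<open>\<parallel>r a
  x\<parallel>\<^sup>2 = \<parallel>x\<parallel>\<^sup>2 - \<parallel>x - r k
  x\<parallel>\<^sup>2\<close>. The identity operator is available here even if the algebra has no
  identity.\<close>

lemma norm_op_rep_le_aux:
  assumes A: "cstar_algebra A" and r: "op_rep A r" and a: "a \<in> carr A" and small: "cnrm A a < 1"
  shows "norm (r a) \<le> 1"
proof (rule norm_blinfun_bound)
  fix x
  interpret cstar_algebra A by (rule A)
  obtain k where k: "k \<in> carr A" "cadj A k = k"
    and eq: "cadd A k k = cadd A (cmul A (cadj A a) a) (cmul A k k)"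
    using selfadjoint_fixed_point[OF a small] by blast
  have adj: "inner (r (cadj A b) u) v = inner u (r b v)" if "b \<in> carr A" for b u v
  proof -
    have "ell2_inner (coord (r (cadj A b) u)) (coord v) = ell2_inner (coord u) (coord (r b v))"
      using adjoint_entries_iff[of "r b" "r (cadj A b)"] op_repD(1,5)[OF r] that by auto
    then show ?thesis
      by (simp add: inner_l2_def)
  qed
  have "r k + r k = (r (cadj A a) o\<^sub>L r a) + (r k o\<^sub>L r k)"
    using arg_cong[OF eq, of r] a k by (simp add: op_repD[OF r])
  then have "r (cadj A a) (r a x) = r k x + r k x - r k (r k x)"
    by (metis (no_types, lifting) add_diff_cancel_right' blinfun.add_left blinfun_apply_blinfun_compose)
  then have "inner (r (cadj A a) (r a x)) x = 2 * inner (r k x) x - inner (r k (r k x)) x"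
    by (simp add: inner_add_left inner_diff_left)
  moreover have "inner (r k (r k x)) x = inner (r k x) (r k x)"
    using adj[OF k(1), of "r k x" x] k by simp
  moreover have "inner (r (cadj A a) (r a x)) x = inner (r a x) (r a x)"
    by (rule adj[OF a])
  ultimately have "(norm (r a x))\<^sup>2 = (norm x)\<^sup>2 - (norm (x - r k x))\<^sup>2"
    by (simp add: power2_norm_eq_inner inner_diff_left inner_diff_right inner_commute)
  then have "(norm (r a x))\<^sup>2 \<le> (norm x)\<^sup>2"
    by simp
  then show "norm (r a x) \<le> 1 * norm x"
    by (simp add: power2_le_iff_abs_le)
qed simp

lemma norm_op_rep_le:
  assumes A: "cstar_algebra A" and r: "op_rep A r" and a: "a \<in> carr A"
  shows "norm (r a) \<le> cnrm A a"
proof (rule field_le_epsilon)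
  interpret cstar_algebra A by (rule A)
  fix e :: real assume "e > 0"
  \<comment> \<open>The summand \<open>e\<close> makes the rescaled element have norm strictly below
    1 and keeps \<open>c\<close> positive when \<open>a\<close> is zero.\<close>
  define c where "c = cnrm A a + e"
  have c: "c > 0"
    using norm_nonneg[OF a] \<open>e > 0\<close> by (simp add: c_def)
  have "cnrm A (cscale A (of_real (1 / c)) a) < 1"
    using c \<open>e > 0\<close> unfolding norm_scale[OF a] norm_of_real by (simp add: c_def)
  then have "norm (r (cscale A (of_real (1 / c)) a)) \<le> 1"
    by (intro norm_op_rep_le_aux[OF A r]) (use a in auto)
  moreover have "r (cscale A (of_real (1 / c)) a) = (1 / c) *\<^sub>R r a"
    using a by (intro blinfun_eqI) (simp only: op_repD[OF r] blinfun_apply_blinfun_compose cmult_apply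
      scaleC_of_real blinfun.scaleR_left)
  ultimately show "norm (r a) \<le> cnrm A a + e"
    using c by (simp add: field_simps c_def)
qed

text \<open>Every member of the family annihilates the difference of \<open>x\<close> and
  \<open>y\<close>, so joint faithfulness makes its norm zero.\<close>

lemma jointly_faithful_eq:
  assumes A: "cstar_algebra A" and rep: "\<And>i. i \<in> I \<Longrightarrow> op_rep A (Q i)"
    and faithful: "\<And>x. x \<in> carr A \<Longrightarrow> (\<And>i. i \<in> I \<Longrightarrow> norm (Q i x) \<le> 0) \<Longrightarrow> cnrm A x \<le> 0"
    and x: "x \<in> carr A" and y: "y \<in> carr A" and eq: "\<And>i. i \<in> I \<Longrightarrow> Q i x = Q i y"
  shows "x = y"
proof -
  interpret cstar_algebra A by (rule A)
  have "cnrm A (cadd A x (cscale A (- 1) y)) \<le> 0"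
  proof (rule faithful)
    fix i assume i: "i \<in> I"
    have "Q i (cadd A x (cscale A (- 1) y)) = 0"
      using x y eq[OF i] by (intro blinfun_eqI l2_eqI) (simp add: op_repD[OF rep[OF i]] blinfun.add_left)
    then show "norm (Q i (cadd A x (cscale A (- 1) y))) \<le> 0"
      by simp
  qed (use x y in auto)
  then show ?thesis
    using x y cdist_le_0_imp_eq by (simp add: cdist_def)
qed

section \<open>Translation to and from representations on function spaces\<close>

definition op_of_rep :: "('u \<Rightarrow> ('h \<Rightarrow> complex) \<Rightarrow> ('h \<Rightarrow> complex)) \<Rightarrow> 'u \<Rightarrow> 'h op" where
  "op_of_rep \<pi> a = op_of (\<lambda>x. \<pi> a (coord x))"

definition rep_of_op :: "('u \<Rightarrow> 'h op) \<Rightarrow> 'u \<Rightarrow> ('h \<Rightarrow> complex) \<Rightarrow> ('h \<Rightarrow> complex)" where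
  "rep_of_op r a \<xi> = coord (r a (Abs_l2 \<xi>))"

lemma bounded_operatorD:
  assumes "bounded_operator T" "\<xi> \<in> ell2"
  shows "T \<xi> \<in> ell2" and "\<eta> \<in> ell2 \<Longrightarrow> T (\<lambda>z. \<xi> z + \<eta> z) = (\<lambda>z. T \<xi> z + T \<eta> z)"
    and "T (\<lambda>z. c * \<xi> z) = (\<lambda>z. c * T \<xi> z)"
  using assms unfolding bounded_operator_def by blast+

lemma op_of_bounded_operator:
  assumes "bounded_operator T"
  shows "coord (op_of (\<lambda>x. T (coord x)) x) = T (coord x)" and "clin (op_of (\<lambda>x. T (coord x)))"
proof -
  obtain K where K: "\<And>\<xi>. \<xi> \<in> ell2 \<Longrightarrow> ell2_norm (T \<xi>) \<le> K * ell2_norm \<xi>"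
    using assms unfolding bounded_operator_def by blast
  \<comment> \<open>The constant \<open>K\<close> may be negative, whereas a bound for the squares
    needs \<open>\<bar>K\<bar>\<close>.\<close>
  have *: "(\<Sum>z\<in>F. (cmod (T (coord x) z))\<^sup>2) \<le> (\<bar>K\<bar> * norm x)\<^sup>2" if "finite F" for F x
  proof -
    have "(\<Sum>z\<in>F. (cmod (T (coord x) z))\<^sup>2) \<le> (ell2_norm (T (coord x)))\<^sup>2"
      by (rule ell2_sum_le[OF bounded_operatorD(1)[OF assms coord_ell2] that])
    moreover have "ell2_norm (T (coord x)) \<le> K * norm x"
      using K[OF coord_ell2[of x]] by (simp only: norm_l2_def)
    moreover have "K * norm x \<le> \<bar>K\<bar> * norm x"
      by (intro mult_right_mono) auto
    moreover have "0 \<le> ell2_norm (T (coord x))"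
      by (simp add: ell2_norm_def infsum_nonneg)
    ultimately show ?thesis
      by (meson order_trans power_mono)
  qed
  have add: "T (coord (x + y)) z = T (coord x) z + T (coord y) z" for x y z
    using bounded_operatorD(2)[OF assms coord_ell2 coord_ell2] by simp
  have scale: "T (coord (scaleC c x)) z = c * T (coord x) z" for c x z
    using bounded_operatorD(3)[OF assms coord_ell2] by simp
  show "coord (op_of (\<lambda>x. T (coord x)) x) = T (coord x)"
    by (rule coord_op_of[where \<Phi> = "\<lambda>x. T (coord x)", OF add scale *]) auto
  show "clin (op_of (\<lambda>x. T (coord x)))"
    by (rule clin_op_of[where \<Phi> = "\<lambda>x. T (coord x)", OF add scale *]) auto
qed

lemma op_rep_op_of_rep:
  assumes A: "cstar_algebra A" and \<pi>: "representation A \<pi>"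
  shows "op_rep A (op_of_rep \<pi>)"
    and coord_op_of_rep: "a \<in> carr A \<Longrightarrow> coord (op_of_rep \<pi> a x) = \<pi> a (coord x)"
proof -
  interpret cstar_algebra A by (rule A)
  have bounded: "bounded_operator (\<pi> a)" if "a \<in> carr A" for a
    using \<pi> that by (simp add: representation_def)
  show coord: "coord (op_of_rep \<pi> a x) = \<pi> a (coord x)" if "a \<in> carr A" for a x
    unfolding op_of_rep_def using bounded[OF that] by (rule op_of_bounded_operator)
  have clin: "clin (op_of_rep \<pi> a)" if "a \<in> carr A" for a
    unfolding op_of_rep_def using bounded[OF that] by (rule op_of_bounded_operator)
  show "op_rep A (op_of_rep \<pi>)"
    unfolding op_rep_def
  proof (intro conjI allI ballI)
    fix a assume a: "a \<in> carr A"
    show "clin (op_of_rep \<pi> a)"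
      by (rule clin[OF a])
    show "adjoint_entries (op_of_rep \<pi> a) (op_of_rep \<pi> (cadj A a))"
      using \<pi> a by (simp add: adjoint_entries_iff clin coord representation_def)
    show "op_of_rep \<pi> (cscale A c a) = cmult c o\<^sub>L op_of_rep \<pi> a" for c
      using \<pi> a by (intro blinfun_eqI l2_eqI) (simp add: coord representation_def)
    fix b assume b: "b \<in> carr A"
    show "op_of_rep \<pi> (cadd A a b) = op_of_rep \<pi> a + op_of_rep \<pi> b"
      using \<pi> a b by (intro blinfun_eqI l2_eqI) (simp add: coord representation_def blinfun.add_left)
    show "op_of_rep \<pi> (cmul A a b) = op_of_rep \<pi> a o\<^sub>L op_of_rep \<pi> b"
      using \<pi> a b by (intro blinfun_eqI l2_eqI) (simp add: coord representation_def)
  qed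
qed

lemma coord_Abs_l2: "\<xi> \<in> ell2 \<Longrightarrow> coord (Abs_l2 \<xi>) = \<xi>"
  by (rule Abs_l2_inverse)

lemma Abs_l2_add: "\<xi> \<in> ell2 \<Longrightarrow> \<eta> \<in> ell2 \<Longrightarrow> Abs_l2 (\<lambda>z. \<xi> z + \<eta> z) = Abs_l2 \<xi> + Abs_l2 \<eta>"
  by (simp add: plus_l2_def coord_Abs_l2)

lemma Abs_l2_scale: "\<xi> \<in> ell2 \<Longrightarrow> Abs_l2 (\<lambda>z. c * \<xi> z) = scaleC c (Abs_l2 \<xi>)"
  by (simp add: scaleC_def coord_Abs_l2)

lemma representation_rep_of_op:
  assumes A: "cstar_algebra A" and r: "op_rep A r"
  shows "representation A (rep_of_op r)"
proof -
  interpret cstar_algebra A by (rule A)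
  have "bounded_operator (rep_of_op r a)" if a: "a \<in> carr A" for a
    unfolding bounded_operator_def rep_of_op_def
  proof (intro conjI ballI allI exI[where x = "norm (r a)"])
    fix \<xi> \<eta> :: "'b \<Rightarrow> complex" assume "\<xi> \<in> ell2" "\<eta> \<in> ell2"
    then show "coord (r a (Abs_l2 (\<lambda>z. \<xi> z + \<eta> z))) = (\<lambda>z. coord (r a (Abs_l2 \<xi>)) z + coord (r a (Abs_l2 \<eta>)) z)"
      by (simp add: Abs_l2_add blinfun.add_right)
  next
    fix \<xi> :: "'b \<Rightarrow> complex" and c assume \<xi>: "\<xi> \<in> ell2"
    show "coord (r a (Abs_l2 \<xi>)) \<in> ell2"
      by simp
    show "coord (r a (Abs_l2 (\<lambda>z. c * \<xi> z))) = (\<lambda>z. c * coord (r a (Abs_l2 \<xi>)) z)"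
      using \<xi> a by (simp add: Abs_l2_scale clinD op_repD[OF r])
    show "ell2_norm (coord (r a (Abs_l2 \<xi>))) \<le> norm (r a) * ell2_norm \<xi>"
      using norm_blinfun[of "r a" "Abs_l2 \<xi>"] \<xi> by (simp add: norm_l2_def coord_Abs_l2)
  qed
  moreover have "ell2_inner (rep_of_op r (cadj A a) \<xi>) \<eta> = ell2_inner \<xi> (rep_of_op r a \<eta>)"
    if "a \<in> carr A" "\<xi> \<in> ell2" "\<eta> \<in> ell2" for a \<xi> \<eta>
  proof -
    have "ell2_inner (coord (r (cadj A a) (Abs_l2 \<xi>))) (coord (Abs_l2 \<eta>))
        = ell2_inner (coord (Abs_l2 \<xi>)) (coord (r a (Abs_l2 \<eta>)))"
      using that adjoint_entries_iff[of "r a" "r (cadj A a)"] by (simp add: op_repD[OF r])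
    then show ?thesis
      using that by (simp add: rep_of_op_def coord_Abs_l2)
  qed
  ultimately show ?thesis
    unfolding representation_def
    by (auto simp: rep_of_op_def op_repD[OF r] blinfun.add_left coord_inverse)
qed

text \<open>Every \<open>op_rep\<close> thus comes from a representation in the sense of the minimal
  norm, so both kinds give the same supremum.\<close>

lemma op_of_rep_of_op:
  assumes A: "cstar_algebra A" and r: "op_rep A r" and a: "a \<in> carr A"
  shows "op_of_rep (rep_of_op r) a = r a"
  by (intro blinfun_eqI l2_eqI)
    (simp add: coord_op_of_rep[OF A representation_rep_of_op[OF A r] a] rep_of_op_def coord_inverse)

section \<open>The minimal norm as a supremum of operator norms\<close>

abbreviation rep_ops :: "('u \<Rightarrow> 'h op) list \<Rightarrow> 'u list \<Rightarrow> 'h op list" where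
  "rep_ops \<equiv> map2 (\<lambda>r a. r a)"

text \<open>The image of the formal sum \<open>X\<close> of elementary tensors under the product of
  the representations \<open>rs\<close>.\<close>

definition alg_op :: "('u \<Rightarrow> 'h op) list \<Rightarrow> 'u list list \<Rightarrow> 'h list op" where
  "alg_op rs X = (\<Sum>as\<leftarrow>X. tensor_ops (rep_ops rs as))"

lemma alg_op_simps [simp]:
  "alg_op rs [] = 0"
  "alg_op rs (as # X) = tensor_ops (rep_ops rs as) + alg_op rs X"
  "alg_op rs (X @ Y) = alg_op rs X + alg_op rs Y"
  by (simp_all add: alg_op_def)

lemma clin_rep_ops:
  assumes "list_all2 op_rep As rs" "as \<in> elementary As"
  shows "\<forall>T\<in>set (rep_ops rs as). clin T"
  using assms unfolding elementary_def list_all2_conv_all_nth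
  by (auto simp: set_zip op_repD(1))

lemma clin_alg_op:
  assumes "list_all2 op_rep As rs" "set X \<subseteq> elementary As"
  shows "clin (alg_op rs X)"
  using assms(2)
  by (induction X) (auto intro!: clin_zero clin_add clin_tensor_ops clin_rep_ops[OF assms(1), rule_format])

lemma blinfun_sum_list_left: "blinfun_apply (\<Sum>i\<leftarrow>xs. T i) x = (\<Sum>i\<leftarrow>xs. T i x)"
  by (induction xs) (simp_all add: blinfun.add_left)

lemma blinfun_sum_list_right: "blinfun_apply T (\<Sum>i\<leftarrow>xs. f i) = (\<Sum>i\<leftarrow>xs. T (f i))"
  by (induction xs) (simp_all add: blinfun.add_right blinfun.zero_right)

lemma norm_op_le_finite:
  assumes K: "0 \<le> K"
    and *: "\<And>S x. finite S \<Longrightarrow> norm x \<le> 1 \<Longrightarrow> norm (blinfun_apply T (restrict_l2 S x)) \<le> K"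
  shows "norm T \<le> K"
proof (rule norm_blinfun_bound)
  have 1: "norm (T x) \<le> K" if "norm x \<le> 1" for x
  proof (rule field_le_epsilon)
    fix e :: real assume e: "e > 0"
    have "0 < e / (norm T + 1)"
      using e by (simp add: add_nonneg_pos)
    then obtain S where S: "finite S" "norm (x - restrict_l2 S x) < e / (norm T + 1)"
      by (rule restrict_l2_approx)
    have "norm (T (x - restrict_l2 S x)) \<le> norm T * (e / (norm T + 1))"
      using S by (intro order_trans[OF norm_blinfun] mult_left_mono) auto
    also have "\<dots> \<le> e"
      using e unfolding times_divide_eq_right
      by (subst pos_divide_le_eq) (auto simp: algebra_simps intro: add_pos_nonneg)
    finally have "norm (T x - T (restrict_l2 S x)) \<le> e"
      by (simp add: blinfun.diff_right)
    then show "norm (T x) \<le> K + e"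
      using *[OF S(1) that] norm_triangle_sub[of "T x" "T (restrict_l2 S x)"] by linarith
  qed
  show "norm (T x) \<le> K * norm x" for x
  proof (cases "x = 0")
    case False
    have "norm (T (x /\<^sub>R norm x)) \<le> K"
      using False by (intro 1) simp
    then show ?thesis
      using False by (simp add: blinfun.scaleR_right field_simps)
  qed (simp add: blinfun.zero_right)
qed (rule K)

lemma tensor_vec_scaleC: "tensor_vec (scaleC c x # xs) = scaleC c (tensor_vec (x # xs))"
proof -
  have "vec_tensor (scaleC c x) y = scaleC c (vec_tensor x y)" for y :: "'a list l2"
    by (rule l2_eqI) auto
  then show ?thesis
    by (simp add: clinD clin_up inj_cons_pair)
qed

lemma tensor_vec_basis_vec: "tensor_vec (map basis_vec zs) = basis_vec zs"
proof (induction zs)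
  case (Cons z zs)
  have "vec_tensor (basis_vec z) (basis_vec zs) = basis_vec (z, zs)"
    by (rule l2_eqI) (auto split: if_splits)
  then show ?case
    using Cons up_basis_vec[OF inj_cons_pair, of "(z, zs)"] by simp
qed simp

definition alg_vectors :: "nat \<Rightarrow> 'a list l2 set" where
  "alg_vectors n = {\<Sum>xs\<leftarrow>W. tensor_vec xs | W. \<forall>xs\<in>set W. length xs = n}"

lemma restrict_l2_in_alg_vectors:
  assumes "finite S" "n > 0"
  shows "restrict_l2 (S \<inter> {zs. length zs = n}) x \<in> alg_vectors n"
proof -
  obtain l where l: "set l = S \<inter> {zs. length zs = n}" "distinct l"
    using assms(1) finite_distinct_list[of "S \<inter> {zs. length zs = n}"] by auto
  \<comment> \<open>The coefficient is absorbed into the first factor, hence the assumption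
    \<open>n > 0\<close>.\<close>
  define g where "g = (\<lambda>zs. scaleC (coord x zs) (basis_vec (hd zs)) # map basis_vec (tl zs))"
  have g: "tensor_vec (g zs) = scaleC (coord x zs) (basis_vec zs) \<and> length (g zs) = n" if zs: "zs \<in> set l" for zs
  proof -
    obtain z zs' where "zs = z # zs'"
      using zs l(1) assms(2) by (metis (mono_tags, lifting) IntE length_greater_0_conv list.exhaust mem_Collect_eq)
    then show ?thesis
      using zs l tensor_vec_basis_vec[of zs]
      by (simp add: g_def tensor_vec_scaleC del: tensor_vec.simps)
  qed
  have "restrict_l2 (set l) x = (\<Sum>zs\<leftarrow>l. scaleC (coord x zs) (basis_vec zs))"
    by (simp add: restrict_l2_finite sum_list_distinct_conv_sum_set l(2))
  also have "\<dots> = (\<Sum>xs\<leftarrow>map g l. tensor_vec xs)"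
    using g by (simp add: o_def cong: map_cong)
  finally show ?thesis
    unfolding alg_vectors_def l(1)[symmetric] using g by fastforce
qed

text \<open>Finitely supported vectors on lists of length \<open>n\<close> are finite sums of
  elementary tensors, and \<open>T\<close> ignores the other lengths; so algebraic vectors already
  detect the operator norm.\<close>

lemma norm_op_le_alg_vectors:
  fixes T :: "'a list l2 \<Rightarrow>\<^sub>L 'b l2"
  assumes K: "0 \<le> K" and n: "n > 0"
    and clin: "clin T" and supp: "\<And>zs. length zs \<noteq> n \<Longrightarrow> T (basis_vec zs) = 0"
    and *: "\<And>x. x \<in> alg_vectors n \<Longrightarrow> norm x \<le> 1 \<Longrightarrow> norm (blinfun_apply T x) \<le> K"
  shows "norm T \<le> K"
proof (rule norm_op_le_finite[OF K])
  fix S :: "'a list set" and x :: "'a list l2" assume S: "finite S" and x: "norm x \<le> 1"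
  let ?S' = "S \<inter> {zs. length zs = n}"
  have "T (restrict_l2 S x) = (\<Sum>zs\<in>S. scaleC (coord x zs) (T (basis_vec zs)))"
    using S clin by (simp add: restrict_l2_finite blinfun.sum_right clinD)
  also have "\<dots> = (\<Sum>zs\<in>?S'. scaleC (coord x zs) (T (basis_vec zs)))"
    using S by (intro sum.mono_neutral_right) (auto intro!: l2_eqI simp: supp)
  also have "\<dots> = T (restrict_l2 ?S' x)"
    using S clin by (simp add: restrict_l2_finite blinfun.sum_right clinD)
  finally show "norm (T (restrict_l2 S x)) \<le> K"
    using * restrict_l2_in_alg_vectors[OF S n] order_trans[OF norm_restrict_l2_le x] by simp
qed

lemma tensor_ops_basis_vec_length:
  assumes "\<forall>T\<in>set Ts. clin T" "length zs \<noteq> length Ts"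
  shows "tensor_ops Ts (basis_vec zs) = 0"
  using entry_tensor_ops_length[OF assms(1)] assms(2) by (intro l2_eqI) (simp add: entry_def)

lemma coord_sum_list': "coord (\<Sum>i\<leftarrow>S. f i) = (\<lambda>z. \<Sum>i\<leftarrow>S. coord (f i) z)"
  by (rule ext) simp

text \<open>The supremum in the definition runs over algebraic vectors only; they suffice by
  \<open>norm_op_le_alg_vectors\<close>, since the operator kills lists of the wrong length. What
  remains is to translate between lists of functions and lists of elements of
  \<open>l2\<close>.\<close>

lemma spatial_norm_eq:
  assumes As: "As \<noteq> []" "\<forall>A\<in>set As. cstar_algebra A"
    and \<pi>s: "list_all2 representation As \<pi>s" and X: "set X \<subseteq> elementary As"
  shows "spatial_norm \<pi>s X = norm (alg_op (map op_of_rep \<pi>s) X)"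
proof -
  define n where "n = length As"
  have n: "n > 0" "length \<pi>s = n"
    using As \<pi>s by (auto simp: n_def list_all2_lengthD)
  let ?rs = "map op_of_rep \<pi>s"
  let ?O = "alg_op ?rs X"
  have rs: "list_all2 op_rep As ?rs"
    using \<pi>s As unfolding list_all2_conv_all_nth by (auto intro: op_rep_op_of_rep)
  have elem: "coord (tensor_ops (rep_ops ?rs as) (tensor_vec xs))
      = tensor_vector (map (\<lambda>(\<pi>, a, \<xi>). \<pi> a \<xi>) (zip \<pi>s (zip as (map coord xs))))"
    if as: "as \<in> elementary As" and xs: "length xs = n" for as xs
  proof -
    have len: "length as = n"
      using as by (simp add: elementary_def list_all2_lengthD n_def)
    have "clin (op_of_rep (\<pi>s ! i) (as ! i))" if "i < n" for i
      using rs as that n op_repD(1)[of "As ! i" "op_of_rep (\<pi>s ! i)" "as ! i"]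
      by (simp add: elementary_def list_all2_conv_all_nth n_def)
    then have "list_all2 (\<lambda>T x. clin T) (rep_ops ?rs as) xs"
      using len xs n by (simp add: list_all2_conv_all_nth)
    then have "coord (tensor_ops (rep_ops ?rs as) (tensor_vec xs))
        = tensor_vector (map coord (map2 blinfun_apply (rep_ops ?rs as) xs))"
      by (simp add: tensor_ops_tensor_vec coord_tensor_vec)
    also have "map coord (map2 blinfun_apply (rep_ops ?rs as) xs)
        = map (\<lambda>(\<pi>, a, \<xi>). \<pi> a \<xi>) (zip \<pi>s (zip as (map coord xs)))"
    proof (rule nth_equalityI)
      fix i assume "i < length (map coord (map2 blinfun_apply (rep_ops ?rs as) xs))"
      then have i: "i < n"
        using len xs n by simp
      then have "as ! i \<in> carr (As ! i)" "cstar_algebra (As ! i)" "representation (As ! i) (\<pi>s ! i)"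
        using as As \<pi>s by (auto simp: elementary_def list_all2_conv_all_nth n_def)
      then show "map coord (map2 blinfun_apply (rep_ops ?rs as) xs) ! i
          = map (\<lambda>(\<pi>, a, \<xi>). \<pi> a \<xi>) (zip \<pi>s (zip as (map coord xs))) ! i"
        using i len xs n by (simp add: coord_op_of_rep)
    qed (use len xs n in simp)
    finally show ?thesis .
  qed
  have O: "coord (?O (\<Sum>xs\<leftarrow>W. tensor_vec xs)) = (\<lambda>zs. \<Sum>as\<leftarrow>X. \<Sum>xs\<leftarrow>W.
      tensor_vector (map (\<lambda>(\<pi>, a, \<xi>). \<pi> a \<xi>) (zip \<pi>s (zip as (map coord xs)))) zs)"
    if W: "\<forall>xs\<in>set W. length xs = n" for W
    unfolding alg_op_def blinfun_sum_list_left
    unfolding blinfun_sum_list_right coord_sum_list'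
    using elem W X by (intro ext arg_cong[where f = sum_list] map_cong) (auto simp: subset_iff)
  let ?S = "{ell2_norm (\<lambda>zs. \<Sum>as\<leftarrow>X. \<Sum>\<xi>s\<leftarrow>V.
            tensor_vector (map (\<lambda>(\<pi>, a, \<xi>). \<pi> a \<xi>) (zip \<pi>s (zip as \<xi>s))) zs) | V.
          V \<in> vector_lists (length \<pi>s) \<and> ell2_norm (\<lambda>zs. \<Sum>\<xi>s\<leftarrow>V. tensor_vector \<xi>s zs) \<le> 1}"
  have S: "?S = {norm (?O x) | x. x \<in> alg_vectors n \<and> norm x \<le> 1}"
  proof (intro equalityI subsetI)
    fix s assume "s \<in> ?S"
    then obtain V where V: "V \<in> vector_lists n" and le: "ell2_norm (\<lambda>zs. \<Sum>\<xi>s\<leftarrow>V. tensor_vector \<xi>s zs) \<le> 1"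
      and s: "s = ell2_norm (\<lambda>zs. \<Sum>as\<leftarrow>X. \<Sum>\<xi>s\<leftarrow>V.
            tensor_vector (map (\<lambda>(\<pi>, a, \<xi>). \<pi> a \<xi>) (zip \<pi>s (zip as \<xi>s))) zs)"
      using n(2) by auto
    define W where "W = map (map Abs_l2) V"
    have W: "\<forall>xs\<in>set W. length xs = n"
      using V by (auto simp: W_def vector_lists_def)
    have "map coord (map Abs_l2 \<xi>s) = \<xi>s" if "\<xi>s \<in> set V" for \<xi>s
    proof -
      have "set \<xi>s \<subseteq> ell2"
        using that V by (simp add: vector_lists_def)
      then show ?thesis
        unfolding map_map by (intro map_idI) (auto simp: coord_Abs_l2)
    qed
    then have VW: "V = map (map coord) W"
      unfolding W_def map_map by (intro map_idI[symmetric]) simp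
    have "norm (\<Sum>xs\<leftarrow>W. tensor_vec xs) \<le> 1"
      using le by (simp add: norm_l2_def VW coord_tensor_vec coord_sum_list' o_def)
    moreover have "s = norm (?O (\<Sum>xs\<leftarrow>W. tensor_vec xs))"
      unfolding s norm_l2_def O[OF W] by (simp add: VW o_def)
    ultimately show "s \<in> {norm (?O x) | x. x \<in> alg_vectors n \<and> norm x \<le> 1}"
      using W by (auto simp: alg_vectors_def)
  next
    fix s assume "s \<in> {norm (?O x) | x. x \<in> alg_vectors n \<and> norm x \<le> 1}"
    then obtain W where W: "\<forall>xs\<in>set W. length xs = n" and le: "norm (\<Sum>xs\<leftarrow>W. tensor_vec xs) \<le> 1"
      and s: "s = norm (?O (\<Sum>xs\<leftarrow>W. tensor_vec xs))"
      by (auto simp: alg_vectors_def)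
    define V where "V = map (map coord) W"
    have "V \<in> vector_lists n"
      using W by (auto simp: V_def vector_lists_def)
    moreover have "ell2_norm (\<lambda>zs. \<Sum>\<xi>s\<leftarrow>V. tensor_vector \<xi>s zs) \<le> 1"
      using le by (simp add: norm_l2_def V_def coord_tensor_vec coord_sum_list' o_def)
    moreover have "s = ell2_norm (\<lambda>zs. \<Sum>as\<leftarrow>X. \<Sum>\<xi>s\<leftarrow>V.
            tensor_vector (map (\<lambda>(\<pi>, a, \<xi>). \<pi> a \<xi>) (zip \<pi>s (zip as \<xi>s))) zs)"
      unfolding s norm_l2_def O[OF W] by (simp add: V_def o_def)
    ultimately show "s \<in> ?S"
      using n(2) by auto
  qed
  have bound: "s \<le> norm ?O" if s: "s \<in> ?S" for s
  proof -
    obtain x where x: "s = norm (?O x)" "norm x \<le> 1"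
      using s unfolding S by blast
    then show ?thesis
      using order_trans[OF norm_blinfun[of ?O x] mult_left_le[of "norm x" "norm ?O"]] by simp
  qed
  \<comment> \<open>Used twice: the set is nonempty, and its supremum is nonnegative.\<close>
  have zero: "0 \<in> ?S"
  proof -
    have "0 \<in> alg_vectors n"
      unfolding alg_vectors_def by (rule CollectI, rule exI[where x = "[]"]) simp
    then show ?thesis
      unfolding S by (intro CollectI exI[where x = 0]) (simp add: blinfun.zero_right)
  qed
  have bdd: "bdd_above ?S"
    using bound by (rule bdd_aboveI)
  have clin: "clin ?O"
    by (rule clin_alg_op[OF rs X])
  have "?O (basis_vec zs) = 0" if "length zs \<noteq> n" for zs
  proof -
    have "tensor_ops (rep_ops ?rs as) (basis_vec zs) = 0" if "as \<in> set X" for as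
      using \<open>length zs \<noteq> n\<close> that X n clin_rep_ops[OF rs, of as]
      by (intro tensor_ops_basis_vec_length) (auto simp: elementary_def list_all2_lengthD n_def dest!: subsetD)
    then show ?thesis
      unfolding alg_op_def blinfun_sum_list_left by (simp cong: map_cong)
  qed
  moreover have "norm (?O x) \<le> Sup ?S" if "x \<in> alg_vectors n" "norm x \<le> 1" for x
    by (rule cSup_upper[OF _ bdd], unfold S) (use that in blast)
  ultimately have "norm ?O \<le> Sup ?S"
    using norm_op_le_alg_vectors[OF cSup_upper[OF zero bdd] n(1) clin] by blast
  moreover have "Sup ?S \<le> norm ?O"
    by (rule cSup_least[OF _ bound]) (use zero in blast)+
  ultimately show ?thesis
    unfolding spatial_norm_def by (rule antisym[rotated])
qed

text \<open>A bound that does not depend on the representations: it makes the minimal norm the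
  supremum of a bounded set.\<close>

lemma norm_alg_op_le:
  assumes As: "\<forall>A\<in>set As. cstar_algebra A" and rs: "list_all2 op_rep As rs"
    and X: "set X \<subseteq> elementary As"
  shows "norm (alg_op rs X) \<le> (\<Sum>as\<leftarrow>X. \<Prod>i<length As. cnrm (As ! i) (as ! i))"
  using X
proof (induction X)
  case (Cons as X)
  then have as: "as \<in> elementary As"
    by simp
  have len: "length as = length As" "length rs = length As"
    using as rs by (auto simp: elementary_def list_all2_lengthD)
  have "norm (tensor_ops (rep_ops rs as)) \<le> (\<Prod>T\<leftarrow>rep_ops rs as. norm T)"
    by (intro norm_tensor_ops_le clin_rep_ops[OF rs as])
  also have "\<dots> = (\<Prod>i<length As. norm ((rs ! i) (as ! i)))"
    using len by (simp add: prod.list_conv_set_nth atLeast0LessThan)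
  also have "\<dots> \<le> (\<Prod>i<length As. cnrm (As ! i) (as ! i))"
    using as As rs
    by (intro prod_mono) (auto simp: elementary_def list_all2_conv_all_nth intro!: norm_op_rep_le)
  finally show ?case
    using order_trans[OF norm_triangle_ineq add_mono] Cons by simp
qed simp

text \<open>Through \<open>spatial_norm_eq\<close> and the translation of representations, the
  minimal norm becomes the least upper bound of the norms of \<open>alg_op\<close>.\<close>

lemma min_norm_bounds:
  fixes As :: "'u cstar list" and rs :: "('u \<Rightarrow> 'u op) list"
  assumes As: "As \<noteq> []" "\<forall>A\<in>set As. cstar_algebra A" and X: "set X \<subseteq> elementary As"
  shows norm_alg_op_le_min_norm: "list_all2 op_rep As rs \<Longrightarrow> norm (alg_op rs X) \<le> min_norm As X"
    and min_norm_leI: "(\<And>rs :: ('u \<Rightarrow> 'u op) list. list_all2 op_rep As rs \<Longrightarrow>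
      norm (alg_op rs X) \<le> K) \<Longrightarrow> min_norm As X \<le> K"
proof -
  let ?S = "{spatial_norm \<pi>s X | \<pi>s :: ('u \<Rightarrow> ('u \<Rightarrow> complex) \<Rightarrow> ('u \<Rightarrow> complex)) list.
    list_all2 representation As \<pi>s}"
  have S: "?S = {norm (alg_op rs X) | rs :: ('u \<Rightarrow> 'u op) list. list_all2 op_rep As rs}"
  proof (intro equalityI subsetI)
    fix s assume "s \<in> ?S"
    then obtain \<pi>s :: "('u \<Rightarrow> ('u \<Rightarrow> complex) \<Rightarrow> ('u \<Rightarrow> complex)) list"
      where \<pi>s: "list_all2 representation As \<pi>s" and s: "s = spatial_norm \<pi>s X"
      by auto
    have "list_all2 op_rep As (map op_of_rep \<pi>s)"
      using \<pi>s As unfolding list_all2_conv_all_nth by (auto intro: op_rep_op_of_rep)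
    then show "s \<in> {norm (alg_op rs X) | rs :: ('u \<Rightarrow> 'u op) list. list_all2 op_rep As rs}"
      using spatial_norm_eq[OF As \<pi>s X] s by auto
  next
    fix s assume "s \<in> {norm (alg_op rs X) | rs :: ('u \<Rightarrow> 'u op) list. list_all2 op_rep As rs}"
    then obtain rs :: "('u \<Rightarrow> 'u op) list"
      where rs: "list_all2 op_rep As rs" and s: "s = norm (alg_op rs X)"
      by auto
    let ?\<pi>s = "map rep_of_op rs"
    have \<pi>s: "list_all2 representation As ?\<pi>s"
      using rs As unfolding list_all2_conv_all_nth by (auto intro: representation_rep_of_op)
    have "rep_ops (map op_of_rep ?\<pi>s) as = rep_ops rs as" if "as \<in> set X" for as
    proof -
      have "as \<in> elementary As"
        using that X by blast
      then have "op_of_rep (rep_of_op (rs ! i)) (as ! i) = (rs ! i) (as ! i)" if "i < length As" for i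
        using that rs As op_of_rep_of_op[of "As ! i" "rs ! i" "as ! i"]
        by (simp add: elementary_def list_all2_conv_all_nth)
      then show ?thesis
        using rs by (intro nth_equalityI) (auto simp: list_all2_conv_all_nth)
    qed
    then have "alg_op (map op_of_rep ?\<pi>s) X = alg_op rs X"
      unfolding alg_op_def by (simp cong: map_cong)
    then show "s \<in> ?S"
      using spatial_norm_eq[OF As \<pi>s X] s \<pi>s by (intro CollectI exI[where x = ?\<pi>s]) simp
  qed
  have bdd: "bdd_above ?S"
    unfolding S using norm_alg_op_le[OF As(2) _ X] by (auto intro!: bdd_aboveI)
  show "norm (alg_op rs X) \<le> min_norm As X" if "list_all2 op_rep As rs"
    unfolding min_norm_def using that by (intro cSup_upper bdd) (auto simp: S)
  have "list_all2 op_rep As (map (\<lambda>_ _. 0 :: 'u op) As)"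
    by (simp add: list_all2_conv_all_nth op_rep_zero)
  then have "?S \<noteq> {}"
    unfolding S by blast
  then show "min_norm As X \<le> K"
    if "\<And>rs :: ('u \<Rightarrow> 'u op) list. list_all2 op_rep As rs \<Longrightarrow> norm (alg_op rs X) \<le> K"
    unfolding min_norm_def using that by (intro cSup_least) (auto simp: S)
qed

section \<open>Minimal tensor products and their product representations\<close>

text \<open>A condition under which equality passes from elementary tensors to their closed span. In
  contrast to complex linearity it also holds for maps that involve the adjoint.\<close>

definition additive_bounded :: "'v cstar \<Rightarrow> ('v \<Rightarrow> 'b :: real_normed_vector) \<Rightarrow> bool" where
  "additive_bounded A F \<longleftrightarrow>
     (\<forall>x\<in>carr A. \<forall>y\<in>carr A. F (cadd A x y) = F x + F y) \<and>
     (\<exists>C. \<forall>x\<in>carr A. norm (F x) \<le> C * cnrm A x)"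

lemma additive_boundedI:
  assumes "\<And>x y. x \<in> carr A \<Longrightarrow> y \<in> carr A \<Longrightarrow> F (cadd A x y) = F x + F y"
    and "\<And>x. x \<in> carr A \<Longrightarrow> norm (F x) \<le> C * cnrm A x"
  shows "additive_bounded A F"
  using assms unfolding additive_bounded_def by blast

lemma additive_zero:
  fixes F :: "'v \<Rightarrow> 'b :: real_normed_vector"
  assumes "cstar_algebra A" and "\<And>x y. x \<in> carr A \<Longrightarrow> y \<in> carr A \<Longrightarrow> F (cadd A x y) = F x + F y"
  shows "F (czero A) = 0"
proof -
  interpret cstar_algebra A by (rule assms(1))
  show ?thesis
    using assms(2)[of "czero A" "czero A"] by simp
qed

lemma additive_norm_diff_le:
  fixes F :: "'v \<Rightarrow> 'b :: real_normed_vector"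
  assumes "cstar_algebra A" and add: "\<And>x y. x \<in> carr A \<Longrightarrow> y \<in> carr A \<Longrightarrow> F (cadd A x y) = F x + F y"
    and bound: "\<And>x. x \<in> carr A \<Longrightarrow> norm (F x) \<le> C * cnrm A x"
    and x: "x \<in> carr A" and y: "y \<in> carr A"
  shows "norm (F x - F y) \<le> C * cdist A x y"
proof -
  interpret cstar_algebra A by (rule assms(1))
  let ?d = "cadd A x (cscale A (- 1) y)"
  have "cadd A ?d y = x"
    using x y by (simp add: add_assoc add_commute[of "cscale A (- 1) y" y] add_minus)
  then have "F x = F ?d + F y"
    using add[of ?d y] x y by simp
  then show ?thesis
    using bound[of ?d] x y by (simp add: cdist_def)
qed

lemma additive_bounded_diff:
  assumes "cstar_algebra A" "additive_bounded A F"
  obtains C where "C > 0" "\<And>x y. x \<in> carr A \<Longrightarrow> y \<in> carr A \<Longrightarrow> norm (F x - F y) \<le> C * cdist A x y"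
proof -
  interpret cstar_algebra A by (rule assms(1))
  obtain C where C: "\<And>x. x \<in> carr A \<Longrightarrow> norm (F x) \<le> C * cnrm A x"
    and add: "\<And>x y. x \<in> carr A \<Longrightarrow> y \<in> carr A \<Longrightarrow> F (cadd A x y) = F x + F y"
    using assms(2) unfolding additive_bounded_def by blast
  have "norm (F x - F y) \<le> (\<bar>C\<bar> + 1) * cdist A x y" if "x \<in> carr A" "y \<in> carr A" for x y
  proof -
    have "C * cdist A x y \<le> (\<bar>C\<bar> + 1) * cdist A x y"
      using cdist_nonneg[OF that] by (intro mult_right_mono) auto
    then show ?thesis
      using additive_norm_diff_le[OF assms(1) add C that] by simp
  qed
  then show ?thesis
    using that[of "\<bar>C\<bar> + 1"] by simp
qed

definition cstars :: "'u cstar list \<Rightarrow> bool" where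
  "cstars As \<longleftrightarrow> As \<noteq> [] \<and> (\<forall>A\<in>set As. cstar_algebra A)"

text \<open>Formal sums carry no scalars, so a scalar multiple is formed in the first factor of each
  summand.\<close>

definition scale_head :: "'u cstar list \<Rightarrow> complex \<Rightarrow> 'u list \<Rightarrow> 'u list" where
  "scale_head As c as = as[0 := cscale (As ! 0) c (as ! 0)]"

lemma elementary_Cons: "as \<in> elementary (A # As) \<longleftrightarrow> (\<exists>a as'. as = a # as' \<and> a \<in> carr A \<and> as' \<in> elementary As)"
  by (auto simp: elementary_def list_all2_Cons2)

lemma elementary_Nil [simp]: "elementary [] = {[]}"
  by (auto simp: elementary_def)

lemma elementary_append:
  "as \<in> elementary As \<Longrightarrow> bs \<in> elementary Bs \<Longrightarrow> as @ bs \<in> elementary (As @ Bs)"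
  by (simp add: elementary_def list_all2_appendI)

lemma scale_head_elementary:
  assumes "cstars As" "as \<in> elementary As"
  shows "scale_head As c as \<in> elementary As"
proof -
  obtain A As' where As: "As = A # As'"
    using assms(1) by (cases As) (auto simp: cstars_def)
  then have "cstar_algebra A"
    using assms(1) by (simp add: cstars_def)
  then show ?thesis
    using assms(2) by (auto simp: As elementary_Cons scale_head_def cstar_algebra.scale_closed)
qed

lemma tensor_ops_scale_head:
  assumes "cstars As" "list_all2 op_rep As rs" "as \<in> elementary As"
  shows "tensor_ops (rep_ops rs (scale_head As c as)) = cmult c o\<^sub>L tensor_ops (rep_ops rs as)"
proof -
  obtain A As' where As: "As = A # As'"
    using assms(1) by (cases As) (auto simp: cstars_def)
  obtain r rs' where rs: "rs = r # rs'" "op_rep A r" "list_all2 op_rep As' rs'"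
    using assms(2) by (auto simp: As list_all2_Cons1)
  obtain a as' where as: "as = a # as'" "a \<in> carr A" "as' \<in> elementary As'"
    using assms(3) by (auto simp: As elementary_Cons)
  show ?thesis
    using rs as clin_rep_ops[OF rs(3) as(3)]
    by (simp add: scale_head_def As op_repD op_tensor_cmult transport_cmult inj_cons_pair clin_tensor_ops)
qed

section \<open>Product representations of completed tensor products\<close>

locale min_tensors =
  fixes M :: "'u tensor_choice"
  assumes M: "min_tensor_products M"
begin

definition code_sum :: "'u cstar list \<Rightarrow> 'u list list \<Rightarrow> 'u" where
  "code_sum As X = csum (tprod M As) (map (telem M As) X)"

text \<open>The extension of \<open>alg_op rs\<close> to the completion. The inequality for all
  \<open>X\<close> expresses Lipschitz continuity with constant 1, and determines the operator
  because sums of elementary tensors are dense.\<close>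

definition tensor_rep ::
  "'u cstar list \<Rightarrow> ('u \<Rightarrow> 'u op) list \<Rightarrow> 'u \<Rightarrow> 'u list op" where
  "tensor_rep As rs z = (THE S. clin S \<and> (\<forall>X. set X \<subseteq> elementary As \<longrightarrow>
     norm (S - alg_op rs X) \<le> cdist (tprod M As) z (code_sum As X)))"

lemma is_min: "cstars As \<Longrightarrow> is_min_tensor As (tprod M As) (telem M As)"
  using M by (auto simp: cstars_def min_tensor_products_def)

lemma tprod_singleton: "cstar_algebra A \<Longrightarrow> tprod M [A] = A"
  and telem_singleton: "cstar_algebra A \<Longrightarrow> a \<in> carr A \<Longrightarrow> telem M [A] [a] = a"
  using M unfolding min_tensor_products_def by blast+

lemma cstar_tprod: "cstars As \<Longrightarrow> cstar_algebra (tprod M As)"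
  using is_min by (auto simp: is_min_tensor_def)

lemma telem_closed: "cstars As \<Longrightarrow> as \<in> elementary As \<Longrightarrow> telem M As as \<in> carr (tprod M As)"
  using is_min by (auto simp: is_min_tensor_def)

lemma telem_update:
  "cstars As \<Longrightarrow> as \<in> elementary As \<Longrightarrow> i < length As \<Longrightarrow>
    clinear_map (As ! i) (tprod M As) (\<lambda>x. telem M As (as[i := x]))"
  using is_min by (auto simp: is_min_tensor_def)

lemma telem_mul:
  "cstars As \<Longrightarrow> as \<in> elementary As \<Longrightarrow> bs \<in> elementary As \<Longrightarrow>
    telem M As (map (\<lambda>(A, a, b). cmul A a b) (zip As (zip as bs)))
      = cmul (tprod M As) (telem M As as) (telem M As bs)"
  using is_min by (auto simp: is_min_tensor_def)

lemma telem_adj: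
  "cstars As \<Longrightarrow> as \<in> elementary As \<Longrightarrow>
    telem M As (map (\<lambda>(A, a). cadj A a) (zip As as)) = cadj (tprod M As) (telem M As as)"
  using is_min by (auto simp: is_min_tensor_def)

lemma norm_code_sum:
  "cstars As \<Longrightarrow> set X \<subseteq> elementary As \<Longrightarrow> cnrm (tprod M As) (code_sum As X) = min_norm As X"
  using is_min by (auto simp: is_min_tensor_def code_sum_def)

lemma code_sum_dense:
  assumes "cstars As" "z \<in> carr (tprod M As)" "e > 0"
  obtains X where "set X \<subseteq> elementary As" "cdist (tprod M As) (code_sum As X) z < e"
  using is_min[OF assms(1)] assms(2,3) unfolding is_min_tensor_def code_sum_def by blast

lemma code_sum_closed: "cstars As \<Longrightarrow> set X \<subseteq> elementary As \<Longrightarrow> code_sum As X \<in> carr (tprod M As)"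
  unfolding code_sum_def
  by (intro cstar_algebra.csum_closed cstar_tprod) (auto intro: telem_closed)

lemma code_sum_Nil: "cstars As \<Longrightarrow> code_sum As [] = czero (tprod M As)"
  by (simp add: code_sum_def cstar_algebra.csum_Nil cstar_tprod)

lemma code_sum_Cons:
  "cstars As \<Longrightarrow> code_sum As (as # X) = cadd (tprod M As) (telem M As as) (code_sum As X)"
  by (simp add: code_sum_def cstar_algebra.csum_Cons cstar_tprod)

lemma code_sum_append:
  "cstars As \<Longrightarrow> set X \<subseteq> elementary As \<Longrightarrow> set Y \<subseteq> elementary As \<Longrightarrow>
    code_sum As (X @ Y) = cadd (tprod M As) (code_sum As X) (code_sum As Y)"
  unfolding code_sum_def map_append
  by (intro cstar_algebra.csum_append cstar_tprod) (auto intro: telem_closed)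

lemma telem_scale_head:
  assumes "cstars As" "as \<in> elementary As"
  shows "telem M As (scale_head As c as) = cscale (tprod M As) c (telem M As as)"
proof -
  have 0: "0 < length As" "as ! 0 \<in> carr (As ! 0)"
    using assms by (auto simp: cstars_def elementary_def list_all2_conv_all_nth)
  show ?thesis
    using telem_update[OF assms 0(1)] 0(2) unfolding clinear_map_def scale_head_def by simp
qed

lemma code_sum_scale:
  assumes "cstars As" "set X \<subseteq> elementary As"
  shows "code_sum As (map (scale_head As c) X) = cscale (tprod M As) c (code_sum As X)"
proof -
  have "map (telem M As) (map (scale_head As c) X) = map (cscale (tprod M As) c) (map (telem M As) X)"
    using assms by (auto simp: telem_scale_head subset_iff)
  then show ?thesis
    unfolding code_sum_def using assms
    by (auto simp: subset_iff telem_closed intro!: cstar_algebra.csum_scale cstar_tprod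
        simp del: map_map)
qed

lemma alg_op_scale:
  assumes "cstars As" "list_all2 op_rep As rs" "set X \<subseteq> elementary As"
  shows "alg_op rs (map (scale_head As c) X) = cmult c o\<^sub>L alg_op rs X"
  using assms(3)
proof (induction X)
  case Nil
  show ?case
    by (rule blinfun_eqI) (auto intro!: l2_eqI)
next
  case (Cons as X)
  have "cmult c o\<^sub>L (S + T) = (cmult c o\<^sub>L S) + (cmult c o\<^sub>L T)" for S T :: "'b list op"
    by (rule blinfun_eqI) (simp add: blinfun.add_left scaleC_add)
  then show ?case
    using Cons tensor_ops_scale_head[OF assms(1,2)] by simp
qed

text \<open>An element has many formal sums as representatives. Applied to a formal difference, the
  minimal norm shows that the operator depends on the element alone, and does so with Lipschitz
  constant 1.\<close>

lemma norm_alg_op_diff_le: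
  fixes rs :: "('u \<Rightarrow> 'u op) list"
  assumes As: "cstars As" and rs: "list_all2 op_rep As rs"
    and X: "set X \<subseteq> elementary As" and Y: "set Y \<subseteq> elementary As"
  shows "norm (alg_op rs X - alg_op rs Y) \<le> cdist (tprod M As) (code_sum As X) (code_sum As Y)"
proof -
  let ?Y = "map (scale_head As (- 1)) Y"
  have Y': "set ?Y \<subseteq> elementary As"
    using Y As by (auto intro: scale_head_elementary)
  have "cmult (- 1) o\<^sub>L alg_op rs Y = - alg_op rs Y"
    by (intro blinfun_eqI l2_eqI) (simp add: blinfun.minus_left)
  then have "alg_op rs X - alg_op rs Y = alg_op rs (X @ ?Y)"
    using alg_op_scale[OF As rs Y] by simp
  moreover have "norm (alg_op rs (X @ ?Y)) \<le> cnrm (tprod M As) (code_sum As (X @ ?Y))"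
    using norm_alg_op_le_min_norm[of As "X @ ?Y" rs] norm_code_sum[OF As, of "X @ ?Y"] As X Y' rs
    by (simp add: cstars_def)
  moreover have "code_sum As (X @ ?Y) = cadd (tprod M As) (code_sum As X) (cscale (tprod M As) (- 1) (code_sum As Y))"
    using As X Y Y' by (simp add: code_sum_append code_sum_scale)
  ultimately show ?thesis
    unfolding cdist_def by metis
qed

text \<open>The operators of an approximating sequence of formal sums are Cauchy by
  \<open>norm_alg_op_diff_le\<close>, and the space of operators is complete.\<close>

lemma tensor_rep_exists:
  assumes As: "cstars As" and rs: "list_all2 op_rep As rs" and z: "z \<in> carr (tprod M As)"
  shows "clin (tensor_rep As rs z) \<and> (\<forall>X. set X \<subseteq> elementary As \<longrightarrow>
    norm (tensor_rep As rs z - alg_op rs X) \<le> cdist (tprod M As) z (code_sum As X))"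
    (is "?P (tensor_rep As rs z)")
proof -
  interpret T: cstar_algebra "tprod M As" by (rule cstar_tprod[OF As])
  have "\<forall>n. \<exists>X. set X \<subseteq> elementary As \<and> cdist (tprod M As) (code_sum As X) z < inverse (real (Suc n))"
    using code_sum_dense[OF As z] by (metis inverse_positive_iff_positive of_nat_0_less_iff zero_less_Suc)
  then obtain X where X: "\<And>n. set (X n) \<subseteq> elementary As"
    and Xz: "\<And>n. cdist (tprod M As) (code_sum As (X n)) z < inverse (real (Suc n))"
    by metis
  have cX: "code_sum As (X n) \<in> carr (tprod M As)" for n
    by (rule code_sum_closed[OF As X])
  have near: "norm (alg_op rs (X n) - alg_op rs Y) \<le> inverse (real (Suc n)) + cdist (tprod M As) z (code_sum As Y)"
    if Y: "set Y \<subseteq> elementary As" for n Y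
    using norm_alg_op_diff_le[OF As rs X Y, of n] Xz[of n]
      T.cdist_triangle[OF cX[of n] z code_sum_closed[OF As Y]] by linarith
  have "Cauchy (\<lambda>n. alg_op rs (X n))"
  proof (rule metric_CauchyI)
    fix e :: real assume "e > 0"
    then obtain N where N: "inverse (real (Suc N)) < e / 2"
      using reals_Archimedean[of "e / 2"] by auto
    have "dist (alg_op rs (X m)) (alg_op rs (X n)) < e" if "m \<ge> N" "n \<ge> N" for m n
    proof -
      have "inverse (real (Suc k)) \<le> inverse (real (Suc N))" if "k \<ge> N" for k
        using that by (intro le_imp_inverse_le) auto
      then have "inverse (real (Suc m)) < e / 2" "inverse (real (Suc n)) < e / 2"
        using N that by (meson order_le_less_trans)+
      then show ?thesis
        using near[OF X, of m n] Xz[of n] T.cdist_commute[OF cX[of n] z] by (simp add: dist_norm)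
    qed
    then show "\<exists>N. \<forall>m\<ge>N. \<forall>n\<ge>N. dist (alg_op rs (X m)) (alg_op rs (X n)) < e"
      by blast
  qed
  then obtain S where S: "(\<lambda>n. alg_op rs (X n)) \<longlonglongrightarrow> S"
    using Cauchy_convergent_iff convergent_def by blast
  have PS: "?P S"
  proof (intro conjI allI impI)
    show "clin S"
      by (rule clin_limit[OF S]) (rule clin_alg_op[OF rs X])
    fix Y assume Y: "set Y \<subseteq> elementary As"
    show "norm (S - alg_op rs Y) \<le> cdist (tprod M As) z (code_sum As Y)"
    proof (rule LIMSEQ_le)
      show "(\<lambda>n. norm (alg_op rs (X n) - alg_op rs Y)) \<longlonglongrightarrow> norm (S - alg_op rs Y)"
        by (intro tendsto_intros S)
      show "(\<lambda>n. inverse (real (Suc n)) + cdist (tprod M As) z (code_sum As Y))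
          \<longlonglongrightarrow> cdist (tprod M As) z (code_sum As Y)"
        using tendsto_add[OF LIMSEQ_inverse_real_of_nat tendsto_const] by simp
    qed (use near[OF Y] in blast)
  qed
  \<comment> \<open>Uniqueness, as required by the definite description: both operators are close to
    that of one formal sum near \<open>z\<close>.\<close>
  moreover have "S' = S" if S': "?P S'" for S'
  proof -
    have "norm (S' - S) \<le> 0 + e" if "e > 0" for e
    proof -
      obtain Y where Y: "set Y \<subseteq> elementary As" "cdist (tprod M As) (code_sum As Y) z < e / 2"
        using code_sum_dense[OF As z] \<open>e > 0\<close> by (metis half_gt_zero)
      then have "norm (S' - alg_op rs Y) \<le> e / 2" "norm (S - alg_op rs Y) \<le> e / 2"
        using S' PS T.cdist_commute[OF code_sum_closed[OF As Y(1)] z] by fastforce+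
      then show ?thesis
        using norm_triangle_ineq4[of "S' - alg_op rs Y" "S - alg_op rs Y"] by simp
    qed
    then have "norm (S' - S) \<le> 0"
      by (rule field_le_epsilon)
    then show ?thesis
      by simp
  qed
  ultimately show ?thesis
    unfolding tensor_rep_def by (rule theI)
qed

lemma clin_tensor_rep:
  "cstars As \<Longrightarrow> list_all2 op_rep As rs \<Longrightarrow> z \<in> carr (tprod M As) \<Longrightarrow> clin (tensor_rep As rs z)"
  using tensor_rep_exists by blast

lemma norm_tensor_rep_diff_le:
  "cstars As \<Longrightarrow> list_all2 op_rep As rs \<Longrightarrow> z \<in> carr (tprod M As) \<Longrightarrow> set X \<subseteq> elementary As \<Longrightarrow>
    norm (tensor_rep As rs z - alg_op rs X) \<le> cdist (tprod M As) z (code_sum As X)"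
  using tensor_rep_exists by blast

lemma tensor_rep_code_sum:
  assumes "cstars As" "list_all2 op_rep As rs" "set X \<subseteq> elementary As"
  shows "tensor_rep As rs (code_sum As X) = alg_op rs X"
  using norm_tensor_rep_diff_le[OF assms(1,2) code_sum_closed[OF assms(1,3)] assms(3)]
    cstar_algebra.cdist_self[OF cstar_tprod[OF assms(1)] code_sum_closed[OF assms(1,3)]] by simp

lemma tensor_rep_telem:
  assumes "cstars As" "list_all2 op_rep As rs" "as \<in> elementary As"
  shows "tensor_rep As rs (telem M As as) = tensor_ops (rep_ops rs as)"
proof -
  interpret T: cstar_algebra "tprod M As" by (rule cstar_tprod[OF assms(1)])
  have "code_sum As [as] = telem M As as"
    using telem_closed assms by (simp add: code_sum_def)
  then show ?thesis
    using tensor_rep_code_sum[OF assms(1,2), of "[as]"] assms(3) by simp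
qed

lemma norm_tensor_rep_le:
  assumes "cstars As" "list_all2 op_rep As rs" "z \<in> carr (tprod M As)"
  shows "norm (tensor_rep As rs z) \<le> cnrm (tprod M As) z"
  using norm_tensor_rep_diff_le[OF assms, of "[]"] assms
  by (simp add: code_sum_Nil cstar_algebra.cdist_zero cstar_tprod)

text \<open>For formal sums the norm is a supremum over product representations by definition;
  approximation carries the estimate to the completion.\<close>

lemma tensor_rep_faithful:
  assumes As: "cstars As" and z: "z \<in> carr (tprod M As)"
    and bound: "\<And>rs. list_all2 op_rep As rs \<Longrightarrow> norm (tensor_rep As rs z) \<le> K"
  shows "cnrm (tprod M As) z \<le> K"
proof (rule field_le_epsilon)
  interpret T: cstar_algebra "tprod M As" by (rule cstar_tprod[OF As])
  fix e :: real assume "e > 0"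
  then obtain X where X: "set X \<subseteq> elementary As" "cdist (tprod M As) (code_sum As X) z < e / 2"
    using code_sum_dense[OF As z] by (metis half_gt_zero)
  have cX: "code_sum As X \<in> carr (tprod M As)"
    by (rule code_sum_closed[OF As X(1)])
  have "min_norm As X \<le> K + e / 2"
  proof (rule min_norm_leI)
    fix rs :: "('u \<Rightarrow> 'u op) list" assume rs: "list_all2 op_rep As rs"
    have "norm (alg_op rs X) \<le> norm (tensor_rep As rs z) + norm (tensor_rep As rs z - alg_op rs X)"
      by (metis norm_minus_commute norm_triangle_sub)
    then show "norm (alg_op rs X) \<le> K + e / 2"
      using bound[OF rs] norm_tensor_rep_diff_le[OF As rs z X(1)] X(2) T.cdist_commute[OF cX z] by linarith
  qed (use As X in \<open>auto simp: cstars_def\<close>)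
  then show "cnrm (tprod M As) z \<le> K + e"
    using T.norm_le_cdist[OF z cX] norm_code_sum[OF As X(1)] X(2) T.cdist_commute[OF cX z] by linarith
qed

lemma tensor_rep_add:
  assumes As: "cstars As" and rs: "list_all2 op_rep As rs"
    and z: "z \<in> carr (tprod M As)" and w: "w \<in> carr (tprod M As)"
  shows "tensor_rep As rs (cadd (tprod M As) z w) = tensor_rep As rs z + tensor_rep As rs w"
proof -
  interpret T: cstar_algebra "tprod M As" by (rule cstar_tprod[OF As])
  let ?R = "tensor_rep As rs" and ?d = "cdist (tprod M As)"
  have "norm (?R (cadd (tprod M As) z w) - (?R z + ?R w)) \<le> 0 + e" if "e > 0" for e
  proof -
    obtain X Y where X: "set X \<subseteq> elementary As" "?d (code_sum As X) z < e / 4"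
      and Y: "set Y \<subseteq> elementary As" "?d (code_sum As Y) w < e / 4"
      using code_sum_dense[OF As z, of "e / 4"] code_sum_dense[OF As w, of "e / 4"] \<open>e > 0\<close>
      by (metis divide_pos_pos zero_less_numeral)
    have c: "code_sum As X \<in> carr (tprod M As)" "code_sum As Y \<in> carr (tprod M As)"
      using code_sum_closed As X Y by auto
    have d: "?d z (code_sum As X) < e / 4" "?d w (code_sum As Y) < e / 4"
      using X Y c z w by (simp_all add: T.cdist_commute)
    have 1: "norm (?R z - alg_op rs X) \<le> e / 4" "norm (?R w - alg_op rs Y) \<le> e / 4"
      using norm_tensor_rep_diff_le[OF As rs z X(1)] norm_tensor_rep_diff_le[OF As rs w Y(1)] d by auto
    have "norm (?R (cadd (tprod M As) z w) - alg_op rs (X @ Y)) \<le> ?d (cadd (tprod M As) z w) (code_sum As (X @ Y))"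
      using z w X Y by (intro norm_tensor_rep_diff_le As rs) auto
    also have "\<dots> \<le> e / 2"
      using T.cdist_add[OF z w c] d X Y As by (simp add: code_sum_append)
    finally have 2: "norm (?R (cadd (tprod M As) z w) - (alg_op rs X + alg_op rs Y)) \<le> e / 2"
      by simp
    have 3: "?R (cadd (tprod M As) z w) - (?R z + ?R w) = (?R (cadd (tprod M As) z w) - (alg_op rs X + alg_op rs Y))
        - ((?R z - alg_op rs X) + (?R w - alg_op rs Y))"
      by simp
    have "norm (?R (cadd (tprod M As) z w) - (?R z + ?R w)) \<le> e / 2 + (e / 4 + e / 4)"
      unfolding 3 by (rule order_trans[OF norm_triangle_ineq4 add_mono[OF 2 order_trans[OF norm_triangle_ineq add_mono[OF 1]]]])
    then show ?thesis
      by simp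
  qed
  then have "norm (?R (cadd (tprod M As) z w) - (?R z + ?R w)) \<le> 0"
    by (rule field_le_epsilon)
  then show ?thesis
    by simp
qed

lemma additive_bounded_tensor_rep:
  assumes "cstars As" "list_all2 op_rep As rs"
  shows "additive_bounded (tprod M As) (tensor_rep As rs)"
  using assms norm_tensor_rep_le by (intro additive_boundedI[where C = 1]) (auto simp: tensor_rep_add)

text \<open>Equality passes to formal sums by additivity and to the completion by
  continuity.\<close>

lemma additive_bounded_eq:
  fixes F G :: "'u \<Rightarrow> 'b :: real_normed_vector"
  assumes As: "cstars As" and F: "additive_bounded (tprod M As) F" and G: "additive_bounded (tprod M As) G"
    and eq: "\<And>as. as \<in> elementary As \<Longrightarrow> F (telem M As as) = G (telem M As as)"
    and z: "z \<in> carr (tprod M As)"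
  shows "F z = G z"
proof -
  interpret T: cstar_algebra "tprod M As" by (rule cstar_tprod[OF As])
  have add: "F (cadd (tprod M As) x y) = F x + F y" "G (cadd (tprod M As) x y) = G x + G y"
    if "x \<in> carr (tprod M As)" "y \<in> carr (tprod M As)" for x y
    using F G that by (auto simp: additive_bounded_def)
  have zero: "F (czero (tprod M As)) = 0" "G (czero (tprod M As)) = 0"
    using additive_zero[OF cstar_tprod[OF As] add(1)] additive_zero[OF cstar_tprod[OF As] add(2)] by auto
  have codes: "F (code_sum As X) = G (code_sum As X)" if "set X \<subseteq> elementary As" for X
    using that
    by (induction X) (auto simp: code_sum_Nil code_sum_Cons As zero add telem_closed code_sum_closed eq)
  obtain C where C: "C > 0" "\<And>x y. x \<in> carr (tprod M As) \<Longrightarrow> y \<in> carr (tprod M As) \<Longrightarrow>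
      norm (F x - F y) \<le> C * cdist (tprod M As) x y"
    by (rule additive_bounded_diff[OF cstar_tprod[OF As] F]) blast
  obtain D where D: "D > 0" "\<And>x y. x \<in> carr (tprod M As) \<Longrightarrow> y \<in> carr (tprod M As) \<Longrightarrow>
      norm (G x - G y) \<le> D * cdist (tprod M As) x y"
    by (rule additive_bounded_diff[OF cstar_tprod[OF As] G]) blast
  have "norm (F z - G z) \<le> 0 + e" if "e > 0" for e
  proof -
    have "e / (C + D) > 0"
      using C D that by simp
    then obtain X where X: "set X \<subseteq> elementary As" "cdist (tprod M As) (code_sum As X) z < e / (C + D)"
      by (rule code_sum_dense[OF As z])
    let ?c = "code_sum As X" and ?d = "cdist (tprod M As) (code_sum As X) z"
    have c: "?c \<in> carr (tprod M As)"
      by (rule code_sum_closed[OF As X(1)])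
    have "norm (F z - G z) \<le> norm (F ?c - F z) + norm (G ?c - G z)"
      using norm_triangle_ineq4[of "G ?c - G z" "F ?c - F z"] codes[OF X(1)] by (simp add: algebra_simps)
    also have "\<dots> \<le> C * ?d + D * ?d"
      using C(2)[OF c z] D(2)[OF c z] by simp
    also have "\<dots> \<le> e"
      using X(2) C(1) D(1) by (simp add: field_simps)
    finally show ?thesis
      by simp
  qed
  then have "norm (F z - G z) \<le> 0"
    by (rule field_le_epsilon)
  then show ?thesis
    by simp
qed

lemma tensor_rep_scale:
  assumes As: "cstars As" and rs: "list_all2 op_rep As rs" and z: "z \<in> carr (tprod M As)"
  shows "tensor_rep As rs (cscale (tprod M As) c z) = cmult c o\<^sub>L tensor_rep As rs z"
proof (rule additive_bounded_eq[OF As _ _ _ z])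
  interpret T: cstar_algebra "tprod M As" by (rule cstar_tprod[OF As])
  show "additive_bounded (tprod M As) (\<lambda>z. tensor_rep As rs (cscale (tprod M As) c z))"
    using norm_tensor_rep_le[OF As rs T.scale_closed]
    by (intro additive_boundedI[where C = "cmod c"])
      (auto simp: tensor_rep_add As rs T.scale_add T.norm_scale)
  show "additive_bounded (tprod M As) (\<lambda>z. cmult c o\<^sub>L tensor_rep As rs z)"
  proof (rule additive_boundedI[where C = "cmod c"])
    show "norm (cmult c o\<^sub>L tensor_rep As rs z) \<le> cmod c * cnrm (tprod M As) z"
      if "z \<in> carr (tprod M As)" for z
      using norm_tensor_rep_le[OF As rs that] norm_cmult_le
      by (intro order_trans[OF norm_blinfun_compose] mult_mono) auto
    show "cmult c o\<^sub>L tensor_rep As rs (cadd (tprod M As) x y)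
        = (cmult c o\<^sub>L tensor_rep As rs x) + (cmult c o\<^sub>L tensor_rep As rs y)"
      if "x \<in> carr (tprod M As)" "y \<in> carr (tprod M As)" for x y
      using that by (intro blinfun_eqI) (simp add: tensor_rep_add As rs blinfun.add_left scaleC_add)
  qed
  fix as assume as: "as \<in> elementary As"
  show "tensor_rep As rs (cscale (tprod M As) c (telem M As as)) = cmult c o\<^sub>L tensor_rep As rs (telem M As as)"
    using telem_scale_head[OF As as, symmetric] As rs as
    by (simp add: tensor_rep_telem scale_head_elementary tensor_ops_scale_head)
qed

lemma tensor_rep_mul:
  assumes As: "cstars As" and rs: "list_all2 op_rep As rs"
    and z: "z \<in> carr (tprod M As)" and w: "w \<in> carr (tprod M As)"
  shows "tensor_rep As rs (cmul (tprod M As) z w) = tensor_rep As rs z o\<^sub>L tensor_rep As rs w"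
proof -
  interpret T: cstar_algebra "tprod M As" by (rule cstar_tprod[OF As])
  let ?R = "tensor_rep As rs"
  have L: "additive_bounded (tprod M As) (\<lambda>z. ?R (cmul (tprod M As) z w))"
    "additive_bounded (tprod M As) (\<lambda>z. ?R (cmul (tprod M As) w z))"
    if w: "w \<in> carr (tprod M As)" for w
  proof -
    have "norm (?R (cmul (tprod M As) z w)) \<le> cnrm (tprod M As) w * cnrm (tprod M As) z"
      "norm (?R (cmul (tprod M As) w z)) \<le> cnrm (tprod M As) w * cnrm (tprod M As) z"
      if z: "z \<in> carr (tprod M As)" for z
      using T.norm_mul[OF w z] T.norm_mul[OF z w] norm_tensor_rep_le[OF As rs T.mul_closed[OF w z]]
        norm_tensor_rep_le[OF As rs T.mul_closed[OF z w]] by (simp_all add: mult.commute)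
    then show "additive_bounded (tprod M As) (\<lambda>z. ?R (cmul (tprod M As) z w))"
      "additive_bounded (tprod M As) (\<lambda>z. ?R (cmul (tprod M As) w z))"
      using w
      by (auto intro!: additive_boundedI[where C = "cnrm (tprod M As) w"]
          simp: tensor_rep_add As rs T.add_mul T.mul_add)
  qed
  have R: "additive_bounded (tprod M As) (\<lambda>z. ?R z o\<^sub>L S)" "additive_bounded (tprod M As) (\<lambda>z. S o\<^sub>L ?R z)"
    for S :: "'u list op"
  proof -
    have "norm (?R z o\<^sub>L S) \<le> norm S * cnrm (tprod M As) z \<and> norm (S o\<^sub>L ?R z) \<le> norm S * cnrm (tprod M As) z"
      if "z \<in> carr (tprod M As)" for z
      using norm_tensor_rep_le[OF As rs that] norm_blinfun_compose[of "?R z" S] norm_blinfun_compose[of S "?R z"]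
      by (smt (verit) mult.commute mult_left_mono norm_ge_zero)
    then show "additive_bounded (tprod M As) (\<lambda>z. ?R z o\<^sub>L S)" "additive_bounded (tprod M As) (\<lambda>z. S o\<^sub>L ?R z)"
      by (auto intro!: additive_boundedI[where C = "norm S"] blinfun_eqI
          simp: tensor_rep_add As rs blinfun.add_left blinfun.add_right)
  qed
  have elem: "?R (cmul (tprod M As) (telem M As as) (telem M As bs)) = ?R (telem M As as) o\<^sub>L ?R (telem M As bs)"
    if as: "as \<in> elementary As" and bs: "bs \<in> elementary As" for as bs
  proof -
    let ?cs = "map (\<lambda>(A, a, b). cmul A a b) (zip As (zip as bs))"
    have len: "length as = length As" "length bs = length As" "length rs = length As"
      using as bs rs by (auto simp: elementary_def list_all2_lengthD)
    have nth: "as ! i \<in> carr (As ! i)" "bs ! i \<in> carr (As ! i)" "op_rep (As ! i) (rs ! i)" "cstar_algebra (As ! i)"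
      if "i < length As" for i
      using as bs rs As that by (auto simp: elementary_def list_all2_conv_all_nth cstars_def)
    have cs: "?cs \<in> elementary As"
      using len cstar_algebra.mul_closed[OF nth(4) nth(1,2)]
      by (auto simp: elementary_def list_all2_conv_all_nth)
    have "rep_ops rs ?cs = map2 (o\<^sub>L) (rep_ops rs as) (rep_ops rs bs)"
      using len by (intro nth_equalityI) (auto simp: op_repD(4)[OF nth(3) nth(1,2)])
    moreover have "list_all2 (\<lambda>T S. clin T \<and> clin S) (rep_ops rs as) (rep_ops rs bs)"
      using len op_repD(1)[OF nth(3) nth(1)] op_repD(1)[OF nth(3) nth(2)] by (simp add: list_all2_conv_all_nth)
    ultimately have "tensor_ops (rep_ops rs ?cs)
        = tensor_ops (rep_ops rs as) o\<^sub>L tensor_ops (rep_ops rs bs)"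
      using tensor_ops_compose by simp
    then show ?thesis
      using as bs cs by (simp add: telem_mul[OF As as bs, symmetric] tensor_rep_telem As rs)
  qed
  \<comment> \<open>Density is applied to one argument at a time, first with the second argument
    elementary.\<close>
  have "?R (cmul (tprod M As) z (telem M As bs)) = ?R z o\<^sub>L ?R (telem M As bs)" if bs: "bs \<in> elementary As" for bs
    by (rule additive_bounded_eq[OF As L(1)[OF telem_closed[OF As bs]] R(1) elem[OF _ bs] z])
  then show ?thesis
    by (rule additive_bounded_eq[OF As L(2)[OF z] R(2) _ w])
qed

text \<open>Each entry on either side is a bounded additive function of \<open>z\<close> with
  complex values, so elementary tensors suffice.\<close>

lemma tensor_rep_adj:
  assumes As: "cstars As" and rs: "list_all2 op_rep As rs" and z: "z \<in> carr (tprod M As)"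
  shows "adjoint_entries (tensor_rep As rs z) (tensor_rep As rs (cadj (tprod M As) z))"
  unfolding adjoint_entries_def
proof (intro allI)
  interpret T: cstar_algebra "tprod M As" by (rule cstar_tprod[OF As])
  let ?R = "tensor_rep As rs"
  fix zs ws
  have norm_adj: "cnrm (tprod M As) (cadj (tprod M As) x) = cnrm (tprod M As) x" if "x \<in> carr (tprod M As)" for x
    using that T.norm_adj_le[of x] T.norm_adj_le[of "cadj (tprod M As) x"] by (simp add: T.adj_adj)
  show "entry (?R (cadj (tprod M As) z)) ws zs = cnj (entry (?R z) zs ws)"
  proof (rule additive_bounded_eq[OF As _ _ _ z])
    have "cmod (entry (?R (cadj (tprod M As) x)) ws zs) \<le> cnrm (tprod M As) x"
      if "x \<in> carr (tprod M As)" for x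
      using order_trans[OF norm_entry_le norm_tensor_rep_le[OF As rs T.adj_closed[OF that]]]
      by (simp add: norm_adj[OF that])
    then show "additive_bounded (tprod M As) (\<lambda>z. entry (?R (cadj (tprod M As) z)) ws zs)"
      by (auto intro!: additive_boundedI[where C = 1] simp: tensor_rep_add As rs T.adj_add entry_add)
    show "additive_bounded (tprod M As) (\<lambda>z. cnj (entry (?R z) zs ws))"
      using order_trans[OF norm_entry_le norm_tensor_rep_le[OF As rs]]
      by (auto intro!: additive_boundedI[where C = 1] simp: tensor_rep_add As rs entry_add)
    fix as assume as: "as \<in> elementary As"
    let ?cs = "map (\<lambda>(A, a). cadj A a) (zip As as)"
    have len: "length as = length As" "length rs = length As"
      using as rs by (auto simp: elementary_def list_all2_lengthD)
    have nth: "as ! i \<in> carr (As ! i)" "op_rep (As ! i) (rs ! i)" "cstar_algebra (As ! i)"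
      "cadj (As ! i) (as ! i) \<in> carr (As ! i)"
      if "i < length As" for i
      using as rs As that cstar_algebra.adj_closed[of "As ! i" "as ! i"]
      by (auto simp: elementary_def list_all2_conv_all_nth cstars_def)
    have cs: "?cs \<in> elementary As"
      using len nth by (auto simp: elementary_def list_all2_conv_all_nth)
    have "list_all2 (\<lambda>T S. clin T \<and> clin S \<and> adjoint_entries T S) (rep_ops rs as) (rep_ops rs ?cs)"
      using len op_repD(1)[OF nth(2) nth(1)] op_repD(1)[OF nth(2) nth(4)] op_repD(5)[OF nth(2) nth(1)]
      by (simp add: list_all2_conv_all_nth)
    from adjoint_entries_tensor_ops[OF this]
    show "entry (?R (cadj (tprod M As) (telem M As as))) ws zs = cnj (entry (?R (telem M As as)) zs ws)"
      using as cs by (simp add: telem_adj[OF As as, symmetric] tensor_rep_telem As rs adjoint_entries_def)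
  qed
qed

lemma op_rep_tensor_rep:
  assumes "cstars As" "list_all2 op_rep As rs"
  shows "op_rep (tprod M As) (tensor_rep As rs)"
  unfolding op_rep_def[of "tprod M As"] using assms
  by (simp add: clin_tensor_rep tensor_rep_add tensor_rep_scale tensor_rep_mul tensor_rep_adj)

text \<open>
  The Gelfand-Naimark theorem is implicit in the hypothesis on \<open>M\<close>: the norm of the
  one-factor product \<open>tprod M [A] = A\<close> is a supremum over representations.
\<close>

lemma op_rep_faithful:
  assumes A: "cstar_algebra A" and a: "a \<in> carr A"
    and bound: "\<And>r :: 'u \<Rightarrow> 'u op. op_rep A r \<Longrightarrow> norm (r a) \<le> K"
  shows "cnrm A a \<le> K"
proof -
  have As: "cstars [A]"
    using A by (simp add: cstars_def)
  have "cnrm (tprod M [A]) a \<le> K"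
  proof (rule tensor_rep_faithful[OF As])
    fix rs :: "('u \<Rightarrow> 'u op) list" assume rs: "list_all2 op_rep [A] rs"
    then obtain r where r: "rs = [r]" "op_rep A r"
      by (auto simp: list_all2_Cons1)
    have "tensor_rep [A] rs a = tensor_ops [r a]"
      using tensor_rep_telem[OF As rs, of "[a]"] a A r by (simp add: telem_singleton elementary_def)
    moreover have "norm (tensor_ops [r a]) \<le> norm (r a)"
      using norm_tensor_ops_le[of "[r a]"] op_repD(1)[OF r(2) a] by simp
    ultimately show "norm (tensor_rep [A] rs a) \<le> K"
      using bound[OF r(2)] by simp
  qed (use A a in \<open>simp add: tprod_singleton\<close>)
  then show ?thesis
    using A by (simp add: tprod_singleton)
qed

text \<open>Composition with \<open>f\<close> turns representations of \<open>B\<close> into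
  representations of \<open>A\<close>, where they are contractive; and the norm of \<open>B\<close>
  is bounded by any common bound of its representations.\<close>

lemma star_hom_contractive:
  fixes A B :: "'u cstar"
  assumes A: "cstar_algebra A" and B: "cstar_algebra B" and f: "star_hom A B f" and a: "a \<in> carr A"
  shows "cnrm B (f a) \<le> cnrm A a"
  using op_rep_faithful[OF B star_homD(1)[OF f a]] norm_op_rep_le[OF A op_rep_star_hom[OF _ f] a] by blast

lemma faithful_eq:
  fixes x y :: 'u
  assumes A: "cstar_algebra A" and x: "x \<in> carr A" and y: "y \<in> carr A"
    and eq: "\<And>r :: 'u \<Rightarrow> 'u op. op_rep A r \<Longrightarrow> r x = r y"
  shows "x = y"
  by (rule jointly_faithful_eq[OF A, where I = "{r :: 'u \<Rightarrow> 'u op. op_rep A r}" and Q = "\<lambda>r. r"])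
    (use x y eq op_rep_faithful[OF A, of _ 0] in auto)

lemma tensor_rep_eqI:
  assumes As: "cstars As" and x: "x \<in> carr (tprod M As)" and y: "y \<in> carr (tprod M As)"
    and eq: "\<And>rs. list_all2 op_rep As rs \<Longrightarrow> tensor_rep As rs x = tensor_rep As rs y"
  shows "x = y"
  by (rule jointly_faithful_eq[OF cstar_tprod[OF As], where I = "{rs. list_all2 op_rep As rs}" and Q = "tensor_rep As"])
    (use x y eq op_rep_tensor_rep[OF As] tensor_rep_faithful[OF As, of _ 0] in auto)

end

context min_tensors
begin

text \<open>
  The existence principle behind tensor products of elements, tensor products of maps, and slice maps.
\<close>

lemma lift_from_elementary:
  fixes B :: "'v cstar" and Q :: "'i \<Rightarrow> 'v \<Rightarrow> 'b :: real_normed_vector" and \<Theta> :: "'i \<Rightarrow> 'u \<Rightarrow> 'b"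
  assumes As: "cstars As" and B: "cstar_algebra B"
    and Q_add: "\<And>i x y. i \<in> I \<Longrightarrow> x \<in> carr B \<Longrightarrow> y \<in> carr B \<Longrightarrow> Q i (cadd B x y) = Q i x + Q i y"
    and Q_le: "\<And>i x. i \<in> I \<Longrightarrow> x \<in> carr B \<Longrightarrow> norm (Q i x) \<le> cnrm B x"
    and Q_faithful: "\<And>x K. x \<in> carr B \<Longrightarrow> (\<And>i. i \<in> I \<Longrightarrow> norm (Q i x) \<le> K) \<Longrightarrow> cnrm B x \<le> K"
    and \<Theta>_add: "\<And>i x y. i \<in> I \<Longrightarrow> x \<in> carr (tprod M As) \<Longrightarrow> y \<in> carr (tprod M As) \<Longrightarrow>
      \<Theta> i (cadd (tprod M As) x y) = \<Theta> i x + \<Theta> i y"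
    and \<Theta>_le: "\<And>i x. i \<in> I \<Longrightarrow> x \<in> carr (tprod M As) \<Longrightarrow> norm (\<Theta> i x) \<le> C * cnrm (tprod M As) x"
    and elem: "\<And>as. as \<in> elementary As \<Longrightarrow> \<exists>w\<in>carr B. \<forall>i\<in>I. Q i w = \<Theta> i (telem M As as)"
    and z: "z \<in> carr (tprod M As)"
  shows "\<exists>w\<in>carr B. \<forall>i\<in>I. Q i w = \<Theta> i z"
proof -
  let ?T = "tprod M As"
  interpret T: cstar_algebra ?T by (rule cstar_tprod[OF As])
  interpret B: cstar_algebra B by (rule B)
  have Q_diff: "norm (Q i x - Q i y) \<le> 1 * cdist B x y" if "i \<in> I" "x \<in> carr B" "y \<in> carr B" for i x y
    by (rule additive_norm_diff_le[OF B Q_add[OF that(1)] _ that(2,3)]) (use Q_le that in auto)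
  have \<Theta>_diff: "norm (\<Theta> i x - \<Theta> i y) \<le> C * cdist ?T x y"
    if "i \<in> I" "x \<in> carr ?T" "y \<in> carr ?T" for i x y
    by (rule additive_norm_diff_le[OF cstar_tprod[OF As] \<Theta>_add[OF that(1)] \<Theta>_le[OF that(1)] that(2,3)])
  have codes: "\<exists>w\<in>carr B. \<forall>i\<in>I. Q i w = \<Theta> i (code_sum As X)" if "set X \<subseteq> elementary As" for X
    using that
  proof (induction X)
    case Nil
    have "Q i (czero B) = 0" if "i \<in> I" for i
      by (rule additive_zero[OF B Q_add[OF that]])
    moreover have "\<Theta> i (czero ?T) = 0" if "i \<in> I" for i
      by (rule additive_zero[OF cstar_tprod[OF As] \<Theta>_add[OF that]])
    ultimately show ?case
      using As by (auto simp: code_sum_Nil intro!: bexI[where x = "czero B"])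
  next
    case (Cons as X)
    then obtain w v where w: "w \<in> carr B" "\<forall>i\<in>I. Q i w = \<Theta> i (code_sum As X)"
      and v: "v \<in> carr B" "\<forall>i\<in>I. Q i v = \<Theta> i (telem M As as)"
      using elem[of as] by auto
    have "\<forall>i\<in>I. Q i (cadd B v w) = \<Theta> i (code_sum As (as # X))"
      using Cons w v As by (simp add: code_sum_Cons Q_add \<Theta>_add telem_closed code_sum_closed)
    then show ?case
      using w v by blast
  qed
  have "\<forall>n. \<exists>X. set X \<subseteq> elementary As \<and> cdist ?T (code_sum As X) z < inverse (real (Suc n))"
    using code_sum_dense[OF As z] by (metis inverse_positive_iff_positive of_nat_0_less_iff zero_less_Suc)
  then obtain X where X: "\<And>n. set (X n) \<subseteq> elementary As"
    and Xz: "\<And>n. cdist ?T (code_sum As (X n)) z < inverse (real (Suc n))"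
    by metis
  define c where "c = (\<lambda>n. code_sum As (X n))"
  have c: "c n \<in> carr ?T" and cz: "cdist ?T (c n) z < inverse (real (Suc n))" for n
    using code_sum_closed[OF As X] Xz by (auto simp: c_def)
  obtain w where w: "\<And>n. w n \<in> carr B" "\<And>n i. i \<in> I \<Longrightarrow> Q i (w n) = \<Theta> i (c n)"
    using codes[OF X] unfolding c_def by metis
  \<comment> \<open>In the family \<open>Q\<close>, the difference of two approximants becomes a
    difference of values of \<open>\<Theta>\<close>. Joint faithfulness turns this uniform bound
    into one for the norm of \<open>B\<close>, so the approximants are Cauchy there.\<close>
  have w_dist: "cdist B (w m) (w n) \<le> \<bar>C\<bar> * cdist ?T (c m) (c n)" for m n
  proof -
    let ?d = "cadd B (w m) (cscale B (- 1) (w n))"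
    have "norm (Q i ?d) \<le> \<bar>C\<bar> * cdist ?T (c m) (c n)" if i: "i \<in> I" for i
    proof -
      have "cadd B ?d (w n) = w m"
        using w by (simp add: B.add_assoc B.add_commute[of "cscale B (- 1) (w n)" "w n"] B.add_minus)
      then have "Q i ?d = \<Theta> i (c m) - \<Theta> i (c n)"
        using Q_add[OF i, of ?d "w n"] w i by simp
      then have "norm (Q i ?d) \<le> C * cdist ?T (c m) (c n)"
        using \<Theta>_diff[OF i c c] by simp
      also have "\<dots> \<le> \<bar>C\<bar> * cdist ?T (c m) (c n)"
        using T.cdist_nonneg[OF c c] by (intro mult_right_mono) auto
      finally show ?thesis .
    qed
    then show ?thesis
      unfolding cdist_def[of B] using w by (intro Q_faithful) auto
  qed
  have "\<exists>N. \<forall>m\<ge>N. \<forall>n\<ge>N. cdist B (w m) (w n) < e" if e: "e > 0" for e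
  proof -
    \<comment> \<open>The factor 2 pays for the triangle inequality through \<open>z\<close>, and
      the summand 1 allows \<open>C = 0\<close>.\<close>
    obtain N where N: "inverse (real (Suc N)) < e / (2 * (\<bar>C\<bar> + 1))"
      using reals_Archimedean[of "e / (2 * (\<bar>C\<bar> + 1))"] e by auto
    have "cdist B (w m) (w n) < e" if mn: "m \<ge> N" "n \<ge> N" for m n
    proof -
      have near: "cdist ?T (c k) z < e / (2 * (\<bar>C\<bar> + 1))" if "k \<ge> N" for k
      proof -
        have "inverse (real (Suc k)) \<le> inverse (real (Suc N))"
          using that by (intro le_imp_inverse_le) auto
        then show ?thesis
          using cz[of k] N by linarith
      qed
      have "cdist ?T (c m) (c n) \<le> cdist ?T (c m) z + cdist ?T (c n) z"
        using T.cdist_triangle[OF c[of m] z c[of n]] T.cdist_commute[OF c[of n] z] by simp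
      also have "\<dots> < 2 * (e / (2 * (\<bar>C\<bar> + 1)))"
        using near[OF mn(1)] near[OF mn(2)] by linarith
      also have "2 * (e / (2 * (\<bar>C\<bar> + 1))) = e / (\<bar>C\<bar> + 1)"
        unfolding times_divide_eq_right by (rule mult_divide_mult_cancel_left) simp
      finally have "cdist ?T (c m) (c n) < e / (\<bar>C\<bar> + 1)" .
      then have "(\<bar>C\<bar> + 1) * cdist ?T (c m) (c n) < e"
        by (simp add: pos_less_divide_eq mult.commute)
      moreover have "\<bar>C\<bar> * cdist ?T (c m) (c n) \<le> (\<bar>C\<bar> + 1) * cdist ?T (c m) (c n)"
        using T.cdist_nonneg[OF c c] by (intro mult_right_mono) auto
      ultimately show ?thesis
        using w_dist[of m n] by linarith
    qed
    then show ?thesis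
      by blast
  qed
  then obtain v where v: "v \<in> carr B" "(\<lambda>n. cdist B (w n) v) \<longlonglongrightarrow> 0"
    using B.complete[of w] w(1) by blast
  have "Q i v = \<Theta> i z" if i: "i \<in> I" for i
  proof -
    have "norm (Q i v - \<Theta> i z) \<le> cdist B (w n) v + \<bar>C\<bar> * inverse (real (Suc n))" for n
    proof -
      have "norm (\<Theta> i (c n) - \<Theta> i z) \<le> \<bar>C\<bar> * inverse (real (Suc n))"
      proof -
        have "C * cdist ?T (c n) z \<le> \<bar>C\<bar> * cdist ?T (c n) z"
          using T.cdist_nonneg[OF c z] by (intro mult_right_mono) auto
        moreover have "\<bar>C\<bar> * cdist ?T (c n) z \<le> \<bar>C\<bar> * inverse (real (Suc n))"
          using cz[of n] by (intro mult_left_mono) auto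
        ultimately show ?thesis
          using \<Theta>_diff[OF i c z, of n] by linarith
      qed
      moreover have "norm (Q i v - Q i (w n)) \<le> cdist B (w n) v"
        using Q_diff[OF i v(1) w(1)[of n]] B.cdist_commute[OF v(1) w(1)[of n]] by simp
      moreover have "Q i v - \<Theta> i z = (Q i v - Q i (w n)) + (\<Theta> i (c n) - \<Theta> i z)"
        using w(2)[OF i, of n] by simp
      ultimately show ?thesis
        by (metis add_mono norm_triangle_ineq order_trans)
    qed
    moreover have "(\<lambda>n. cdist B (w n) v + \<bar>C\<bar> * inverse (real (Suc n))) \<longlonglongrightarrow> 0"
      using tendsto_add[OF v(2) tendsto_mult_right_zero[OF LIMSEQ_inverse_real_of_nat, of "\<bar>C\<bar>"]] by simp
    ultimately have "norm (Q i v - \<Theta> i z) \<le> 0"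
      by (intro LIMSEQ_le_const) blast+
    then show ?thesis
      by simp
  qed
  then show ?thesis
    using v(1) by blast
qed

section \<open>Tensor products of elements\<close>

lemma cstars_append: "cstars As \<Longrightarrow> cstars Bs \<Longrightarrow> cstars (As @ Bs)"
  by (auto simp: cstars_def)

text \<open>\<open>N x y\<close> is the operator that \<open>x \<otimes> y\<close> has to become in
  the product representation given by \<open>rs @ ss\<close>. It is bilinear and bounded, as the
  lifting principle demands, and correct on elementary tensors.\<close>

lemma append_op_tensor_rep:
  assumes As: "cstars As" and Bs: "cstars Bs" and rs: "list_all2 op_rep As rs" and ss: "list_all2 op_rep Bs ss"
  defines "N \<equiv> \<lambda>x y. append_op (length As) (tensor_rep As rs x) (tensor_rep Bs ss y)"
  shows "x \<in> carr (tprod M As) \<Longrightarrow> x' \<in> carr (tprod M As) \<Longrightarrow> y \<in> carr (tprod M Bs) \<Longrightarrow>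
      N (cadd (tprod M As) x x') y = N x y + N x' y"
    and "x \<in> carr (tprod M As) \<Longrightarrow> y \<in> carr (tprod M Bs) \<Longrightarrow> y' \<in> carr (tprod M Bs) \<Longrightarrow>
      N x (cadd (tprod M Bs) y y') = N x y + N x y'"
    and "x \<in> carr (tprod M As) \<Longrightarrow> y \<in> carr (tprod M Bs) \<Longrightarrow>
      N (cscale (tprod M As) c x) y = cmult c o\<^sub>L N x y"
    and "x \<in> carr (tprod M As) \<Longrightarrow> y \<in> carr (tprod M Bs) \<Longrightarrow>
      N x (cscale (tprod M Bs) c y) = cmult c o\<^sub>L N x y"
    and "x \<in> carr (tprod M As) \<Longrightarrow> y \<in> carr (tprod M Bs) \<Longrightarrow>
      norm (N x y) \<le> cnrm (tprod M As) x * cnrm (tprod M Bs) y"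
    and "as \<in> elementary As \<Longrightarrow> bs \<in> elementary Bs \<Longrightarrow>
      N (telem M As as) (telem M Bs bs) = tensor_rep (As @ Bs) (rs @ ss) (telem M (As @ Bs) (as @ bs))"
proof -
  note r = op_rep_tensor_rep[OF As rs] and s = op_rep_tensor_rep[OF Bs ss]
  show "N (cadd (tprod M As) x x') y = N x y + N x' y"
    if "x \<in> carr (tprod M As)" "x' \<in> carr (tprod M As)" "y \<in> carr (tprod M Bs)"
    using that by (simp add: N_def op_repD[OF r] op_repD(1)[OF s] append_op_add_left)
  show "N x (cadd (tprod M Bs) y y') = N x y + N x y'"
    if "x \<in> carr (tprod M As)" "y \<in> carr (tprod M Bs)" "y' \<in> carr (tprod M Bs)"
    using that by (simp add: N_def op_repD[OF s] op_repD(1)[OF r] append_op_add_right)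
  show "N (cscale (tprod M As) c x) y = cmult c o\<^sub>L N x y" "N x (cscale (tprod M Bs) c y) = cmult c o\<^sub>L N x y"
    "norm (N x y) \<le> cnrm (tprod M As) x * cnrm (tprod M Bs) y"
    if x: "x \<in> carr (tprod M As)" and y: "y \<in> carr (tprod M Bs)"
  proof -
    show "N (cscale (tprod M As) c x) y = cmult c o\<^sub>L N x y" "N x (cscale (tprod M Bs) c y) = cmult c o\<^sub>L N x y"
      using x y by (simp_all add: N_def op_repD(1,3)[OF s] op_repD(1,3)[OF r] append_op_cmult)
    have "norm (N x y) \<le> norm (tensor_rep As rs x) * norm (tensor_rep Bs ss y)"
      using x y by (simp add: N_def norm_append_op_le op_repD(1)[OF s] op_repD(1)[OF r])
    also have "\<dots> \<le> cnrm (tprod M As) x * cnrm (tprod M Bs) y"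
      using x y norm_tensor_rep_le As Bs rs ss cstar_algebra.norm_nonneg[OF cstar_tprod[OF As] x]
      by (intro mult_mono) auto
    finally show "norm (N x y) \<le> cnrm (tprod M As) x * cnrm (tprod M Bs) y" .
  qed
  show "N (telem M As as) (telem M Bs bs) = tensor_rep (As @ Bs) (rs @ ss) (telem M (As @ Bs) (as @ bs))"
    if as: "as \<in> elementary As" and bs: "bs \<in> elementary Bs"
  proof -
    have len: "length as = length As" "length rs = length As"
      using as rs by (auto simp: elementary_def list_all2_lengthD)
    have all: "list_all2 op_rep (As @ Bs) (rs @ ss)"
      using rs ss by (rule list_all2_appendI)
    have map2: "rep_ops (rs @ ss) (as @ bs) = rep_ops rs as @ rep_ops ss bs"
      using len by simp
    show ?thesis
      using as bs len tensor_ops_append[of "rep_ops rs as" "rep_ops ss bs"]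
        clin_rep_ops[OF all elementary_append[OF as bs]]
      unfolding N_def tensor_rep_telem[OF As rs as] tensor_rep_telem[OF Bs ss bs] map2
        tensor_rep_telem[OF cstars_append[OF As Bs] all elementary_append[OF as bs]]
      by simp
  qed
qed

lemma list_all2_append_split:
  assumes "list_all2 P (xs @ ys) zs"
  obtains us vs where "zs = us @ vs" "list_all2 P xs us" "list_all2 P ys vs"
  using assms by (auto simp: list_all2_append1)

text \<open>Two applications of the lifting principle: in \<open>x\<close> with an elementary second
  argument, then in \<open>y\<close> for arbitrary \<open>x\<close>. Each list of representations of
  \<open>As @ Bs\<close> splits in two, so the family indexed by pairs is jointly isometric.\<close>

lemma tjoin2_value_exists:
  assumes As: "cstars As" and Bs: "cstars Bs" and x: "x \<in> carr (tprod M As)" and y: "y \<in> carr (tprod M Bs)"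
  shows "\<exists>w\<in>carr (tprod M (As @ Bs)). \<forall>(rs, ss)\<in>{(rs, ss). list_all2 op_rep As rs \<and> list_all2 op_rep Bs ss}.
    tensor_rep (As @ Bs) (rs @ ss) w = append_op (length As) (tensor_rep As rs x) (tensor_rep Bs ss y)"
proof -
  define I :: "(('u \<Rightarrow> 'u op) list \<times> ('u \<Rightarrow> 'u op) list) set"
    where "I = {(rs, ss). list_all2 op_rep As rs \<and> list_all2 op_rep Bs ss}"
  define Q where "Q = (\<lambda>(rs, ss). tensor_rep (As @ Bs) (rs @ ss))"
  define N where "N = (\<lambda>(rs, ss) x y. append_op (length As) (tensor_rep As rs x) (tensor_rep Bs ss y))"
  have AB: "cstars (As @ Bs)"
    using As Bs by (rule cstars_append)
  have I_append: "list_all2 op_rep (As @ Bs) (fst i @ snd i)" if "i \<in> I" for i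
    using that by (auto simp: I_def intro: list_all2_appendI)
  have Q: "\<And>i x y. i \<in> I \<Longrightarrow> x \<in> carr (tprod M (As @ Bs)) \<Longrightarrow> y \<in> carr (tprod M (As @ Bs)) \<Longrightarrow>
      Q i (cadd (tprod M (As @ Bs)) x y) = Q i x + Q i y"
    "\<And>i x. i \<in> I \<Longrightarrow> x \<in> carr (tprod M (As @ Bs)) \<Longrightarrow> norm (Q i x) \<le> cnrm (tprod M (As @ Bs)) x"
    using tensor_rep_add[OF AB I_append] norm_tensor_rep_le[OF AB I_append] by (auto simp: Q_def split_beta)
  have faithful: "cnrm (tprod M (As @ Bs)) x \<le> K"
    if "x \<in> carr (tprod M (As @ Bs))" "\<And>i. i \<in> I \<Longrightarrow> norm (Q i x) \<le> K" for x K
  proof (rule tensor_rep_faithful[OF AB that(1)])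
    fix rs :: "('u \<Rightarrow> 'u op) list" assume "list_all2 op_rep (As @ Bs) rs"
    then obtain us vs where "rs = us @ vs" "(us, vs) \<in> I"
      by (auto simp: I_def list_all2_append1)
    then show "norm (tensor_rep (As @ Bs) rs x) \<le> K"
      using that(2)[of "(us, vs)"] by (simp add: Q_def)
  qed
  note N = append_op_tensor_rep[OF As Bs]
  have elem: "\<exists>w\<in>carr (tprod M (As @ Bs)). \<forall>i\<in>I. Q i w = N i x (telem M Bs bs)"
    if bs: "bs \<in> elementary Bs" for bs
  proof (rule lift_from_elementary[OF As cstar_tprod[OF AB] Q faithful, where \<Theta> = "\<lambda>i x. N i x (telem M Bs bs)"
        and C = "cnrm (tprod M Bs) (telem M Bs bs)"])
    show "\<exists>w\<in>carr (tprod M (As @ Bs)). \<forall>i\<in>I. Q i w = N i (telem M As as) (telem M Bs bs)"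
      if as: "as \<in> elementary As" for as
      using as bs N(6)[OF _ _ as bs] telem_closed[OF AB elementary_append[OF as bs]]
      by (intro bexI[where x = "telem M (As @ Bs) (as @ bs)"]) (auto simp: I_def Q_def N_def)
  qed (use x N(1,5) telem_closed[OF Bs bs] in \<open>auto simp: I_def N_def mult.commute\<close>)
  have "\<exists>w\<in>carr (tprod M (As @ Bs)). \<forall>i\<in>I. Q i w = N i x y"
    by (rule lift_from_elementary[OF Bs cstar_tprod[OF AB] Q faithful, where \<Theta> = "\<lambda>i y. N i x y"
        and C = "cnrm (tprod M As) x"])
      (use x y N(2,5) elem in \<open>auto simp: I_def N_def\<close>)
  then show ?thesis
    unfolding I_def Q_def N_def by (simp add: split_beta)
qed

text \<open>The values found above are chosen for \<open>m\<close>. Bilinearity and the norm bound,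
  with constant 1, are then checked in the product representations, where \<open>append_op\<close>
  has these properties.\<close>

lemma tjoin2: assumes As: "cstars As" and Bs: "cstars Bs" shows "is_tjoin2 M As Bs (tjoin2 M As Bs)"
proof -
  have AB: "cstars (As @ Bs)"
    using As Bs by (rule cstars_append)
  interpret A: cstar_algebra "tprod M As" by (rule cstar_tprod[OF As])
  interpret B: cstar_algebra "tprod M Bs" by (rule cstar_tprod[OF Bs])
  interpret AB: cstar_algebra "tprod M (As @ Bs)" by (rule cstar_tprod[OF AB])
  obtain m where m: "\<And>x y. x \<in> carr (tprod M As) \<Longrightarrow> y \<in> carr (tprod M Bs) \<Longrightarrow> m x y \<in> carr (tprod M (As @ Bs))"
    and rep: "\<And>x y rs ss. x \<in> carr (tprod M As) \<Longrightarrow> y \<in> carr (tprod M Bs) \<Longrightarrow> list_all2 op_rep As rs \<Longrightarrow>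
      list_all2 op_rep Bs ss \<Longrightarrow>
      tensor_rep (As @ Bs) (rs @ ss) (m x y) = append_op (length As) (tensor_rep As rs x) (tensor_rep Bs ss y)"
    using tjoin2_value_exists[OF As Bs] by (simp add: Bex_def) metis
  note N = append_op_tensor_rep[OF As Bs]
  have eqI: "v = w" if "v \<in> carr (tprod M (As @ Bs))" "w \<in> carr (tprod M (As @ Bs))"
    "\<And>rs ss. list_all2 op_rep As rs \<Longrightarrow> list_all2 op_rep Bs ss \<Longrightarrow>
      tensor_rep (As @ Bs) (rs @ ss) v = tensor_rep (As @ Bs) (rs @ ss) w" for v w
    by (rule tensor_rep_eqI[OF AB that(1,2)]) (metis list_all2_append_split that(3))
  note add = tensor_rep_add[OF AB list_all2_appendI] and scale = tensor_rep_scale[OF AB list_all2_appendI]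
  have "is_tjoin2 M As Bs m"
    unfolding is_tjoin2_def clinear_map_def
  proof (intro conjI ballI allI)
    fix x y x' y' c
    assume x: "x \<in> carr (tprod M As)" and y: "y \<in> carr (tprod M Bs)"
    show "m x y \<in> carr (tprod M (As @ Bs))" "m x y \<in> carr (tprod M (As @ Bs))"
      by (rule m[OF x y])+
    show "m x (cscale (tprod M Bs) c y) = cscale (tprod M (As @ Bs)) c (m x y)"
      using x y m by (intro eqI) (simp_all add: rep N scale)
    show "m (cscale (tprod M As) c x) y = cscale (tprod M (As @ Bs)) c (m x y)"
      using x y m by (intro eqI) (simp_all add: rep N scale)
    show "m x (cadd (tprod M Bs) y y') = cadd (tprod M (As @ Bs)) (m x y) (m x y')"
      if "y' \<in> carr (tprod M Bs)"
      using x y m that by (intro eqI) (simp_all add: rep N add)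
    show "m (cadd (tprod M As) x x') y = cadd (tprod M (As @ Bs)) (m x y) (m x' y)"
      if "x' \<in> carr (tprod M As)"
      using x y m that by (intro eqI) (simp_all add: rep N add)
  next
    fix as bs assume as: "as \<in> elementary As" and bs: "bs \<in> elementary Bs"
    show "m (telem M As as) (telem M Bs bs) = telem M (As @ Bs) (as @ bs)"
      using as bs telem_closed As Bs AB elementary_append[OF as bs] m
      by (intro eqI) (simp_all add: rep N(6))
  next
    have "cnrm (tprod M (As @ Bs)) (m x y) \<le> 1 * cnrm (tprod M As) x * cnrm (tprod M Bs) y"
      if x: "x \<in> carr (tprod M As)" and y: "y \<in> carr (tprod M Bs)" for x y
    proof (rule tensor_rep_faithful[OF AB m[OF x y]])
      fix rs :: "('u \<Rightarrow> 'u op) list" assume "list_all2 op_rep (As @ Bs) rs"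
      then obtain us vs where "rs = us @ vs" "list_all2 op_rep As us" "list_all2 op_rep Bs vs"
        by (rule list_all2_append_split)
      then show "norm (tensor_rep (As @ Bs) rs (m x y)) \<le> 1 * cnrm (tprod M As) x * cnrm (tprod M Bs) y"
        using N(5)[OF _ _ x y] x y by (simp add: rep)
    qed
    then show "\<exists>K. \<forall>x\<in>carr (tprod M As). \<forall>y\<in>carr (tprod M Bs).
        cnrm (tprod M (As @ Bs)) (m x y) \<le> K * cnrm (tprod M As) x * cnrm (tprod M Bs) y"
      by blast
  qed
  then show ?thesis
    unfolding tjoin2_def by (rule someI[of "is_tjoin2 M As Bs"])
qed

lemma tjoin2_closed:
  "cstars As \<Longrightarrow> cstars Bs \<Longrightarrow> x \<in> carr (tprod M As) \<Longrightarrow> y \<in> carr (tprod M Bs) \<Longrightarrow>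
    tjoin2 M As Bs x y \<in> carr (tprod M (As @ Bs))"
  using tjoin2 unfolding is_tjoin2_def clinear_map_def by blast

lemma tjoin2_telem:
  "cstars As \<Longrightarrow> cstars Bs \<Longrightarrow> as \<in> elementary As \<Longrightarrow> bs \<in> elementary Bs \<Longrightarrow>
    tjoin2 M As Bs (telem M As as) (telem M Bs bs) = telem M (As @ Bs) (as @ bs)"
  using tjoin2 unfolding is_tjoin2_def by blast

text \<open>The chosen \<open>tjoin2\<close> is known only by its characterising properties.
  Together with density in each argument they determine its image in every product
  representation.\<close>

lemma tensor_rep_tjoin2:
  assumes As: "cstars As" and Bs: "cstars Bs" and rs: "list_all2 op_rep As rs" and ss: "list_all2 op_rep Bs ss"
    and x: "x \<in> carr (tprod M As)" and y: "y \<in> carr (tprod M Bs)"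
  shows "tensor_rep (As @ Bs) (rs @ ss) (tjoin2 M As Bs x y)
    = append_op (length As) (tensor_rep As rs x) (tensor_rep Bs ss y)"
proof -
  have AB: "cstars (As @ Bs)" and all: "list_all2 op_rep (As @ Bs) (rs @ ss)"
    using As Bs rs ss by (auto intro: cstars_append list_all2_appendI)
  note N = append_op_tensor_rep[OF As Bs rs ss] and join = tjoin2[OF As Bs, unfolded is_tjoin2_def clinear_map_def]
  let ?J = "\<lambda>x y. tensor_rep (As @ Bs) (rs @ ss) (tjoin2 M As Bs x y)"
  let ?N = "\<lambda>x y. append_op (length As) (tensor_rep As rs x) (tensor_rep Bs ss y)"
  obtain K where K: "\<forall>x\<in>carr (tprod M As). \<forall>y\<in>carr (tprod M Bs).
      cnrm (tprod M (As @ Bs)) (tjoin2 M As Bs x y) \<le> K * cnrm (tprod M As) x * cnrm (tprod M Bs) y"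
    using join by blast
  have J_le: "norm (?J x y) \<le> K * cnrm (tprod M As) x * cnrm (tprod M Bs) y"
    if "x \<in> carr (tprod M As)" "y \<in> carr (tprod M Bs)" for x y
    using norm_tensor_rep_le[OF AB all tjoin2_closed[OF As Bs that]] K that by fastforce
  have J1: "additive_bounded (tprod M As) (\<lambda>x. ?J x y)" if y: "y \<in> carr (tprod M Bs)" for y
  proof (rule additive_boundedI[where C = "K * cnrm (tprod M Bs) y"])
    show "?J (cadd (tprod M As) x x') y = ?J x y + ?J x' y"
      if "x \<in> carr (tprod M As)" "x' \<in> carr (tprod M As)" for x x'
      using join that y tensor_rep_add[OF AB all] tjoin2_closed[OF As Bs] by simp
    show "norm (?J x y) \<le> K * cnrm (tprod M Bs) y * cnrm (tprod M As) x" if "x \<in> carr (tprod M As)" for x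
      using J_le[OF that y] by (simp add: mult_ac)
  qed
  have J2: "additive_bounded (tprod M Bs) (\<lambda>y. ?J x y)" if x: "x \<in> carr (tprod M As)" for x
  proof (rule additive_boundedI[where C = "K * cnrm (tprod M As) x"])
    show "?J x (cadd (tprod M Bs) y y') = ?J x y + ?J x y'"
      if "y \<in> carr (tprod M Bs)" "y' \<in> carr (tprod M Bs)" for y y'
      using join that x tensor_rep_add[OF AB all] tjoin2_closed[OF As Bs] by simp
    show "norm (?J x y) \<le> K * cnrm (tprod M As) x * cnrm (tprod M Bs) y" if "y \<in> carr (tprod M Bs)" for y
      by (rule J_le[OF x that])
  qed
  have N1: "additive_bounded (tprod M As) (\<lambda>x. ?N x y)" if y: "y \<in> carr (tprod M Bs)" for y
    using N(1,5) y by (auto intro!: additive_boundedI[where C = "cnrm (tprod M Bs) y"] simp: mult.commute)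
  have N2: "additive_bounded (tprod M Bs) (\<lambda>y. ?N x y)" if x: "x \<in> carr (tprod M As)" for x
    using N(2,5) x by (auto intro!: additive_boundedI[where C = "cnrm (tprod M As) x"])
  have "?J x (telem M Bs bs) = ?N x (telem M Bs bs)" if bs: "bs \<in> elementary Bs" for bs
    by (rule additive_bounded_eq[OF As J1[OF telem_closed[OF Bs bs]] N1[OF telem_closed[OF Bs bs]] _ x])
      (use N(6) tjoin2_telem[OF As Bs] bs in simp)
  then show ?thesis
    by (rule additive_bounded_eq[OF Bs J2[OF x] N2[OF x] _ y])
qed

text \<open>Cutting a list after \<open>m\<close> places and the rest after \<open>n\<close> gives
  the same three pieces as cutting it after \<open>m + n\<close> places and the first part after
  \<open>m\<close>.\<close>

lemma append_op_assoc:
  assumes "clin R" "clin S" "clin T"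
  shows "append_op m R (append_op n S T) = append_op (m + n) (append_op m R S) T"
proof (rule op_eqI)
  fix zs ws :: "'a list"
  show "entry (append_op m R (append_op n S T)) zs ws = entry (append_op (m + n) (append_op m R S) T) zs ws"
  proof (cases "length zs < m \<or> length ws < m")
    case True
    then show ?thesis
      by (simp add: entry_append_op_short) (metis entry_append_op_short trans_less_add1)
  next
    case False
    then obtain u v u' v' where zs: "zs = u @ v" "length u = m" and ws: "ws = u' @ v'" "length u' = m"
      by (metis append_take_drop_id length_take min.absorb2 not_le)
    show ?thesis
    proof (cases "length v < n \<or> length v' < n")
      case True
      then have "length zs < m + n \<or> length ws < m + n"
        using zs ws by auto
      then show ?thesis
        using True zs ws assms by (simp add: entry_append_op entry_append_op_short clin_append_op)
    next
      case False
      then obtain x y x' y' where v: "v = x @ y" "length x = n" and v': "v' = x' @ y'" "length x' = n"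
        by (metis append_take_drop_id length_take min.absorb2 not_le)
      have "entry (append_op m R (append_op n S T)) zs ws = entry R u u' * (entry S x x' * entry T y y')"
        unfolding zs(1) ws(1) v v' using assms zs ws v v' by (simp add: entry_append_op clin_append_op)
      moreover have "entry (append_op (m + n) (append_op m R S) T) ((u @ x) @ y) ((u' @ x') @ y')
          = entry R u u' * entry S x x' * entry T y y'"
        using assms zs ws v v' by (subst entry_append_op) (simp_all add: entry_append_op clin_append_op)
      ultimately show ?thesis
        using zs ws v v' by simp
    qed
  qed
qed (use assms in \<open>auto intro: clin_append_op\<close>)

text \<open>In a product representation both sides become iterated \<open>append_op\<close>. As
  multiple products are formed from flat lists, both sides lie in the same algebra.\<close>

lemma tjoin2_assoc:
  assumes As: "cstars As" and Bs: "cstars Bs" and Cs: "cstars Cs"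
    and x: "x \<in> carr (tprod M As)" and y: "y \<in> carr (tprod M Bs)" and z: "z \<in> carr (tprod M Cs)"
  shows "tjoin2 M As (Bs @ Cs) x (tjoin2 M Bs Cs y z) = tjoin2 M (As @ Bs) Cs (tjoin2 M As Bs x y) z"
proof (rule tensor_rep_eqI)
  note c = cstars_append[OF As Bs] cstars_append[OF Bs Cs] cstars_append[OF As cstars_append[OF Bs Cs]]
  show "cstars (As @ Bs @ Cs)"
    by (rule c)
  show "tjoin2 M As (Bs @ Cs) x (tjoin2 M Bs Cs y z) \<in> carr (tprod M (As @ Bs @ Cs))"
    by (intro tjoin2_closed As Bs Cs x y z c)
  show "tjoin2 M (As @ Bs) Cs (tjoin2 M As Bs x y) z \<in> carr (tprod M (As @ Bs @ Cs))"
    using tjoin2_closed[OF c(1) Cs tjoin2_closed[OF As Bs x y] z] by simp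
  fix rs :: "('u \<Rightarrow> 'u op) list" assume "list_all2 op_rep (As @ Bs @ Cs) rs"
  then obtain rs1 rs2 rs3 where rs: "rs = rs1 @ rs2 @ rs3"
    and r: "list_all2 op_rep As rs1" "list_all2 op_rep Bs rs2" "list_all2 op_rep Cs rs3"
    by (metis list_all2_append_split)
  have "tensor_rep (As @ Bs @ Cs) (rs1 @ rs2 @ rs3) (tjoin2 M As (Bs @ Cs) x (tjoin2 M Bs Cs y z))
      = append_op (length As) (tensor_rep As rs1 x)
          (append_op (length Bs) (tensor_rep Bs rs2 y) (tensor_rep Cs rs3 z))"
    using tensor_rep_tjoin2[OF As c(2) r(1) list_all2_appendI[OF r(2,3)] x tjoin2_closed[OF Bs Cs y z]]
      tensor_rep_tjoin2[OF Bs Cs r(2,3) y z] by simp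
  moreover have "tensor_rep ((As @ Bs) @ Cs) ((rs1 @ rs2) @ rs3) (tjoin2 M (As @ Bs) Cs (tjoin2 M As Bs x y) z)
      = append_op (length As + length Bs)
          (append_op (length As) (tensor_rep As rs1 x) (tensor_rep Bs rs2 y)) (tensor_rep Cs rs3 z)"
    using tensor_rep_tjoin2[OF c(1) Cs list_all2_appendI[OF r(1,2)] r(3) tjoin2_closed[OF As Bs x y] z]
      tensor_rep_tjoin2[OF As Bs r(1,2) x y] by simp
  ultimately show "tensor_rep (As @ Bs @ Cs) rs (tjoin2 M As (Bs @ Cs) x (tjoin2 M Bs Cs y z))
      = tensor_rep (As @ Bs @ Cs) rs (tjoin2 M (As @ Bs) Cs (tjoin2 M As Bs x y) z)"
    using rs r As Bs Cs x y z by (simp add: append_op_assoc clin_tensor_rep)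
qed

end

subsection \<open>Tensoring a homomorphism with an identity map\<close>

text \<open>Replaces the tail of a list by its code, so that a nonempty list becomes one of length
  two. A product of representations of \<open>A # Bs\<close> is thereby compared with a product of
  two representations.\<close>

fun block_code :: "('a list \<Rightarrow> 'a) \<Rightarrow> 'a list \<Rightarrow> 'a list" where
  "block_code e [] = []"
| "block_code e (z # zs) = [z, e zs]"

lemma inj_block_code: "inj e \<Longrightarrow> inj (block_code e)"
proof (rule injI)
  fix zs ws assume "inj e" "block_code e zs = block_code e ws"
  then show "zs = ws"
    by (cases zs; cases ws) (auto dest: injD)
qed

lemma append_op_singleton:
  assumes "clin T" "clin S"
  shows "append_op (Suc 0) (tensor_ops [T]) S = transport cons_pair UNIV (op_tensor T S)"
proof (rule op_eqI)
  have T: "clin (tensor_ops [T])"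
    using assms by (intro clin_tensor_ops) simp
  show "clin (append_op (Suc 0) (tensor_ops [T]) S)" "clin (transport cons_pair UNIV (op_tensor T S))"
    using assms T by (auto intro: clin_append_op clin_transport clin_op_tensor inj_cons_pair)
  fix zs ws
  show "entry (append_op (Suc 0) (tensor_ops [T]) S) zs ws = entry (transport cons_pair UNIV (op_tensor T S)) zs ws"
  proof (cases "zs = [] \<or> ws = []")
    case True
    then have "entry (transport cons_pair UNIV (op_tensor T S)) zs ws = 0"
      by (intro entry_transport_other inj_cons_pair) auto
    then show ?thesis
      using True by (auto intro!: entry_append_op_short)
  next
    case False
    then obtain z zs' w ws' where "zs = z # zs'" "ws = w # ws'"
      by (meson neq_Nil_conv)
    then show ?thesis
      using assms T entry_append_op[OF T assms(2), of "[z]" 1 "[w]" zs' ws']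
        entry_transport[OF inj_cons_pair, of "(z, zs')" "(w, ws')" "op_tensor T S"]
        entry_tensor_ops_Cons[of T "[]" z "[]" w "[]"]
      by (simp add: entry_op_tensor entry_tensor_ops_Nil del: tensor_ops.simps)
  qed
qed

text \<open>Both matrices live on lists of length two whose second member is a code, and there the
  entries are products of entries of \<open>T\<close> and \<open>S\<close>.\<close>

lemma transport_block_code:
  assumes "clin T" "clin S" "inj e"
  shows "transport (block_code e) UNIV (transport cons_pair UNIV (op_tensor T S))
    = tensor_ops [T, transport e UNIV S]"
proof (rule op_eqI)
  let ?L = "transport (block_code e) UNIV (transport cons_pair UNIV (op_tensor T S))"
  let ?R = "tensor_ops [T, transport e UNIV S]"
  have e: "inj (block_code e)"
    using assms(3) by (rule inj_block_code)
  have clin: "\<forall>U\<in>set [T, transport e UNIV S]. clin U"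
    using assms by (simp add: clin_transport)
  show "clin ?L" "clin ?R"
    using assms e clin by (auto intro!: clin_transport clin_op_tensor inj_cons_pair clin_tensor_ops simp del: tensor_ops.simps)
  have R2: "entry ?R [z, y] [w, x] = entry T z w * entry (transport e UNIV S) y x" for z y w x
    using clin entry_tensor_ops_Cons[of T "[transport e UNIV S]" z "[y]" w "[x]"]
      entry_tensor_ops_Cons[of "transport e UNIV S" "[]" y "[]" x "[]"]
    by (simp add: entry_tensor_ops_Nil del: tensor_ops.simps)
  fix zs ws
  show "entry ?L zs ws = entry ?R zs ws"
  proof (cases "length zs = 2 \<and> length ws = 2")
    case True
    then obtain z y w x where zs: "zs = [z, y]" and ws: "ws = [w, x]"
      by (auto simp: length_Suc_conv numeral_2_eq_2)
    show ?thesis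
    proof (cases "y \<in> range e \<and> x \<in> range e")
      case True
      then obtain u v where uv: "y = e u" "x = e v"
        by auto
      then show ?thesis
        using entry_transport[OF e, of "z # u" "w # v"] entry_transport[OF assms(3), of u v S]
          entry_transport[OF inj_cons_pair, of "(z, u)" "(w, v)" "op_tensor T S"] assms
        unfolding zs ws R2 by (simp add: entry_op_tensor)
    next
      case False
      have "zs \<notin> range (block_code e) \<or> ws \<notin> range (block_code e)"
      proof (rule ccontr)
        assume "\<not> (zs \<notin> range (block_code e) \<or> ws \<notin> range (block_code e))"
        then obtain u v where "zs = block_code e u" "ws = block_code e v"
          by auto
        then show False
          using False zs ws by (cases u; cases v) auto
      qed
      then have "entry ?L zs ws = 0"
        by (intro entry_transport_other e)
      then show ?thesis
        using False entry_transport_other[OF assms(3), of y x S] unfolding zs ws R2 by auto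
    qed
  next
    case False
    have "entry ?L zs ws = 0"
    proof (cases "zs \<in> range (block_code e) \<and> ws \<in> range (block_code e)")
      case True
      then obtain u v where uv: "zs = block_code e u" "ws = block_code e v"
        by auto
      then have "u = [] \<or> v = []"
        using False by (cases u; cases v) auto
      then have "entry (transport cons_pair UNIV (op_tensor T S)) u v = 0"
        by (intro entry_transport_other inj_cons_pair) auto
      then show ?thesis
        using entry_transport[OF e, of u v] uv by simp
    qed (auto intro!: entry_transport_other e)
    then show ?thesis
      using False clin by (subst entry_tensor_ops_length) auto
  qed
qed

text \<open>The slice map of a matrix coefficient on the first factor: the block of \<open>T\<close>
  in row \<open>z\<close> and column \<open>w\<close>.\<close>

definition slice :: "'a \<Rightarrow> 'a \<Rightarrow> 'a list op \<Rightarrow> 'a op" where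
  "slice z w T = down (\<lambda>x. [z, x]) UNIV o\<^sub>L T o\<^sub>L up (\<lambda>x. [w, x]) UNIV"

lemma inj_slice: "inj (\<lambda>x. [z, x])"
  by (simp add: inj_def)

lemma clin_slice: "clin T \<Longrightarrow> clin (slice z w T)"
  unfolding slice_def by (intro clin_compose clin_down clin_up inj_slice)

lemma norm_slice_le: "norm (slice z w T) \<le> norm T"
  unfolding slice_def by (intro norm_contract_compose norm_down_le norm_up_le inj_slice)

lemma entry_slice: "entry (slice z w T) x y = entry T [z, x] [w, y]"
  by (simp add: slice_def entry_def coord_down inj_slice up_basis_vec)

lemma slice_add: "slice z w (T + S) = slice z w T + slice z w S"
  by (rule blinfun_eqI) (simp add: slice_def blinfun.add_left blinfun.add_right)

lemma slice_tensor_ops: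
  assumes "clin T" "clin S"
  shows "slice z w (tensor_ops [T, S]) = cmult (entry T z w) o\<^sub>L S"
proof (rule op_eqI)
  have "\<forall>U\<in>set [T, S]. clin U"
    using assms by simp
  then show "clin (slice z w (tensor_ops [T, S]))" "clin (cmult (entry T z w) o\<^sub>L S)"
    using assms by (auto intro!: clin_slice clin_tensor_ops clin_compose clin_cmult simp del: tensor_ops.simps)
  show "entry (slice z w (tensor_ops [T, S])) x y = entry (cmult (entry T z w) o\<^sub>L S) x y" for x y
    using assms entry_tensor_ops_Cons[of T "[S]" z "[x]" w "[y]"] entry_tensor_ops_Cons[of S "[]" x "[]" y "[]"]
    by (simp add: entry_slice entry_cmult_compose entry_tensor_ops_Nil del: tensor_ops.simps)
qed

context min_tensors
begin

lemma elementary_pair: "xs \<in> elementary [A, B] \<longleftrightarrow> (\<exists>a b. xs = [a, b] \<and> a \<in> carr A \<and> b \<in> carr B)"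
  by (auto simp: elementary_Cons)

lemma cstars_pair: "cstar_algebra A \<Longrightarrow> cstar_algebra B \<Longrightarrow> cstars [A, B]"
  and cstars_single: "cstar_algebra A \<Longrightarrow> cstars [A]"
  and cstars_Cons: "cstar_algebra A \<Longrightarrow> cstars Bs \<Longrightarrow> cstars (A # Bs)"
  by (auto simp: cstars_def)

lemma tjoin2_singletons:
  assumes "cstar_algebra A" "cstar_algebra D" "a \<in> carr A" "d \<in> carr D"
  shows "tjoin2 M [A] [D] a d = telem M [A, D] [a, d]"
  using tjoin2_telem[of "[A]" "[D]" "[a]" "[d]"] assms
  by (simp add: cstars_single telem_singleton elementary_Cons)

lemma tensor_rep_pair:
  assumes "cstar_algebra A" "cstar_algebra D" "op_rep A r" "op_rep D s" "a \<in> carr A" "d \<in> carr D"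
  shows "tensor_rep [A, D] [r, s] (telem M [A, D] [a, d]) = tensor_ops [r a, s d]"
  using tensor_rep_telem[of "[A, D]" "[r, s]" "[a, d]"] assms
  by (simp add: cstars_pair elementary_Cons del: tensor_ops.simps)

lemma tensor_rep_tjoin2_singleton:
  assumes A: "cstar_algebra A" and Bs: "cstars Bs" and r: "op_rep A r" and rs: "list_all2 op_rep Bs rs"
    and a: "a \<in> carr A" and y: "y \<in> carr (tprod M Bs)"
  shows "tensor_rep (A # Bs) (r # rs) (tjoin2 M [A] Bs a y)
    = transport cons_pair UNIV (op_tensor (r a) (tensor_rep Bs rs y))"
proof -
  have "tensor_rep [A] [r] a = tensor_ops [r a]"
    using tensor_rep_telem[of "[A]" "[r]" "[a]"] A r a
    by (simp add: cstars_single elementary_Cons telem_singleton del: tensor_ops.simps)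
  moreover have "tensor_rep ([A] @ Bs) ([r] @ rs) (tjoin2 M [A] Bs a y)
      = append_op (length [A]) (tensor_rep [A] [r] a) (tensor_rep Bs rs y)"
    using A r a by (intro tensor_rep_tjoin2 Bs rs y) (auto simp: cstars_single tprod_singleton)
  ultimately show ?thesis
    using append_op_singleton[OF op_repD(1)[OF r a] clin_tensor_rep[OF Bs rs y]]
    by (simp del: tensor_ops.simps)
qed

context
  fixes A D :: "'u cstar" and Bs :: "'u cstar list" and f :: "'u \<Rightarrow> 'u" and e :: "'u list \<Rightarrow> 'u"
  assumes A: "cstar_algebra A" and D: "cstar_algebra D" and Bs: "cstars Bs"
    and f: "star_hom D (tprod M Bs) f" and e: "inj e"
begin

text \<open>A product representation of \<open>Bs\<close>, restricted to \<open>D\<close> along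
  \<open>f\<close>, acts on families over lists; transport along \<open>e\<close> returns to
  families over \<open>'u\<close>, as is required of the representations that enter the minimal norm
  of \<open>[A, D]\<close>.\<close>

definition pulled_rep :: "('u \<Rightarrow> 'u op) list \<Rightarrow> 'u \<Rightarrow> 'u op" where
  "pulled_rep rs d = transport e UNIV (tensor_rep Bs rs (f d))"

lemma op_rep_pulled_rep: "list_all2 op_rep Bs rs \<Longrightarrow> op_rep D (pulled_rep rs)"
  unfolding pulled_rep_def[abs_def]
  by (intro op_rep_transport op_rep_star_hom[OF _ f] op_rep_tensor_rep Bs e)

lemma AD: "cstars [A, D]" and ABs: "cstars (A # Bs)"
  using A D Bs by (auto intro: cstars_pair cstars_Cons)

lemma op_rep_pair: "op_rep A r \<Longrightarrow> list_all2 op_rep Bs rs \<Longrightarrow> list_all2 op_rep [A, D] [r, pulled_rep rs]"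
  by (simp add: op_rep_pulled_rep)

lemma block_code_tjoin2:
  assumes "op_rep A r" "list_all2 op_rep Bs rs" "a \<in> carr A" "d \<in> carr D"
  shows "transport (block_code e) UNIV (tensor_rep (A # Bs) (r # rs) (tjoin2 M [A] Bs a (f d)))
    = tensor_rep [A, D] [r, pulled_rep rs] (telem M [A, D] [a, d])"
proof -
  have fd: "f d \<in> carr (tprod M Bs)"
    by (rule star_homD(1)[OF f assms(4)])
  show ?thesis
    using assms fd op_repD(1)[OF assms(1,3)] clin_tensor_rep[OF Bs assms(2) fd] e
    by (simp add: tensor_rep_tjoin2_singleton A Bs tensor_rep_pair D op_rep_pulled_rep
        transport_block_code pulled_rep_def del: tensor_ops.simps)
qed

lemma is_tensor_map_iff:
  "is_tensor_map M [[A], [D]] [[A], Bs] [id, f] h \<longleftrightarrow>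
    star_hom (tprod M [A, D]) (tprod M (A # Bs)) h \<and>
    (\<forall>a\<in>carr A. \<forall>d\<in>carr D. h (telem M [A, D] [a, d]) = tjoin2 M [A] Bs a (f d))"
proof -
  have "(\<forall>xs\<in>elementary [A, D]. P xs) \<longleftrightarrow> (\<forall>a\<in>carr A. \<forall>d\<in>carr D. P [a, d])" for P
    by (auto simp: elementary_pair)
  then show ?thesis
    using A D by (simp add: is_tensor_map_def tprod_singleton tjoin2_singletons)
qed

text \<open>Both sides are bounded and additive in \<open>z\<close>, the left one by contractivity
  of \<open>h\<close>, and they agree on elementary tensors.\<close>

lemma tensor_map_rep:
  assumes h: "is_tensor_map M [[A], [D]] [[A], Bs] [id, f] h"
    and r: "op_rep A r" and rs: "list_all2 op_rep Bs rs" and z: "z \<in> carr (tprod M [A, D])"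
  shows "transport (block_code e) UNIV (tensor_rep (A # Bs) (r # rs) (h z))
    = tensor_rep [A, D] [r, pulled_rep rs] z"
proof (rule additive_bounded_eq[OF AD _ _ _ z])
  have hom: "star_hom (tprod M [A, D]) (tprod M (A # Bs)) h"
    using h by (simp add: is_tensor_map_iff)
  have all: "list_all2 op_rep (A # Bs) (r # rs)"
    using r rs by simp
  show "additive_bounded (tprod M [A, D]) (\<lambda>z. transport (block_code e) UNIV (tensor_rep (A # Bs) (r # rs) (h z)))"
  proof (rule additive_boundedI[where C = 1])
    show "norm (transport (block_code e) UNIV (tensor_rep (A # Bs) (r # rs) (h z))) \<le> 1 * cnrm (tprod M [A, D]) z"
      if "z \<in> carr (tprod M [A, D])" for z
      using norm_tensor_rep_le[OF ABs all star_homD(1)[OF hom that]]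
        star_hom_contractive[OF cstar_tprod[OF AD] cstar_tprod[OF ABs] hom that]
      by (simp add: norm_transport inj_block_code e)
  qed (simp add: star_homD[OF hom] tensor_rep_add[OF ABs all] transport_add)
  show "additive_bounded (tprod M [A, D]) (tensor_rep [A, D] [r, pulled_rep rs])"
    by (rule additive_bounded_tensor_rep[OF AD op_rep_pair[OF r rs]])
  show "transport (block_code e) UNIV (tensor_rep (A # Bs) (r # rs) (h (telem M [A, D] as)))
      = tensor_rep [A, D] [r, pulled_rep rs] (telem M [A, D] as)" if "as \<in> elementary [A, D]" for as
    using that h block_code_tjoin2[OF r rs] by (auto simp: elementary_pair is_tensor_map_iff)
qed

text \<open>The right side of \<open>tensor_map_rep\<close> prescribes the composites of the desired
  map with a jointly isometric family. The lifting principle finds the values, and the homomorphism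
  laws hold because they hold in each representation.\<close>

lemma tensor_map_exists: "\<exists>h. is_tensor_map M [[A], [D]] [[A], Bs] [id, f] h"
proof -
  let ?T = "tprod M [A, D]" and ?S = "tprod M (A # Bs)"
  interpret T: cstar_algebra ?T by (rule cstar_tprod[OF AD])
  interpret S: cstar_algebra ?S by (rule cstar_tprod[OF ABs])
  define I :: "(('u \<Rightarrow> 'u op) \<times> ('u \<Rightarrow> 'u op) list) set"
    where "I = {(r, rs). op_rep A r \<and> list_all2 op_rep Bs rs}"
  define Q where "Q = (\<lambda>(r, rs) w. transport (block_code e) UNIV (tensor_rep (A # Bs) (r # rs) w))"
  define \<Theta> where "\<Theta> = (\<lambda>(r, rs). tensor_rep [A, D] [r, pulled_rep rs])"
  have Q: "op_rep ?S (Q i)" and \<Theta>: "op_rep ?T (\<Theta> i)" if "i \<in> I" for i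
    using that op_rep_pulled_rep unfolding I_def Q_def \<Theta>_def
    by (auto intro!: op_rep_transport op_rep_tensor_rep inj_block_code e ABs AD)
  have faithful: "cnrm ?S x \<le> K" if "x \<in> carr ?S" "\<And>i. i \<in> I \<Longrightarrow> norm (Q i x) \<le> K" for x K
  proof (rule tensor_rep_faithful[OF ABs that(1)])
    fix rs :: "('u \<Rightarrow> 'u op) list" assume "list_all2 op_rep (A # Bs) rs"
    then obtain r rs' where "rs = r # rs'" "(r, rs') \<in> I"
      by (auto simp: I_def list_all2_Cons1)
    then show "norm (tensor_rep (A # Bs) rs x) \<le> K"
      using that(2)[of "(r, rs')"] by (simp add: Q_def norm_transport inj_block_code e)
  qed
  have eqI: "x = y" if "x \<in> carr ?S" "y \<in> carr ?S" "\<And>i. i \<in> I \<Longrightarrow> Q i x = Q i y" for x y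
    using jointly_faithful_eq[OF cstar_tprod[OF ABs], of I Q x y] Q faithful[of _ 0] that by blast
  have elem: "Q i (tjoin2 M [A] Bs a (f d)) = \<Theta> i (telem M [A, D] [a, d])"
    if "i \<in> I" "a \<in> carr A" "d \<in> carr D" for i a d
    using that block_code_tjoin2 by (auto simp: I_def Q_def \<Theta>_def)
  have join: "tjoin2 M [A] Bs a (f d) \<in> carr ?S" if "a \<in> carr A" "d \<in> carr D" for a d
    using tjoin2_closed[OF cstars_single[OF A] Bs, of a "f d"] that star_homD(1)[OF f] A
    by (simp add: tprod_singleton)
  have "\<exists>w\<in>carr ?S. \<forall>i\<in>I. Q i w = \<Theta> i z" if z: "z \<in> carr ?T" for z
  proof (rule lift_from_elementary[OF AD cstar_tprod[OF ABs] _ _ faithful _ _ _ z, where C = 1])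
    show "Q i (cadd ?S x y) = Q i x + Q i y" if "i \<in> I" "x \<in> carr ?S" "y \<in> carr ?S" for i x y
      using that by (simp add: op_repD[OF Q])
    show "norm (Q i x) \<le> cnrm ?S x" if "i \<in> I" "x \<in> carr ?S" for i x
      using that by (intro norm_op_rep_le[OF cstar_tprod[OF ABs] Q])
    show "\<Theta> i (cadd ?T x y) = \<Theta> i x + \<Theta> i y" if "i \<in> I" "x \<in> carr ?T" "y \<in> carr ?T" for i x y
      using that by (simp add: op_repD[OF \<Theta>])
    show "norm (\<Theta> i x) \<le> 1 * cnrm ?T x" if "i \<in> I" "x \<in> carr ?T" for i x
      using norm_op_rep_le[OF cstar_tprod[OF AD] \<Theta>[OF that(1)] that(2)] by simp
    show "\<exists>w\<in>carr ?S. \<forall>i\<in>I. Q i w = \<Theta> i (telem M [A, D] as)" if "as \<in> elementary [A, D]" for as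
      using that elem join by (fastforce simp: elementary_pair)
  qed
  then obtain h where h: "\<And>z. z \<in> carr ?T \<Longrightarrow> h z \<in> carr ?S" "\<And>z i. z \<in> carr ?T \<Longrightarrow> i \<in> I \<Longrightarrow> Q i (h z) = \<Theta> i z"
    by metis
  \<comment> \<open>Representations relate to the adjoint through entries, so here the operators are
    compared entrywise.\<close>
  have adj: "Q i (h (cadj ?T x)) = Q i (cadj ?S (h x))" if x: "x \<in> carr ?T" and i: "i \<in> I" for x i
  proof (rule op_eqI)
    show "clin (Q i (h (cadj ?T x)))" "clin (Q i (cadj ?S (h x)))"
      using h x op_repD(1)[OF Q[OF i]] by auto
    show "entry (Q i (h (cadj ?T x))) w v = entry (Q i (cadj ?S (h x))) w v" for w v
      using op_repD(5)[OF Q[OF i] h(1)[OF x]] op_repD(5)[OF \<Theta>[OF i] x] h x i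
      by (simp add: adjoint_entries_def)
  qed
  have "star_hom ?T ?S h"
    unfolding star_hom_def clinear_map_def
  proof (intro conjI ballI allI)
    fix x y c assume x: "x \<in> carr ?T"
    show "h x \<in> carr ?S"
      by (rule h(1)[OF x])
    show "h (cscale ?T c x) = cscale ?S c (h x)"
      using x h by (intro eqI) (auto simp: op_repD(3)[OF Q] op_repD(3)[OF \<Theta>])
    show "h (cadj ?T x) = cadj ?S (h x)"
      using x h adj by (intro eqI) auto
    assume y: "y \<in> carr ?T"
    show "h (cadd ?T x y) = cadd ?S (h x) (h y)"
      using x y h by (intro eqI) (auto simp: op_repD(2)[OF Q] op_repD(2)[OF \<Theta>])
    show "h (cmul ?T x y) = cmul ?S (h x) (h y)"
      using x y h by (intro eqI) (auto simp: op_repD(4)[OF Q] op_repD(4)[OF \<Theta>])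
  qed
  moreover have "h (telem M [A, D] [a, d]) = tjoin2 M [A] Bs a (f d)" if "a \<in> carr A" "d \<in> carr D" for a d
  proof -
    have "telem M [A, D] [a, d] \<in> carr ?T"
      using that by (intro telem_closed AD) (simp add: elementary_pair)
    then show ?thesis
      using that join h elem by (intro eqI) auto
  qed
  ultimately show ?thesis
    unfolding is_tensor_map_iff by blast
qed

section \<open>Slice maps and injectivity\<close>

lemma entry_tensor_rep_length:
  assumes r: "op_rep A r" and s: "op_rep D s" and z: "z \<in> carr (tprod M [A, D])"
    and len: "length zs \<noteq> 2 \<or> length ws \<noteq> 2"
  shows "entry (tensor_rep [A, D] [r, s] z) zs ws = 0"
proof (rule additive_bounded_eq[OF AD _ _ _ z])
  have rs: "list_all2 op_rep [A, D] [r, s]"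
    using r s by simp
  show "additive_bounded (tprod M [A, D]) (\<lambda>z. entry (tensor_rep [A, D] [r, s] z) zs ws)"
    using order_trans[OF norm_entry_le norm_tensor_rep_le[OF AD rs]]
    by (auto intro!: additive_boundedI[where C = 1] simp: tensor_rep_add[OF AD rs] entry_add)
  show "additive_bounded (tprod M [A, D]) (\<lambda>z. 0 :: complex)"
    by (rule additive_boundedI[where C = 0]) auto
  show "entry (tensor_rep [A, D] [r, s] (telem M [A, D] as)) zs ws = 0" if "as \<in> elementary [A, D]" for as
    unfolding tensor_rep_telem[OF AD rs that]
    using len that clin_rep_ops[OF rs that]
    by (intro entry_tensor_ops_length) (auto simp: elementary_pair simp del: tensor_ops.simps)
qed

text \<open>
  Slice maps \<open>\<omega> \<otimes> id\<close>, for the matrix coefficient \<open>\<omega>\<close> of \<open>r\<close> at \<open>(v, w)\<close>.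
\<close>

lemma slice_exists:
  assumes r: "op_rep A r" and z: "z \<in> carr (tprod M [A, D])"
  shows "\<exists>d\<in>carr D. \<forall>s\<in>{s. op_rep D s}. s d = slice v w (tensor_rep [A, D] [r, s] z)"
\<comment> \<open>One element \<open>d\<close> has to serve all \<open>s\<close> at once, so the
  representations of \<open>D\<close> are taken as the jointly isometric family. On an elementary
  tensor the slice is a scalar multiple of its second factor.\<close>
proof (rule lift_from_elementary[OF AD D, where Q = "\<lambda>s. s" and C = 1
      and \<Theta> = "\<lambda>s z. slice v w (tensor_rep [A, D] [r, s] z)"])
  show "\<exists>d\<in>carr D. \<forall>s\<in>{s. op_rep D s}. s d = slice v w (tensor_rep [A, D] [r, s] (telem M [A, D] as))"
    if as: "as \<in> elementary [A, D]" for as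
  proof -
    obtain a d where ad: "as = [a, d]" "a \<in> carr A" "d \<in> carr D"
      using as by (auto simp: elementary_pair)
    have "s (cscale D (entry (r a) v w) d) = slice v w (tensor_rep [A, D] [r, s] (telem M [A, D] as))"
      if s: "op_rep D s" for s
      using ad r s by (simp add: tensor_rep_pair A D slice_tensor_ops op_repD(1)[OF r] op_repD(1,3)[OF s]
          del: tensor_ops.simps)
    then show ?thesis
      using ad cstar_algebra.scale_closed[OF D] by blast
  qed
  fix s :: "'u \<Rightarrow> 'u op" and x y
  assume "s \<in> {s. op_rep D s}"
  then have s: "op_rep D s" and rs: "list_all2 op_rep [A, D] [r, s]"
    using r by auto
  show "s (cadd D x y) = s x + s y" if "x \<in> carr D" "y \<in> carr D"
    using that by (simp add: op_repD[OF s])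
  show "norm (s x) \<le> cnrm D x" if "x \<in> carr D"
    by (rule norm_op_rep_le[OF D s that])
  show "slice v w (tensor_rep [A, D] [r, s] (cadd (tprod M [A, D]) x y))
      = slice v w (tensor_rep [A, D] [r, s] x) + slice v w (tensor_rep [A, D] [r, s] y)"
    if "x \<in> carr (tprod M [A, D])" "y \<in> carr (tprod M [A, D])"
    using that by (simp add: tensor_rep_add[OF AD rs] slice_add)
  show "norm (slice v w (tensor_rep [A, D] [r, s] x)) \<le> 1 * cnrm (tprod M [A, D]) x"
    if "x \<in> carr (tprod M [A, D])"
    using order_trans[OF norm_slice_le norm_tensor_rep_le[OF AD rs that]] by simp
next
  show "cnrm D x \<le> K"
    if "x \<in> carr D" "\<And>s :: 'u \<Rightarrow> 'u op. s \<in> {s. op_rep D s} \<Longrightarrow> norm (s x) \<le> K" for x K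
    using that by (intro op_rep_faithful[OF D]) auto
qed (rule z)

text \<open>Let \<open>d\<close> and \<open>d'\<close> be the same slice of \<open>z\<close> and of
  \<open>z'\<close>. By \<open>tensor_map_rep\<close>, slices in the pulled-back representations
  depend only on \<open>h z\<close>, so \<open>f d = f d'\<close>, and \<open>d = d'\<close> by
  injectivity of \<open>f\<close>. Thus all slices agree in all representations, and they contain
  every entry that can be nonzero.\<close>

lemma tensor_map_inj:
  assumes h: "is_tensor_map M [[A], [D]] [[A], Bs] [id, f] h" and inj: "inj_on f (carr D)"
  shows "inj_on h (carr (tprod M [A, D]))"
proof (rule inj_onI)
  fix z z' assume z: "z \<in> carr (tprod M [A, D])" and z': "z' \<in> carr (tprod M [A, D])" and eq: "h z = h z'"
  show "z = z'"
  proof (rule tensor_rep_eqI[OF AD z z'])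
    fix rs :: "('u \<Rightarrow> 'u op) list" assume rs: "list_all2 op_rep [A, D] rs"
    then obtain r s where rs_eq: "rs = [r, s]" and r: "op_rep A r" and s: "op_rep D s"
      by (auto simp: list_all2_Cons1)
    have slices: "slice v w (tensor_rep [A, D] [r, s] z) = slice v w (tensor_rep [A, D] [r, s] z')" for v w
    proof -
      obtain d where d: "d \<in> carr D" "\<And>s. op_rep D s \<Longrightarrow> s d = slice v w (tensor_rep [A, D] [r, s] z)"
        using slice_exists[OF r z] by blast
      obtain d' where d': "d' \<in> carr D" "\<And>s. op_rep D s \<Longrightarrow> s d' = slice v w (tensor_rep [A, D] [r, s] z')"
        using slice_exists[OF r z'] by blast
      have "tensor_rep Bs us (f d) = tensor_rep Bs us (f d')" if us: "list_all2 op_rep Bs us" for us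
      proof -
        have "pulled_rep us d = pulled_rep us d'"
          using d(2) d'(2) op_rep_pulled_rep[OF us] tensor_map_rep[OF h r us z] tensor_map_rep[OF h r us z'] eq
          by metis
        then have "norm (transport e UNIV (tensor_rep Bs us (f d) - tensor_rep Bs us (f d'))) = 0"
          by (simp add: pulled_rep_def transport_diff)
        then show ?thesis
          by (simp add: norm_transport e)
      qed
      then have "f d = f d'"
        using d d' star_homD(1)[OF f] by (intro tensor_rep_eqI[OF Bs]) auto
      then have "d = d'"
        using inj d d' by (auto dest: inj_onD)
      then show ?thesis
        using d(2)[OF s] d'(2)[OF s] by simp
    qed
    show "tensor_rep [A, D] rs z = tensor_rep [A, D] rs z'"
    proof (rule op_eqI)
      show "clin (tensor_rep [A, D] rs z)" "clin (tensor_rep [A, D] rs z')"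
        by (rule clin_tensor_rep[OF AD rs z] clin_tensor_rep[OF AD rs z'])+
      fix zs ws
      show "entry (tensor_rep [A, D] rs z) zs ws = entry (tensor_rep [A, D] rs z') zs ws"
      proof (cases "length zs = 2 \<and> length ws = 2")
        case True
        then obtain v x w y where "zs = [v, x]" "ws = [w, y]"
          by (auto simp: length_Suc_conv numeral_2_eq_2)
        then show ?thesis
          using slices[of v w] unfolding rs_eq by (metis entry_slice)
      next
        case False
        then show ?thesis
          using z z' by (auto simp: rs_eq entry_tensor_rep_length[OF r s])
      qed
    qed
  qed
qed

text \<open>\<open>tensor_map\<close> is a choice, so existence comes first and injectivity holds
  for every admissible choice. The argument has the form in which \<open>unit_embedding_eq\<close>
  produces it: its second factor is already a value of \<open>f\<close>.\<close>

lemma inv_tensor_map: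
  assumes inj: "inj_on f (carr D)" and a: "a \<in> carr A" and d: "d \<in> carr D"
  shows "inv_into (carr (tprod M [A, D])) (tensor_map M [[A], [D]] [[A], Bs] [id, f]) (tjoin2 M [A] Bs a (f d))
    = telem M [A, D] [a, d]"
proof -
  let ?h = "tensor_map M [[A], [D]] [[A], Bs] [id, f]"
  have h: "is_tensor_map M [[A], [D]] [[A], Bs] [id, f] ?h"
    unfolding tensor_map_def using tensor_map_exists by (rule someI_ex)
  have "telem M [A, D] [a, d] \<in> carr (tprod M [A, D])"
    using a d by (intro telem_closed AD) (simp add: elementary_pair)
  moreover have "?h (telem M [A, D] [a, d]) = tjoin2 M [A] Bs a (f d)"
    using h a d by (simp add: is_tensor_map_iff)
  ultimately show ?thesis
    using inv_into_f_f[OF tensor_map_inj[OF h inj]] by metis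
qed

end

end

section \<open>Partitions\<close>

text \<open>The common point \<open>x\<close> closes the pairs of the left part and opens those of
  the right part, so it has to occur in both.\<close>

lemma zip_tl_append: "zip (u @ x # v) (tl (u @ x # v)) = zip (u @ [x]) (tl (u @ [x])) @ zip (x # v) v"
  by (induction u rule: induct_list012) auto

text \<open>The partitions meet only in \<open>s\<close>, the last point of one and the first of the
  other, so no pair of neighbours is lost or created.\<close>

lemma steps_union:
  assumes I: "I \<in> partitions r s" and J: "J \<in> partitions s t"
  shows "steps (I \<union> J) = steps I @ steps J"
proof -
  have fin: "finite I" "finite J" and I_le: "\<And>x. x \<in> I \<Longrightarrow> x \<le> s" and J_ge: "\<And>x. x \<in> J \<Longrightarrow> s \<le> x"
    and s: "s \<in> I" "s \<in> J"
    using I J by (auto simp: partitions_def)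
  let ?u = "sorted_list_of_set (I - {s})" and ?v = "sorted_list_of_set (J - {s})"
  have u: "sorted_list_of_set I = ?u @ [s]"
  proof (rule sorted_distinct_set_unique)
    show "sorted (?u @ [s])" "distinct (?u @ [s])" "set (sorted_list_of_set I) = set (?u @ [s])"
      using fin I_le s by (auto simp: sorted_append)
  qed auto
  have v: "sorted_list_of_set J = s # ?v"
  proof (rule sorted_distinct_set_unique)
    show "sorted (s # ?v)" "distinct (s # ?v)" "set (sorted_list_of_set J) = set (s # ?v)"
      using fin J_ge s by auto
  qed auto
  have "sorted_list_of_set (I \<union> J) = ?u @ s # ?v"
  proof (rule sorted_distinct_set_unique)
    show "sorted (?u @ s # ?v)"
      using fin I_le J_ge by (auto simp: sorted_append intro: order_trans)
    show "distinct (?u @ s # ?v)"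
      using fin I_le J_ge by (auto dest!: I_le J_ge)
    show "set (sorted_list_of_set (I \<union> J)) = set (?u @ s # ?v)"
      using fin s by auto
  qed auto
  then show ?thesis
    unfolding steps_def u v using zip_tl_append[of ?u s ?v] by (simp add: Let_def)
qed

lemma factors_union: "I \<in> partitions r s \<Longrightarrow> J \<in> partitions s t \<Longrightarrow> factors A (I \<union> J) = factors A I @ factors A J"
  by (simp add: factors_def steps_union)

lemma partitions_union: "r < s \<Longrightarrow> s < t \<Longrightarrow> I \<in> partitions r s \<Longrightarrow> J \<in> partitions s t \<Longrightarrow> I \<union> J \<in> partitions r t"
  by (auto simp: partitions_def)

lemma pair_partition: "s < t \<Longrightarrow> {s, t} \<in> partitions s t"
  by (auto simp: partitions_def)

lemma steps_pair: "s < t \<Longrightarrow> steps {s, t} = [(s, t)]"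
  by (simp add: steps_def)

lemma factors_pair: "s < t \<Longrightarrow> factors A {s, t} = [A s t]"
  by (simp add: factors_def steps_pair)

lemma factors_triple:
  assumes "r < s" "s < t"
  shows "factors A {r, s, t} = [A r s, A s t]"
proof -
  have "{r, s, t} = {r, s} \<union> {s, t}"
    by auto
  then show ?thesis
    using factors_union[OF pair_partition[OF assms(1)] pair_partition[OF assms(2)], of A] assms
    by (simp add: factors_pair)
qed

lemma steps_less:
  assumes "I \<in> partitions s t" "(a, b) \<in> set (steps I)"
  shows "s \<le> a" "a < b"
proof -
  let ?l = "sorted_list_of_set I"
  have fin: "finite I"
    using assms(1) by (simp add: partitions_def)
  obtain i where "i < card I - Suc 0" "a = ?l ! i" "b = ?l ! Suc i"
    using assms(2) by (auto simp: steps_def Let_def set_zip nth_tl)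
  then have i: "Suc i < length ?l" "a = ?l ! i" "b = ?l ! Suc i"
    by simp_all
  then have "a \<in> I"
    using fin by (metis Suc_lessD nth_mem set_sorted_list_of_set)
  then show "s \<le> a"
    using assms(1) by (auto simp: partitions_def)
  show "a < b"
    using strict_sorted_list_of_set[of I] i by (simp add: sorted_wrt_iff_nth_less)
qed

lemma steps_not_Nil:
  assumes "s < t" "I \<in> partitions s t"
  shows "steps I \<noteq> []"
proof -
  have "card {s, t} \<le> card I"
    using assms(2) by (intro card_mono) (auto simp: partitions_def)
  then have "2 \<le> length (sorted_list_of_set I)"
    using assms(1) by simp
  then show ?thesis
    by (cases "sorted_list_of_set I" rule: remdups_adj.cases) (auto simp: steps_def)
qed

section \<open>Homomorphisms\<close>

lemma star_mono_compose: "star_mono A B f \<Longrightarrow> star_mono B C g \<Longrightarrow> star_mono A C (\<lambda>x. g (f x))"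
  by (simp add: star_mono_def star_hom_def clinear_map_def inj_on_def)

lemma star_mono_ident: "star_mono A A (\<lambda>x. x)"
  by (simp add: star_mono_def star_hom_def clinear_map_def inj_on_def)

lemma star_mono_hom: "star_mono A B f \<Longrightarrow> star_hom A B f"
  by (simp add: star_mono_def)

lemma star_mono_inv:
  assumes A: "cstar_algebra A" and f: "star_iso A B f"
  shows "star_mono B A (inv_into (carr A) f)"
proof -
  interpret cstar_algebra A by (rule A)
  let ?g = "inv_into (carr A) f"
  have hom: "star_hom A B f" and inj: "inj_on f (carr A)" and img: "f ` carr A = carr B"
    using f by (auto simp: star_iso_def bij_betw_def)
  have g: "?g y \<in> carr A" "f (?g y) = y" if "y \<in> carr B" for y
    using that img by (metis inv_into_into, metis f_inv_into_f)
  have gI: "?g y = x" if "x \<in> carr A" "f x = y" for x y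
    using that inj by (metis inv_into_f_f)
  have "star_hom B A ?g"
    unfolding star_hom_def clinear_map_def
    using g by (auto intro!: gI simp: star_homD[OF hom])
  moreover have "inj_on ?g (carr B)"
    using img by (simp add: inj_on_inv_into)
  ultimately show ?thesis
    by (simp add: star_mono_def)
qed

text \<open>An infinite set is equipotent with its square. Folding a pairing \<open>q\<close> codes
  lists of a given length injectively, and recording the length separates lists of different
  lengths.\<close>

lemma inj_list_code:
  assumes "infinite (UNIV :: 'u set)"
  obtains e :: "'u list \<Rightarrow> 'u" where "inj e"
proof -
  have "\<exists>q. bij_betw q (UNIV \<times> UNIV :: ('u \<times> 'u) set) (UNIV :: 'u set)"
    unfolding card_of_ordIso using assms by (rule card_of_Times_same_infinite)
  then obtain q :: "'u \<times> 'u \<Rightarrow> 'u" where q: "inj q"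
    by (auto simp: bij_betw_def)
  obtain \<nu> :: "nat \<Rightarrow> 'u" where \<nu>: "inj \<nu>"
    using assms infinite_countable_subset by blast
  define g where "g = (\<lambda>xs. foldr (\<lambda>x y. q (x, y)) xs (\<nu> 0))"
  have g: "xs = ys" if "length xs = length ys" "g xs = g ys" for xs ys
    using that by (induction xs ys rule: list_induct2) (auto simp: g_def dest: injD[OF q])
  have "inj (\<lambda>xs. q (\<nu> (length xs), g xs))"
    by (rule injI) (auto dest!: injD[OF q] injD[OF \<nu>] intro: g)
  then show ?thesis
    by (rule that)
qed

text \<open>The complex multiples of a nonzero element are pairwise distinct.\<close>

lemma cstar_nonzero_infinite:
  fixes A :: "'u cstar"
  assumes A: "cstar_algebra A" and x: "x \<in> carr A" "x \<noteq> czero A"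
  shows "infinite (UNIV :: 'u set)"
proof -
  interpret cstar_algebra A by (rule A)
  have "inj (\<lambda>c. cscale A c x)"
  proof (rule injI)
    fix c d assume "cscale A c x = cscale A d x"
    then have "cscale A (c + - d) x = czero A"
      using x add_scale[of x c "- d"] scale_scale[of x "- 1" d] add_minus[of "cscale A d x"] by simp
    then have "cmod (c + - d) * cnrm A x = 0"
      using x norm_scale[of x "c + - d"] by simp
    then show "c = d"
      using x by (simp add: norm_eq_zero)
  qed
  then show ?thesis
    using infinite_UNIV_char_0[where 'a = complex] finite_imageD[of "\<lambda>c. cscale A c x" UNIV]
      rev_finite_subset by blast
qed

context min_tensors
begin

lemma star_hom_cdist_le:
  fixes A B :: "'u cstar"
  assumes A: "cstar_algebra A" and B: "cstar_algebra B" and f: "star_hom A B f"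
    and x: "x \<in> carr A" and y: "y \<in> carr A"
  shows "cdist B (f x) (f y) \<le> cdist A x y"
proof -
  interpret cstar_algebra A by (rule A)
  have "cdist B (f x) (f y) = cnrm B (f (cadd A x (cscale A (- 1) y)))"
    using x y by (simp add: cdist_def star_homD[OF f])
  then show ?thesis
    using star_hom_contractive[OF A B f, of "cadd A x (cscale A (- 1) y)"] x y by (simp add: cdist_def)
qed

section \<open>Tensoring with a fixed projection\<close>

lemma telem_pair_clinear:
  assumes A: "cstar_algebra A" and B: "cstar_algebra B" and a: "a \<in> carr A" and b: "b \<in> carr B"
  shows "clinear_map A (tprod M [A, B]) (\<lambda>x. telem M [A, B] [x, b])"
    and "clinear_map B (tprod M [A, B]) (\<lambda>y. telem M [A, B] [a, y])"
  using telem_update[OF cstars_pair[OF A B], of "[a, b]" 0] telem_update[OF cstars_pair[OF A B], of "[a, b]" 1] a b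
  by (simp_all add: elementary_pair)

text \<open>At lists of length two, the entry of a product representation on an elementary tensor is
  the product of the entries of its factors.\<close>

lemma telem_pair_eq_imp:
  fixes r s :: "'u \<Rightarrow> 'u op"
  assumes A: "cstar_algebra A" and B: "cstar_algebra B"
    and "a \<in> carr A" "b \<in> carr B" "a' \<in> carr A" "b' \<in> carr B"
    and eq: "telem M [A, B] [a, b] = telem M [A, B] [a', b']"
    and r: "op_rep A r" and s: "op_rep B s"
  shows "entry (r a) z w * entry (s b) x y = entry (r a') z w * entry (s b') x y"
proof -
  have *: "entry (r a) z w * entry (s b) x y = entry (tensor_rep [A, B] [r, s] (telem M [A, B] [a, b])) [z, x] [w, y]"
    if "a \<in> carr A" "b \<in> carr B" for a b
    using entry_slice[of z w "tensor_ops [r a, s b]" x y] that op_repD(1)[OF r] op_repD(1)[OF s]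
    by (simp add: tensor_rep_pair A B r s slice_tensor_ops entry_cmult_compose del: tensor_ops.simps)
  show ?thesis
    using assms(3-6) by (simp add: * eq)
qed

text \<open>Representations separate points, and a complex linear operator with zero matrix is
  zero.\<close>

lemma nonzero_entry:
  assumes A: "cstar_algebra A" and a: "a \<in> carr A" "a \<noteq> czero A"
  obtains r :: "'u \<Rightarrow> 'u op" and z w where "op_rep A r" "entry (r a) z w \<noteq> 0"
proof -
  interpret cstar_algebra A by (rule A)
  have "\<exists>r :: 'u \<Rightarrow> 'u op. op_rep A r \<and> r a \<noteq> r (czero A)"
    using faithful_eq[OF A a(1) zero_closed] a(2) by blast
  then obtain r :: "'u \<Rightarrow> 'u op" where r: "op_rep A r" "r a \<noteq> r (czero A)"
    by blast
  have "r (czero A) = 0"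
    by (rule additive_zero[OF A op_repD(2)[OF r(1)]])
  then have "\<not> (\<forall>z w. entry (r a) z w = entry 0 z w)"
    using r op_eqI[OF op_repD(1)[OF r(1) a(1)] clin_zero] by metis
  then show ?thesis
    using that r(1) by auto
qed

text \<open>Tensoring with \<open>q\<close> respects products and adjoints because \<open>q\<close>
  is idempotent and self-adjoint. For injectivity, a nonzero entry of \<open>q\<close> in some
  representation is cancelled from the matrices of both sides.\<close>

lemma star_mono_telem:
  assumes A: "cstar_algebra A" and B: "cstar_algebra B"
  shows telem_projection_left: "q \<in> carr A \<Longrightarrow> q \<noteq> czero A \<Longrightarrow> cmul A q q = q \<Longrightarrow> cadj A q = q \<Longrightarrow>
      star_mono B (tprod M [A, B]) (\<lambda>x. telem M [A, B] [q, x])"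
    and telem_projection_right: "q \<in> carr B \<Longrightarrow> q \<noteq> czero B \<Longrightarrow> cmul B q q = q \<Longrightarrow> cadj B q = q \<Longrightarrow>
      star_mono A (tprod M [A, B]) (\<lambda>x. telem M [A, B] [x, q])"
proof -
  have mul: "telem M [A, B] [cmul A a a', cmul B b b']
      = cmul (tprod M [A, B]) (telem M [A, B] [a, b]) (telem M [A, B] [a', b'])"
    and adj: "telem M [A, B] [cadj A a, cadj B b] = cadj (tprod M [A, B]) (telem M [A, B] [a, b])"
    if "a \<in> carr A" "b \<in> carr B" "a' \<in> carr A" "b' \<in> carr B" for a b a' b'
    using telem_mul[OF cstars_pair[OF A B], of "[a, b]" "[a', b']"] telem_adj[OF cstars_pair[OF A B], of "[a, b]"]
      that by (simp_all add: elementary_pair)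
  show "star_mono B (tprod M [A, B]) (\<lambda>x. telem M [A, B] [q, x])"
    if q: "q \<in> carr A" "q \<noteq> czero A" "cmul A q q = q" "cadj A q = q"
    unfolding star_mono_def star_hom_def
  proof (intro conjI ballI inj_onI)
    show "clinear_map B (tprod M [A, B]) (\<lambda>x. telem M [A, B] [q, x])"
      by (rule telem_pair_clinear(2)[OF A B q(1) cstar_algebra.zero_closed[OF B]])
    fix x y assume x: "x \<in> carr B"
    show "telem M [A, B] [q, cadj B x] = cadj (tprod M [A, B]) (telem M [A, B] [q, x])"
      using adj[OF q(1) x q(1) x] q by simp
    assume y: "y \<in> carr B"
    show "telem M [A, B] [q, cmul B x y] = cmul (tprod M [A, B]) (telem M [A, B] [q, x]) (telem M [A, B] [q, y])"
      using mul[OF q(1) x q(1) y] q by simp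
    assume eq: "telem M [A, B] [q, x] = telem M [A, B] [q, y]"
    obtain r :: "'u \<Rightarrow> 'u op" and z w where r: "op_rep A r" "entry (r q) z w \<noteq> 0"
      by (rule nonzero_entry[OF A q(1,2)])
    show "x = y"
    proof (rule faithful_eq[OF B x y])
      fix s :: "'u \<Rightarrow> 'u op" assume s: "op_rep B s"
      show "s x = s y"
        using telem_pair_eq_imp[OF A B q(1) x q(1) y eq r(1) s, of z w] r(2)
        by (intro op_eqI op_repD(1)[OF s] x y) simp
    qed
  qed
  show "star_mono A (tprod M [A, B]) (\<lambda>x. telem M [A, B] [x, q])"
    if q: "q \<in> carr B" "q \<noteq> czero B" "cmul B q q = q" "cadj B q = q"
    unfolding star_mono_def star_hom_def
  proof (intro conjI ballI inj_onI)
    show "clinear_map A (tprod M [A, B]) (\<lambda>x. telem M [A, B] [x, q])"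
      by (rule telem_pair_clinear(1)[OF A B cstar_algebra.zero_closed[OF A] q(1)])
    fix x y assume x: "x \<in> carr A"
    show "telem M [A, B] [cadj A x, q] = cadj (tprod M [A, B]) (telem M [A, B] [x, q])"
      using adj[OF x q(1) x q(1)] q by simp
    assume y: "y \<in> carr A"
    show "telem M [A, B] [cmul A x y, q] = cmul (tprod M [A, B]) (telem M [A, B] [x, q]) (telem M [A, B] [y, q])"
      using mul[OF x q(1) y q(1)] q by simp
    assume eq: "telem M [A, B] [x, q] = telem M [A, B] [y, q]"
    obtain s :: "'u \<Rightarrow> 'u op" and z w where s: "op_rep B s" "entry (s q) z w \<noteq> 0"
      by (rule nonzero_entry[OF B q(1,2)])
    show "x = y"
    proof (rule faithful_eq[OF A x y])
      fix r :: "'u \<Rightarrow> 'u op" assume r: "op_rep A r"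
      show "r x = r y"
        using telem_pair_eq_imp[OF A B x q(1) y q(1) eq r s(1), of _ _ z w] s(2)
        by (intro op_eqI op_repD(1)[OF r] x y) simp
    qed
  qed
qed

text \<open>For one factor the defining property covers every element of the algebra, so the choice
  is forced. This evaluates refinements of the trivial partition.\<close>

lemma tensor_map_single:
  assumes A: "cstar_algebra A" and f: "star_hom A (tprod M Bs) f" and x: "x \<in> carr A"
  shows "tensor_map M [[A]] [Bs] [f] x = f x"
proof -
  have "is_tensor_map M [[A]] [Bs] [f] f"
    using A f by (auto simp: is_tensor_map_def tprod_singleton elementary_Cons)
  then have "is_tensor_map M [[A]] [Bs] [f] (tensor_map M [[A]] [Bs] [f])"
    unfolding tensor_map_def by (rule someI[of "is_tensor_map M [[A]] [Bs] [f]"])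
  moreover have "[x] \<in> elementary (map (tprod M) [[A]])"
    using A x by (simp add: tprod_singleton elementary_Cons)
  ultimately show ?thesis
    unfolding is_tensor_map_def by fastforce
qed

end

section \<open>Extending intervals by the unit\<close>

locale unital_dilation = min_tensors M for M :: "'u tensor_choice" +
  fixes A A\<^sub>d :: "real \<Rightarrow> real \<Rightarrow> 'u cstar"
    and \<Delta> \<Delta>\<^sub>d :: "real \<Rightarrow> real \<Rightarrow> real \<Rightarrow> 'u \<Rightarrow> 'u"
    and \<iota> :: "real set \<Rightarrow> 'u \<Rightarrow> 'u"
    and p p\<^sub>d :: "real \<Rightarrow> real \<Rightarrow> 'u"
  assumes subproduct: "subproduct_system M A \<Delta>"
    and dilation: "inductive_dilation M A \<Delta> A\<^sub>d \<Delta>\<^sub>d \<iota>"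
    and unit: "system_unit M A \<Delta> p"
    and dilated_unit: "p\<^sub>d = unit_dilation \<iota> p"
begin

section \<open>The data of the dilation\<close>

lemma cstar_A: "0 < s \<Longrightarrow> s < t \<Longrightarrow> cstar_algebra (A s t)"
  using subproduct by (simp add: subproduct_system_def)

lemma \<Delta>_hom: "0 < r \<Longrightarrow> r < s \<Longrightarrow> s < t \<Longrightarrow> star_hom (A r t) (tprod M [A r s, A s t]) (\<Delta> r s t)"
  using subproduct by (simp add: subproduct_system_def star_mono_def)

lemma limit:
  assumes "0 < s" "s < t"
  shows "inductive_limit (partitions s t) (partition_order s t) (part_alg M A) (refine_map M A \<Delta>) (A\<^sub>d s t) \<iota>"
  using dilation assms by (simp add: inductive_dilation_def)

lemma cstar_Ad: "0 < s \<Longrightarrow> s < t \<Longrightarrow> cstar_algebra (A\<^sub>d s t)"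
  using limit by (simp add: inductive_limit_def)

lemma iota_mono: "0 < s \<Longrightarrow> s < t \<Longrightarrow> I \<in> partitions s t \<Longrightarrow> star_mono (part_alg M A I) (A\<^sub>d s t) (\<iota> I)"
  using dilation by (simp add: inductive_dilation_def)

lemma iota_closed: "0 < s \<Longrightarrow> s < t \<Longrightarrow> I \<in> partitions s t \<Longrightarrow> x \<in> carr (part_alg M A I) \<Longrightarrow> \<iota> I x \<in> carr (A\<^sub>d s t)"
  by (rule star_homD(1)[OF star_mono_hom[OF iota_mono]])

lemma iota_refine:
  assumes "0 < s" "s < t" "I \<in> partitions s t" "J \<in> partitions s t" "I \<subseteq> J" "x \<in> carr (part_alg M A I)"
  shows "\<iota> J (refine_map M A \<Delta> I J x) = \<iota> I x"
proof -
  have "(I, J) \<in> partition_order s t"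
    using assms by (simp add: partition_order_def)
  then show ?thesis
    using limit[OF assms(1,2)] assms(6) unfolding inductive_limit_def by blast
qed

lemma iota_dense:
  assumes "0 < s" "s < t" "b \<in> carr (A\<^sub>d s t)" "e > 0"
  obtains I x where "I \<in> partitions s t" "x \<in> carr (part_alg M A I)" "cdist (A\<^sub>d s t) (\<iota> I x) b < e"
  using limit[OF assms(1,2)] assms(3,4) unfolding inductive_limit_def by blast

lemma \<Delta>d_iso: "0 < r \<Longrightarrow> r < s \<Longrightarrow> s < t \<Longrightarrow> star_iso (A\<^sub>d r t) (tprod M [A\<^sub>d r s, A\<^sub>d s t]) (\<Delta>\<^sub>d r s t)"
  using dilation by (simp add: inductive_dilation_def)

lemma cstars_factors:
  assumes "0 < s" "s < t" "I \<in> partitions s t"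
  shows "cstars (factors A I)"
proof -
  have "cstar_algebra (A a b)" if "(a, b) \<in> set (steps I)" for a b
    using steps_less[OF assms(3) that] assms(1) by (intro cstar_A) auto
  then show ?thesis
    using steps_not_Nil[OF assms(2,3)] by (auto simp: cstars_def factors_def)
qed

lemma part_alg_union:
  "I \<in> partitions r s \<Longrightarrow> J \<in> partitions s t \<Longrightarrow> part_alg M A (I \<union> J) = tprod M (factors A I @ factors A J)"
  by (simp add: part_alg_def factors_union)

lemma part_alg_pair: "0 < s \<Longrightarrow> s < t \<Longrightarrow> part_alg M A {s, t} = A s t"
  by (simp add: part_alg_def factors_pair tprod_singleton cstar_A)

lemma join_closed:
  assumes "0 < r" "r < s" "s < t" "I \<in> partitions r s" "J \<in> partitions s t"
    "x \<in> carr (part_alg M A I)" "y \<in> carr (part_alg M A J)"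
  shows "tjoin2 M (factors A I) (factors A J) x y \<in> carr (part_alg M A (I \<union> J))"
  using tjoin2_closed[OF cstars_factors[of r s I] cstars_factors[of s t J], of x y] assms
  by (simp add: part_alg_union) (simp add: part_alg_def)

text \<open>Read from right to left, this computes the inverse of \<open>\<Delta>\<^sub>d\<close> on
  a dense set, where it is the joining of adjacent partitions.\<close>

lemma \<Delta>d_iota:
  assumes "0 < r" "r < s" "s < t" and I: "I \<in> partitions r s" and J: "J \<in> partitions s t"
    and x: "x \<in> carr (part_alg M A I)" and y: "y \<in> carr (part_alg M A J)"
  shows "\<Delta>\<^sub>d r s t (\<iota> (I \<union> J) (tjoin2 M (factors A I) (factors A J) x y))
    = telem M [A\<^sub>d r s, A\<^sub>d s t] [\<iota> I x, \<iota> J y]"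
proof -
  have "is_tensor_map M [factors A I, factors A J] [[A\<^sub>d r s], [A\<^sub>d s t]] [\<iota> I, \<iota> J] (\<Delta>\<^sub>d r s t \<circ> \<iota> (I \<union> J))"
    using dilation assms by (simp add: inductive_dilation_def)
  moreover have "[x, y] \<in> elementary (map (tprod M) [factors A I, factors A J])"
    using x y by (simp add: elementary_pair part_alg_def)
  ultimately have "(\<Delta>\<^sub>d r s t \<circ> \<iota> (I \<union> J)) (tjoin M [factors A I, factors A J] [x, y])
      = tjoin M [[A\<^sub>d r s], [A\<^sub>d s t]] (map (\<lambda>(f, x). f x) (zip [\<iota> I, \<iota> J] [x, y]))"
    unfolding is_tensor_map_def by blast
  then show ?thesis
    using assms by (simp add: tjoin2_singletons cstar_Ad iota_closed)
qed

lemma unit_projection: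
  assumes "0 < s" "s < t"
  shows "p s t \<in> carr (A s t)" "p s t \<noteq> czero (A s t)" "cmul (A s t) (p s t) (p s t) = p s t"
    "cadj (A s t) (p s t) = p s t"
  using unit assms by (auto simp: system_unit_def)

lemma unit_dilation_eq: "p\<^sub>d s t = \<iota> {s, t} (p s t)"
  by (simp add: dilated_unit unit_dilation_def)

lemma unit_dilation_projection:
  assumes "0 < s" "s < t"
  shows "p\<^sub>d s t \<in> carr (A\<^sub>d s t)" "p\<^sub>d s t \<noteq> czero (A\<^sub>d s t)"
    "cmul (A\<^sub>d s t) (p\<^sub>d s t) (p\<^sub>d s t) = p\<^sub>d s t" "cadj (A\<^sub>d s t) (p\<^sub>d s t) = p\<^sub>d s t"
proof -
  interpret A: cstar_algebra "A s t" by (rule cstar_A[OF assms])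
  interpret Ad: cstar_algebra "A\<^sub>d s t" by (rule cstar_Ad[OF assms])
  have mono: "star_mono (A s t) (A\<^sub>d s t) (\<iota> {s, t})"
    using iota_mono[OF assms pair_partition[OF assms(2)]] assms by (simp add: part_alg_pair)
  note hom = star_mono_hom[OF mono] and p = unit_projection[OF assms]
  show "p\<^sub>d s t \<in> carr (A\<^sub>d s t)"
    using star_homD(1)[OF hom p(1)] by (simp add: unit_dilation_eq)
  show "cmul (A\<^sub>d s t) (p\<^sub>d s t) (p\<^sub>d s t) = p\<^sub>d s t"
    using star_homD(4)[OF hom p(1) p(1)] by (simp add: unit_dilation_eq p)
  show "cadj (A\<^sub>d s t) (p\<^sub>d s t) = p\<^sub>d s t"
    using star_homD(5)[OF hom p(1)] by (simp add: unit_dilation_eq p)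
  have "\<iota> {s, t} (czero (A s t)) = czero (A\<^sub>d s t)"
    using star_homD(3)[OF hom A.zero_closed, of 0] star_homD(1)[OF hom A.zero_closed] by (simp add: Ad.scale_0)
  then show "p\<^sub>d s t \<noteq> czero (A\<^sub>d s t)"
    using mono p(1,2) A.zero_closed unfolding star_mono_def unit_dilation_eq by (metis inj_onD)
qed

text \<open>Refining \<open>{r, t}\<close> to \<open>{r, s, t}\<close> is done by
  \<open>\<Delta>\<close> alone, which sends \<open>p\<close> to \<open>p \<otimes> p\<close>; and
  the maps \<open>\<iota>\<close> are compatible with refinement.\<close>

lemma unit_dilation_split:
  assumes "0 < r" "r < s" "s < t"
  shows "\<iota> {r, s, t} (telem M [A r s, A s t] [p r s, p s t]) = p\<^sub>d r t"
proof -
  have rt: "r < t"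
    using assms by simp
  have "{r, s, t} \<inter> {r..t} = {r, s, t}"
    using assms by auto
  moreover have "split_map M A \<Delta> {r, s, t} = \<Delta> r s t"
    using assms by (simp add: split_map_def)
  ultimately have "refine_map M A \<Delta> {r, t} {r, s, t} (p r t) = \<Delta> r s t (p r t)"
    unfolding refine_map_def steps_pair[OF rt]
    using tensor_map_single[OF cstar_A \<Delta>_hom[OF assms]] unit_projection(1) assms
    by (simp add: factors_triple)
  also have "\<dots> = telem M [A r s, A s t] [p r s, p s t]"
    using unit assms by (simp add: system_unit_def)
  finally show ?thesis
    using iota_refine[of r t "{r, t}" "{r, s, t}" "p r t"] assms unit_projection(1)[of r t]
    by (simp add: part_alg_pair unit_dilation_eq partitions_def)
qed

text \<open>The degenerate case \<open>u = s\<close> is included, so that all four cases of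
  \<open>unit_embedding\<close> become one composite of two one-sided extensions.\<close>

definition extend_left :: "real \<Rightarrow> real \<Rightarrow> real \<Rightarrow> 'u \<Rightarrow> 'u" where
  "extend_left u s t x = (if u = s then x else
     inv_into (carr (A\<^sub>d u t)) (\<Delta>\<^sub>d u s t) (telem M [A\<^sub>d u s, A\<^sub>d s t] [p\<^sub>d u s, x]))"

definition extend_right :: "real \<Rightarrow> real \<Rightarrow> real \<Rightarrow> 'u \<Rightarrow> 'u" where
  "extend_right s t v x = (if t = v then x else
     inv_into (carr (A\<^sub>d s v)) (\<Delta>\<^sub>d s t v) (telem M [A\<^sub>d s t, A\<^sub>d t v] [x, p\<^sub>d t v]))"

lemma extend_left_mono:
  assumes "0 < u" "u \<le> s" "s < t"
  shows "star_mono (A\<^sub>d s t) (A\<^sub>d u t) (extend_left u s t)"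
proof (cases "u = s")
  case True
  then show ?thesis
    by (simp add: extend_left_def[abs_def] star_mono_ident)
next
  case False
  then have u: "u < s" "u < t"
    using assms by auto
  have "star_mono (A\<^sub>d s t) (tprod M [A\<^sub>d u s, A\<^sub>d s t]) (\<lambda>x. telem M [A\<^sub>d u s, A\<^sub>d s t] [p\<^sub>d u s, x])"
    using assms u by (intro telem_projection_left cstar_Ad unit_dilation_projection) auto
  moreover have "star_mono (tprod M [A\<^sub>d u s, A\<^sub>d s t]) (A\<^sub>d u t) (inv_into (carr (A\<^sub>d u t)) (\<Delta>\<^sub>d u s t))"
    using assms u by (intro star_mono_inv cstar_Ad \<Delta>d_iso) auto
  ultimately show ?thesis
    using False star_mono_compose by (simp add: extend_left_def[abs_def])
qed

lemma extend_right_mono: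
  assumes "0 < s" "s < t" "t \<le> v"
  shows "star_mono (A\<^sub>d s t) (A\<^sub>d s v) (extend_right s t v)"
proof (cases "t = v")
  case True
  then show ?thesis
    by (simp add: extend_right_def[abs_def] star_mono_ident)
next
  case False
  then have v: "t < v" "s < v" "0 < t"
    using assms by auto
  have "star_mono (A\<^sub>d s t) (tprod M [A\<^sub>d s t, A\<^sub>d t v]) (\<lambda>x. telem M [A\<^sub>d s t, A\<^sub>d t v] [x, p\<^sub>d t v])"
    using assms v by (intro telem_projection_right cstar_Ad unit_dilation_projection) auto
  moreover have "star_mono (tprod M [A\<^sub>d s t, A\<^sub>d t v]) (A\<^sub>d s v) (inv_into (carr (A\<^sub>d s v)) (\<Delta>\<^sub>d s t v))"
    using assms v by (intro star_mono_inv cstar_Ad \<Delta>d_iso) auto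
  ultimately show ?thesis
    using False star_mono_compose by (simp add: extend_right_def[abs_def])
qed

section \<open>One-sided extensions on the dense images\<close>

lemma inv_\<Delta>d_eqI:
  assumes "0 < r" "r < s" "s < t" "x \<in> carr (A\<^sub>d r t)" "\<Delta>\<^sub>d r s t x = y"
  shows "inv_into (carr (A\<^sub>d r t)) (\<Delta>\<^sub>d r s t) y = x"
  using \<Delta>d_iso[OF assms(1-3)] assms(4,5) inv_into_f_f unfolding star_iso_def bij_betw_def by metis

text \<open>Any representative \<open>x\<close> of the dilated unit over any partition
  \<open>I\<close> may be used, besides \<open>p u s\<close> itself. This freedom lets two
  successive extensions be compared with a single one.\<close>

lemma extend_left_iotaI:
  assumes "0 < u" "u < s" "s < t" "I \<in> partitions u s" "J \<in> partitions s t"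
    "x \<in> carr (part_alg M A I)" "\<iota> I x = p\<^sub>d u s" "y \<in> carr (part_alg M A J)"
  shows "extend_left u s t (\<iota> J y) = \<iota> (I \<union> J) (tjoin2 M (factors A I) (factors A J) x y)"
proof -
  have "\<iota> (I \<union> J) (tjoin2 M (factors A I) (factors A J) x y) \<in> carr (A\<^sub>d u t)"
    using assms by (intro iota_closed partitions_union join_closed) auto
  then show ?thesis
    using assms \<Delta>d_iota[OF assms(1-6,8)] by (simp add: extend_left_def inv_\<Delta>d_eqI)
qed

lemma extend_right_iotaI:
  assumes "0 < s" "s < t" "t < v" "J \<in> partitions s t" "I \<in> partitions t v"
    "y \<in> carr (part_alg M A J)" "x \<in> carr (part_alg M A I)" "\<iota> I x = p\<^sub>d t v"
  shows "extend_right s t v (\<iota> J y) = \<iota> (J \<union> I) (tjoin2 M (factors A J) (factors A I) y x)"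
proof -
  have "\<iota> (J \<union> I) (tjoin2 M (factors A J) (factors A I) y x) \<in> carr (A\<^sub>d s v)"
    using assms by (intro iota_closed partitions_union join_closed) auto
  then show ?thesis
    using assms \<Delta>d_iota[OF assms(1-7)] by (simp add: extend_right_def inv_\<Delta>d_eqI)
qed

lemma extend_left_iota:
  assumes "0 < u" "u < s" "s < t" "J \<in> partitions s t" "y \<in> carr (part_alg M A J)"
  shows "extend_left u s t (\<iota> J y) = \<iota> ({u, s} \<union> J) (tjoin2 M (factors A {u, s}) (factors A J) (p u s) y)"
  using assms unit_projection(1)[of u s]
  by (intro extend_left_iotaI) (auto simp: pair_partition part_alg_pair unit_dilation_eq)

lemma extend_right_iota:
  assumes "0 < s" "s < t" "t < v" "J \<in> partitions s t" "y \<in> carr (part_alg M A J)"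
  shows "extend_right s t v (\<iota> J y) = \<iota> (J \<union> {t, v}) (tjoin2 M (factors A J) (factors A {t, v}) y (p t v))"
  using assms unit_projection(1)[of t v]
  by (intro extend_right_iotaI) (auto simp: pair_partition part_alg_pair unit_dilation_eq)

text \<open>A second representative of the unit over \<open>[r, t]\<close>, on the partition through
  \<open>s\<close>.\<close>

lemma unit_join:
  assumes "0 < r" "r < s" "s < t"
  shows "tjoin2 M (factors A {r, s}) (factors A {s, t}) (p r s) (p s t) \<in> carr (part_alg M A ({r, s} \<union> {s, t}))"
    and "\<iota> ({r, s} \<union> {s, t}) (tjoin2 M (factors A {r, s}) (factors A {s, t}) (p r s) (p s t)) = p\<^sub>d r t"
proof -
  have st: "0 < s"
    using assms by simp
  show "tjoin2 M (factors A {r, s}) (factors A {s, t}) (p r s) (p s t) \<in> carr (part_alg M A ({r, s} \<union> {s, t}))"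
    using assms st unit_projection(1)
    by (intro join_closed[of r s t]) (auto simp: pair_partition part_alg_pair)
  have "{r, s} \<union> {s, t} = {r, s, t}"
    by auto
  then show "\<iota> ({r, s} \<union> {s, t}) (tjoin2 M (factors A {r, s}) (factors A {s, t}) (p r s) (p s t)) = p\<^sub>d r t"
    using assms st unit_dilation_split[OF assms] unit_projection(1)
    by (simp add: factors_pair tjoin2_singletons cstar_A)
qed

text \<open>Homomorphisms are contractive, hence determined by their values on the images of the
  \<open>\<iota> J\<close>, whose union is dense.\<close>

lemma eq_on_dilationI:
  assumes s: "0 < s" "s < t" and B: "cstar_algebra B" and f: "star_hom (A\<^sub>d s t) B f" and g: "star_hom (A\<^sub>d s t) B g"
    and eq: "\<And>J y. J \<in> partitions s t \<Longrightarrow> y \<in> carr (part_alg M A J) \<Longrightarrow> f (\<iota> J y) = g (\<iota> J y)"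
    and x: "x \<in> carr (A\<^sub>d s t)"
  shows "f x = g x"
proof -
  interpret B: cstar_algebra B by (rule B)
  interpret Ad: cstar_algebra "A\<^sub>d s t" by (rule cstar_Ad[OF s])
  show ?thesis
  proof (rule B.cdist_eqI)
    show "f x \<in> carr B" "g x \<in> carr B"
      using star_homD(1)[OF f x] star_homD(1)[OF g x] .
    fix e :: real assume "e > 0"
    then have "e / 2 > 0"
      by simp
    then obtain J y where J: "J \<in> partitions s t" "y \<in> carr (part_alg M A J)"
      and d: "cdist (A\<^sub>d s t) (\<iota> J y) x < e / 2"
      by (rule iota_dense[OF s x])
    have y: "\<iota> J y \<in> carr (A\<^sub>d s t)"
      by (rule iota_closed[OF s J])
    have "cdist B (f x) (g x) \<le> cdist B (f x) (f (\<iota> J y)) + cdist B (g (\<iota> J y)) (g x)"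
      using B.cdist_triangle[of "f x" "f (\<iota> J y)" "g x"] star_homD(1)[OF f] star_homD(1)[OF g] x y eq[OF J] by simp
    also have "\<dots> \<le> cdist (A\<^sub>d s t) x (\<iota> J y) + cdist (A\<^sub>d s t) (\<iota> J y) x"
      by (intro add_mono star_hom_cdist_le cstar_Ad s B f g x y)
    also have "\<dots> \<le> e"
      using d Ad.cdist_commute[OF x y] by simp
    finally show "cdist B (f x) (g x) \<le> e" .
  qed
qed

text \<open>On \<open>\<iota> J y\<close> the extensions put \<open>p u s\<close> and then
  \<open>p w u\<close> in front. Associativity groups these two, and by \<open>unit_join\<close>
  they represent the unit over \<open>[w, s]\<close>.\<close>

lemma extend_left_left:
  assumes "0 < w" "w \<le> u" "u \<le> s" "s < t" and x: "x \<in> carr (A\<^sub>d s t)"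
  shows "extend_left w u t (extend_left u s t x) = extend_left w s t x"
proof (cases "w = u \<or> u = s")
  case True
  then show ?thesis
    by (auto simp: extend_left_def)
next
  case False
  then have o: "w < u" "u < s" "0 < u" "0 < s" "w < s" "u < t" "w < t"
    using assms by auto
  have mono: "star_mono (A\<^sub>d s t) (A\<^sub>d w t) (\<lambda>x. extend_left w u t (extend_left u s t x))"
    by (rule star_mono_compose[OF extend_left_mono extend_left_mono]) (use assms o in auto)
  show ?thesis
  proof (rule eq_on_dilationI[OF _ _ _ star_mono_hom[OF mono] star_mono_hom[OF extend_left_mono] _ x])
    fix J y assume J: "J \<in> partitions s t" and y: "y \<in> carr (part_alg M A J)"
    let ?F = "factors A"
    have pr: "p w u \<in> carr (tprod M (?F {w, u}))" "p u s \<in> carr (tprod M (?F {u, s}))" "y \<in> carr (tprod M (?F J))"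
      using o unit_projection(1) assms y part_alg_pair by (simp_all flip: part_alg_def)
    have c: "cstars (?F {w, u})" "cstars (?F {u, s})" "cstars (?F J)"
      using cstars_factors[of w u "{w, u}"] cstars_factors[of u s "{u, s}"] cstars_factors[of s t J] o assms J
      by (simp_all add: pair_partition)
    have part: "{w, u} \<union> {u, s} \<in> partitions w s"
      by (rule partitions_union[OF o(1,2) pair_partition[OF o(1)] pair_partition[OF o(2)]])
    have "extend_left w u t (extend_left u s t (\<iota> J y))
        = \<iota> ({w, u} \<union> ({u, s} \<union> J)) (tjoin2 M (?F {w, u}) (?F ({u, s} \<union> J)) (p w u)
            (tjoin2 M (?F {u, s}) (?F J) (p u s) y))"
      using o assms J y join_closed[of u s t "{u, s}" J "p u s" y] unit_projection(1)
      by (simp add: extend_left_iota partitions_union pair_partition part_alg_pair del: Un_insert_left Un_insert_right)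
    also have "tjoin2 M (?F {w, u}) (?F ({u, s} \<union> J)) (p w u) (tjoin2 M (?F {u, s}) (?F J) (p u s) y)
        = tjoin2 M (?F ({w, u} \<union> {u, s})) (?F J) (tjoin2 M (?F {w, u}) (?F {u, s}) (p w u) (p u s)) y"
      using tjoin2_assoc[OF c pr] factors_union[OF pair_partition[OF o(2)] J, of A]
        factors_union[OF pair_partition[OF o(1)] pair_partition[OF o(2)], of A]
      by (simp del: Un_insert_left Un_insert_right)
    also have "{w, u} \<union> ({u, s} \<union> J) = ({w, u} \<union> {u, s}) \<union> J"
      by auto
    also have "\<iota> (({w, u} \<union> {u, s}) \<union> J)
        (tjoin2 M (?F ({w, u} \<union> {u, s})) (?F J) (tjoin2 M (?F {w, u}) (?F {u, s}) (p w u) (p u s)) y)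
        = extend_left w s t (\<iota> J y)"
      by (rule extend_left_iotaI[OF assms(1) o(5) assms(4) part J unit_join[OF assms(1) o(1,2)] y, symmetric])
    finally show "extend_left w u t (extend_left u s t (\<iota> J y)) = extend_left w s t (\<iota> J y)" .
  qed (use assms o cstar_Ad in auto)
qed

text \<open>As on the left: the two units appended to \<open>y\<close> are grouped into a
  representative of the unit over \<open>[t, z]\<close>.\<close>

lemma extend_right_right:
  assumes "0 < s" "s < t" "t \<le> v" "v \<le> z" and x: "x \<in> carr (A\<^sub>d s t)"
  shows "extend_right s v z (extend_right s t v x) = extend_right s t z x"
proof (cases "t = v \<or> v = z")
  case True
  then show ?thesis
    by (auto simp: extend_right_def)
next
  case False
  then have o: "t < v" "v < z" "0 < t" "0 < v" "s < v" "t < z" "s < z"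
    using assms by auto
  have mono: "star_mono (A\<^sub>d s t) (A\<^sub>d s z) (\<lambda>x. extend_right s v z (extend_right s t v x))"
    by (rule star_mono_compose[OF extend_right_mono extend_right_mono]) (use assms o in auto)
  show ?thesis
  proof (rule eq_on_dilationI[OF _ _ _ star_mono_hom[OF mono] star_mono_hom[OF extend_right_mono] _ x])
    fix J y assume J: "J \<in> partitions s t" and y: "y \<in> carr (part_alg M A J)"
    let ?F = "factors A"
    have pr: "y \<in> carr (tprod M (?F J))" "p t v \<in> carr (tprod M (?F {t, v}))" "p v z \<in> carr (tprod M (?F {v, z}))"
      using o unit_projection(1) assms y part_alg_pair by (simp_all flip: part_alg_def)
    have c: "cstars (?F J)" "cstars (?F {t, v})" "cstars (?F {v, z})"
      using cstars_factors[of s t J] cstars_factors[of t v "{t, v}"] cstars_factors[of v z "{v, z}"] o assms J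
      by (simp_all add: pair_partition)
    have part: "{t, v} \<union> {v, z} \<in> partitions t z"
      by (rule partitions_union[OF o(1,2) pair_partition[OF o(1)] pair_partition[OF o(2)]])
    have "extend_right s v z (extend_right s t v (\<iota> J y))
        = \<iota> ((J \<union> {t, v}) \<union> {v, z}) (tjoin2 M (?F (J \<union> {t, v})) (?F {v, z})
            (tjoin2 M (?F J) (?F {t, v}) y (p t v)) (p v z))"
      using o assms J y join_closed[of s t v J "{t, v}" y "p t v"] unit_projection(1)
      by (simp add: extend_right_iota partitions_union pair_partition part_alg_pair del: Un_insert_left Un_insert_right)
    also have "tjoin2 M (?F (J \<union> {t, v})) (?F {v, z}) (tjoin2 M (?F J) (?F {t, v}) y (p t v)) (p v z)
        = tjoin2 M (?F J) (?F ({t, v} \<union> {v, z})) y (tjoin2 M (?F {t, v}) (?F {v, z}) (p t v) (p v z))"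
      using tjoin2_assoc[OF c pr] factors_union[OF J pair_partition[OF o(1)], of A]
        factors_union[OF pair_partition[OF o(1)] pair_partition[OF o(2)], of A]
      by (simp del: Un_insert_left Un_insert_right)
    also have "(J \<union> {t, v}) \<union> {v, z} = J \<union> ({t, v} \<union> {v, z})"
      by auto
    also have "\<iota> (J \<union> ({t, v} \<union> {v, z}))
        (tjoin2 M (?F J) (?F ({t, v} \<union> {v, z})) y (tjoin2 M (?F {t, v}) (?F {v, z}) (p t v) (p v z)))
        = extend_right s t z (\<iota> J y)"
      by (rule extend_right_iotaI[OF assms(1,2) o(6) J part y unit_join[OF o(3,1,2)], symmetric])
    finally show "extend_right s v z (extend_right s t v (\<iota> J y)) = extend_right s t z (\<iota> J y)" .
  qed (use assms o cstar_Ad in auto)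
qed

text \<open>Units are added at opposite ends, so the two orders differ only in the bracketing of a
  threefold tensor product.\<close>

lemma extend_right_left:
  assumes "0 < u" "u \<le> s" "s < t" "t \<le> v" and x: "x \<in> carr (A\<^sub>d s t)"
  shows "extend_right u t v (extend_left u s t x) = extend_left u s v (extend_right s t v x)"
proof (cases "u = s \<or> t = v")
  case True
  then show ?thesis
    by (auto simp: extend_left_def extend_right_def)
next
  case False
  then have o: "u < s" "t < v" "0 < s" "0 < t" "u < t" "s < v" "u < v"
    using assms by auto
  have mono: "star_mono (A\<^sub>d s t) (A\<^sub>d u v) (\<lambda>x. extend_right u t v (extend_left u s t x))"
    "star_mono (A\<^sub>d s t) (A\<^sub>d u v) (\<lambda>x. extend_left u s v (extend_right s t v x))"
    by (rule star_mono_compose[OF extend_left_mono extend_right_mono]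
        star_mono_compose[OF extend_right_mono extend_left_mono]; use assms o in auto)+
  show ?thesis
  proof (rule eq_on_dilationI[OF _ _ _ star_mono_hom[OF mono(1)] star_mono_hom[OF mono(2)] _ x])
    fix J y assume J: "J \<in> partitions s t" and y: "y \<in> carr (part_alg M A J)"
    let ?F = "factors A"
    have pr: "p u s \<in> carr (tprod M (?F {u, s}))" "y \<in> carr (tprod M (?F J))" "p t v \<in> carr (tprod M (?F {t, v}))"
      using o unit_projection(1) assms y part_alg_pair by (simp_all flip: part_alg_def)
    have c: "cstars (?F {u, s})" "cstars (?F J)" "cstars (?F {t, v})"
      using cstars_factors[of u s "{u, s}"] cstars_factors[of s t J] cstars_factors[of t v "{t, v}"] o assms J
      by (simp_all add: pair_partition)
    have "extend_right u t v (extend_left u s t (\<iota> J y))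
        = \<iota> (({u, s} \<union> J) \<union> {t, v}) (tjoin2 M (?F ({u, s} \<union> J)) (?F {t, v})
            (tjoin2 M (?F {u, s}) (?F J) (p u s) y) (p t v))"
      using o assms J y join_closed[of u s t "{u, s}" J "p u s" y] unit_projection(1)
      by (simp add: extend_left_iota extend_right_iota partitions_union pair_partition part_alg_pair
          del: Un_insert_left Un_insert_right)
    also have "tjoin2 M (?F ({u, s} \<union> J)) (?F {t, v}) (tjoin2 M (?F {u, s}) (?F J) (p u s) y) (p t v)
        = tjoin2 M (?F {u, s}) (?F (J \<union> {t, v})) (p u s) (tjoin2 M (?F J) (?F {t, v}) y (p t v))"
      using tjoin2_assoc[OF c pr] factors_union[OF pair_partition[OF o(1)] J, of A]
        factors_union[OF J pair_partition[OF o(2)], of A]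
      by (simp del: Un_insert_left Un_insert_right)
    also have "({u, s} \<union> J) \<union> {t, v} = {u, s} \<union> (J \<union> {t, v})"
      by auto
    also have "\<iota> ({u, s} \<union> (J \<union> {t, v})) (tjoin2 M (?F {u, s}) (?F (J \<union> {t, v})) (p u s)
        (tjoin2 M (?F J) (?F {t, v}) y (p t v))) = extend_left u s v (extend_right s t v (\<iota> J y))"
      using o assms J y join_closed[of s t v J "{t, v}" y "p t v"] unit_projection(1)
      by (simp add: extend_left_iota extend_right_iota partitions_union pair_partition part_alg_pair
          del: Un_insert_left Un_insert_right)
    finally show "extend_right u t v (extend_left u s t (\<iota> J y)) = extend_left u s v (extend_right s t v (\<iota> J y))" .
  qed (use assms o cstar_Ad in auto)
qed

text \<open>The two-sided case is the point: the tensor \<open>p \<otimes> x \<otimes> p\<close>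
  equals \<open>p \<otimes> \<Delta>\<^sub>d y\<close> for the right extension \<open>y\<close> of
  \<open>x\<close>, so the inverse of \<open>id \<otimes> \<Delta>\<^sub>d\<close> returns
  \<open>p \<otimes> y\<close>.\<close>

lemma unit_embedding_eq:
  assumes "0 < u" "u \<le> s" "s < t" "t \<le> v" and x: "x \<in> carr (A\<^sub>d s t)"
  shows "unit_embedding M A\<^sub>d \<Delta>\<^sub>d p\<^sub>d (s, t) (u, v) x = extend_left u s v (extend_right s t v x)"
proof (cases "u = s \<or> t = v")
  case True
  then show ?thesis
    by (auto simp: unit_embedding_def extend_left_def extend_right_def)
next
  case False
  then have o: "u < s" "t < v" "0 < s" "0 < t" "s < v"
    using assms by auto
  \<comment> \<open>Lists can be coded because the dilated unit over \<open>[u, s]\<close> is a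
    nonzero element.\<close>
  obtain e :: "'u list \<Rightarrow> 'u" where e: "inj e"
    by (rule inj_list_code[OF cstar_nonzero_infinite[OF cstar_Ad[OF assms(1) o(1)]
          unit_dilation_projection(1,2)[OF assms(1) o(1)]]])
  let ?Bs = "[A\<^sub>d s t, A\<^sub>d t v]" and ?y = "extend_right s t v x"
  have C: "cstar_algebra (A\<^sub>d u s)" "cstar_algebra (A\<^sub>d s t)" "cstar_algebra (A\<^sub>d t v)" "cstar_algebra (A\<^sub>d s v)"
    using assms o by (auto intro: cstar_Ad)
  have iso: "star_hom (A\<^sub>d s v) (tprod M ?Bs) (\<Delta>\<^sub>d s t v)" "inj_on (\<Delta>\<^sub>d s t v) (carr (A\<^sub>d s v))"
    "\<Delta>\<^sub>d s t v ` carr (A\<^sub>d s v) = carr (tprod M ?Bs)"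
    using \<Delta>d_iso[OF o(3) assms(3) o(2)] by (auto simp: star_iso_def bij_betw_def)
  have y: "?y \<in> carr (A\<^sub>d s v)"
    using star_homD(1)[OF star_mono_hom[OF extend_right_mono] x] assms o by auto
  have p: "p\<^sub>d u s \<in> carr (A\<^sub>d u s)" "p\<^sub>d t v \<in> carr (A\<^sub>d t v)"
    using assms o unit_dilation_projection(1) by auto
  have xp: "[x, p\<^sub>d t v] \<in> elementary ?Bs"
    using x p by (simp add: elementary_pair)
  have "\<Delta>\<^sub>d s t v ?y = telem M ?Bs [x, p\<^sub>d t v]"
    using o iso(3) telem_closed[OF cstars_pair[OF C(2,3)] xp] by (simp add: extend_right_def f_inv_into_f)
  then have "telem M [A\<^sub>d u s, A\<^sub>d s t, A\<^sub>d t v] [p\<^sub>d u s, x, p\<^sub>d t v] = tjoin2 M [A\<^sub>d u s] ?Bs (p\<^sub>d u s) (\<Delta>\<^sub>d s t v ?y)"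
    using tjoin2_telem[OF cstars_single[OF C(1)] cstars_pair[OF C(2,3)], of "[p\<^sub>d u s]" "[x, p\<^sub>d t v]"] xp p C
    by (simp add: telem_singleton elementary_Cons)
  then show ?thesis
    using False o inv_tensor_map[OF C(1,4) cstars_pair[OF C(2,3)] iso(1) e iso(2) p(1) y]
    by (simp add: unit_embedding_def extend_left_def)
qed

lemma unit_embedding_mono:
  assumes "0 < u" "u \<le> s" "s < t" "t \<le> v"
  shows "star_mono (A\<^sub>d s t) (A\<^sub>d u v) (unit_embedding M A\<^sub>d \<Delta>\<^sub>d p\<^sub>d (s, t) (u, v))"
proof -
  interpret cstar_algebra "A\<^sub>d s t" by (rule cstar_Ad) (use assms in auto)
  have "star_mono (A\<^sub>d s t) (A\<^sub>d u v) (\<lambda>x. extend_left u s v (extend_right s t v x))"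
    by (rule star_mono_compose[OF extend_right_mono extend_left_mono]) (use assms in auto)
  then show ?thesis
    using assms by (simp add: star_mono_def star_hom_def clinear_map_def inj_on_def unit_embedding_eq)
qed

text \<open>\<open>L R L R = L L R R = L R\<close>: the inner pair is commuted, and then both sides
  are merged.\<close>

lemma unit_embedding_compose:
  assumes "0 < w" "w \<le> u" "u \<le> s" "s < t" "t \<le> v" "v \<le> z" and x: "x \<in> carr (A\<^sub>d s t)"
  shows "unit_embedding M A\<^sub>d \<Delta>\<^sub>d p\<^sub>d (u, v) (w, z) (unit_embedding M A\<^sub>d \<Delta>\<^sub>d p\<^sub>d (s, t) (u, v) x)
    = unit_embedding M A\<^sub>d \<Delta>\<^sub>d p\<^sub>d (s, t) (w, z) x"
proof -
  have R: "extend_right s t v x \<in> carr (A\<^sub>d s v)"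
    by (rule star_homD(1)[OF star_mono_hom[OF extend_right_mono] x]) (use assms in auto)
  have RR: "extend_right s t z x \<in> carr (A\<^sub>d s z)"
    by (rule star_homD(1)[OF star_mono_hom[OF extend_right_mono] x]) (use assms in auto)
  have L: "extend_left u s v (extend_right s t v x) \<in> carr (A\<^sub>d u v)"
    by (rule star_homD(1)[OF star_mono_hom[OF extend_left_mono] R]) (use assms in auto)
  have "unit_embedding M A\<^sub>d \<Delta>\<^sub>d p\<^sub>d (u, v) (w, z) (unit_embedding M A\<^sub>d \<Delta>\<^sub>d p\<^sub>d (s, t) (u, v) x)
      = extend_left w u z (extend_right u v z (extend_left u s v (extend_right s t v x)))"
    using assms L by (simp add: unit_embedding_eq)
  also have "\<dots> = extend_left w u z (extend_left u s z (extend_right s v z (extend_right s t v x)))"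
    using assms R by (simp add: extend_right_left)
  also have "\<dots> = extend_left w s z (extend_right s t z x)"
    using assms x RR by (simp add: extend_right_right extend_left_left)
  finally show ?thesis
    using assms by (simp add: unit_embedding_eq)
qed

end

text \<open>Inclusion of open intervals is comparison of endpoints because the smaller interval is
  nonempty.\<close>

lemma interval_order_iff:
  "((s, t), (u, v)) \<in> interval_order \<longleftrightarrow> 0 < u \<and> u \<le> s \<and> s < t \<and> t \<le> v"
  by (auto simp: interval_order_def intervals_def greaterThanLessThan_subseteq_greaterThanLessThan)

theorem proposition5p1:
  fixes M :: "'u tensor_choice"
    and A A\<^sub>d :: "real \<Rightarrow> real \<Rightarrow> 'u cstar"
    and \<Delta> \<Delta>\<^sub>d :: "real \<Rightarrow> real \<Rightarrow> real \<Rightarrow> 'u \<Rightarrow> 'u"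
    and \<iota> :: "real set \<Rightarrow> 'u \<Rightarrow> 'u"
    and p p\<^sub>d :: "real \<Rightarrow> real \<Rightarrow> 'u"
  assumes "min_tensor_products M"
    and "subproduct_system M A \<Delta>"
    and "unital_system M A \<Delta>"
    and "inductive_dilation M A \<Delta> A\<^sub>d \<Delta>\<^sub>d \<iota>"
    and "system_unit M A \<Delta> p"
    and "p\<^sub>d = unit_dilation \<iota> p"
  shows "(\<forall>s t u v. 0 < u \<and> u \<le> s \<and> s < t \<and> t \<le> v \<longrightarrow>
            star_mono (A\<^sub>d s t) (A\<^sub>d u v) (unit_embedding M A\<^sub>d \<Delta>\<^sub>d p\<^sub>d (s, t) (u, v))) \<and>
         inductive_system intervals interval_order (\<lambda>(s, t). A\<^sub>d s t)
           (unit_embedding M A\<^sub>d \<Delta>\<^sub>d p\<^sub>d)"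
proof -
  interpret unital_dilation M A A\<^sub>d \<Delta> \<Delta>\<^sub>d \<iota> p p\<^sub>d
    using assms by unfold_locales auto
  have "inductive_system intervals interval_order (\<lambda>(s, t). A\<^sub>d s t) (unit_embedding M A\<^sub>d \<Delta>\<^sub>d p\<^sub>d)"
    unfolding inductive_system_def
  proof (intro conjI ballI allI impI)
    show "intervals \<noteq> {}"
    proof -
      have "(1, 2) \<in> intervals"
        by (simp add: intervals_def)
      then show ?thesis
        by blast
    qed
    show "partial_order_on intervals interval_order"
      unfolding partial_order_on_def preorder_on_def
      by (auto simp: refl_on_def trans_def antisym_def interval_order_iff intervals_def)
  next
    fix i j assume i: "i \<in> intervals" and j: "j \<in> intervals"
    obtain s t s' t' where st: "i = (s, t)" "j = (s', t')"
      by (cases i, cases j) auto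
    \<comment> \<open>Directedness: the interval hull of both serves as upper bound.\<close>
    show "\<exists>k\<in>intervals. (i, k) \<in> interval_order \<and> (j, k) \<in> interval_order"
      using i j by (intro bexI[where x = "(min s s', max t t')"])
        (auto simp: st intervals_def interval_order_iff min_def max_def)
  next
    fix i assume "i \<in> intervals"
    then show "cstar_algebra (case i of (s, t) \<Rightarrow> A\<^sub>d s t)"
      by (auto simp: intervals_def cstar_Ad)
  next
    fix i j assume "(i, j) \<in> interval_order"
    then show "star_hom (case i of (s, t) \<Rightarrow> A\<^sub>d s t) (case j of (s, t) \<Rightarrow> A\<^sub>d s t) (unit_embedding M A\<^sub>d \<Delta>\<^sub>d p\<^sub>d i j)"
      by (cases i, cases j) (auto simp: interval_order_iff intro: star_mono_hom unit_embedding_mono)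
  next
    fix i x
    show "unit_embedding M A\<^sub>d \<Delta>\<^sub>d p\<^sub>d i i x = x"
      by (cases i) (simp add: unit_embedding_def)
  next
    fix i j k x assume ij: "(i, j) \<in> interval_order" and jk: "(j, k) \<in> interval_order"
      and x: "x \<in> carr (case i of (s, t) \<Rightarrow> A\<^sub>d s t)"
    obtain s t u v w z where eqs: "i = (s, t)" "j = (u, v)" "k = (w, z)"
      by (cases i, cases j, cases k) auto
    show "unit_embedding M A\<^sub>d \<Delta>\<^sub>d p\<^sub>d j k (unit_embedding M A\<^sub>d \<Delta>\<^sub>d p\<^sub>d i j x) = unit_embedding M A\<^sub>d \<Delta>\<^sub>d p\<^sub>d i k x"
      using ij jk x unfolding eqs interval_order_iff by (intro unit_embedding_compose) auto
  qed
  then show ?thesis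
    using unit_embedding_mono by blast
qed

end
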